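(* For every $n\ge 1$ there is a constant $c_n>0$ depending only on $n$ such that, for all $0<\delta<1$, all $1\le p<\infty$, every $w\in A_\infty$ and every $u\in\mathcal{F}_w$, $$\left(\int_{\mathbb{R}^n}|u(x)|^p\,w(x)\,dx\right)^{1/p}\le c_n\,p\,(1-\delta)^{1/p}\,[w]_{A_\infty}\left(\int_{\mathbb{R}^n}\int_{\mathbb{R}^n}\frac{|u(x)-u(y)|^p}{|x-y|^{n+\delta p}}\,dy\,M_{\delta p}(w)(x)\,dx\right)^{1/p}.$$
   Context: A cube in $\mathbb{R}^n$ is a cartesian product of $n$ intervals of the same side length $\ell(Q)$. A weight is a function $w\in L^1_{\mathrm{loc}}(\mathbb{R}^n)$ with $w(x)>0$ for a.e. $x$; $w(Q)=\int_Q w\,dx$. For a weight $w$, $\mathcal{F}_w$ is the class of functions $u\in L^1_{\mathrm{loc}}(\mathbb{R}^n)\cap L^1_{\mathrm{loc}}(\mathbb{R}^n;w\,dx)$ for which there exists an increasing sequence of cubes $\{Q_j\}_{j\in\mathbb{N}}$ with $\mathbb{R}^n=\bigcup_j Q_j$ and $\lim_{j\to\infty}\frac1{w(Q_j)}\int_{Q_j}u\,w\,dx=0$. For $1<q<\infty$, $w\in A_q$ means $\sup_Q \left(\frac1{|Q|}\int_Q w\,dx\right)\left(\frac1{|Q|}\int_Q w^{1-q'}\,dx\right)^{q-1}<\infty$ (sup over all cubes, $q'=q/(q-1)$); $w\in A_1$ means there is $C>0$ with $\frac1{|Q|}\int_Q w\,dx\le C\operatorname{ess\,inf}_{Q}w$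 for all cubes $Q$. $A_\infty=\bigcup_{1\le q<\infty}A_q$ and $[w]_{A_\infty}=\sup_Q\frac1{w(Q)}\int_Q M(w\chi_Q)(x)\,dx$, where $M=M_0$. For $\alpha\ge0$, the fractional maximal function is $M_\alpha f(x)=\sup_{R\ni x}\ell(R)^\alpha\frac1{|R|}\int_R|f(y)|\,dy$, the supremum over all cubes $R$ in $\mathbb{R}^n$ containing $x$. *)

theory Defs
  imports "HOL-Analysis.Analysis"
begin

text \<open>
  All integrals of nonnegative functions, the maximal functions and the weight constants take
  values in \<^typ>\<open>ennreal\<close>, because each of them may be infinite; the library has no real
  powers on that type.
\<close>

definition ennreal_powr :: "ennreal \<Rightarrow> real \<Rightarrow> ennreal" where
  "ennreal_powr x r = (if x = top then top else ennreal (enn2real x powr r))" \<comment> \<open>only for \<open>r > 0\<close>\<close>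

text \<open>
  The sides of a cube are parallel to the axes, and each of the intervals may be open, closed or
  half-open. The side length is positive, since averages over cubes divide by the volume.
\<close>

definition cube_with_side :: "real \<Rightarrow> (real ^ 'n) set \<Rightarrow> bool" where
  "cube_with_side l Q \<longleftrightarrow> 0 < l \<and>
     (\<exists>a I. (\<forall>i. {a i <..< a i + l} \<subseteq> I i \<and> I i \<subseteq> {a i .. a i + l}) \<and>
            Q = {x. \<forall>i. x $ i \<in> I i})"

definition cubes :: "(real ^ 'n) set set" where
  "cubes = {Q. \<exists>l. cube_with_side l Q}"

definition L1_loc :: "(real ^ 'n) measure \<Rightarrow> (real ^ 'n \<Rightarrow> real) set" where
  "L1_loc \<mu> = {f. \<forall>K. compact K \<longrightarrow> set_integrable \<mu> K f}"

definition weight :: "(real ^ 'n \<Rightarrow> real) \<Rightarrow> bool" where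
  "weight w \<longleftrightarrow> w \<in> L1_loc lebesgue \<and> (AE x in lebesgue. 0 < w x)"

definition weight_measure :: "(real ^ 'n \<Rightarrow> real) \<Rightarrow> (real ^ 'n) measure" where
  "weight_measure w = density lebesgue (\<lambda>x. ennreal (w x))"

definition F_class :: "(real ^ 'n \<Rightarrow> real) \<Rightarrow> (real ^ 'n \<Rightarrow> real) set" where
  "F_class w = {u. u \<in> L1_loc lebesgue \<and> u \<in> L1_loc (weight_measure w) \<and>
     (\<exists>Q :: nat \<Rightarrow> (real ^ 'n) set.
        (\<forall>j. Q j \<in> cubes) \<and> incseq Q \<and> (\<Union>j. Q j) = UNIV \<and>
        (\<lambda>j. 1 / measure (weight_measure w) (Q j) * (LINT x:Q j|lebesgue. u x * w x))
          \<longlonglongrightarrow> 0)}"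

definition nn_average :: "(real ^ 'n) set \<Rightarrow> (real ^ 'n \<Rightarrow> real) \<Rightarrow> ennreal" where
  "nn_average Q f = (\<integral>\<^sup>+x\<in>Q. ennreal (f x) \<partial>lebesgue) / emeasure lebesgue Q"

definition ess_inf_on :: "(real ^ 'n) set \<Rightarrow> (real ^ 'n \<Rightarrow> real) \<Rightarrow> ennreal" where
  "ess_inf_on Q w = Sup {c. AE x in lebesgue. x \<in> Q \<longrightarrow> c \<le> ennreal (w x)}"

text \<open>The value is meaningful for \<open>1 \<le> q\<close>; the exponent \<open>q / (q - 1)\<close> is the conjugate of \<open>q\<close>.\<close>

definition A_class :: "real \<Rightarrow> (real ^ 'n \<Rightarrow> real) set" where
  "A_class q = {w. weight w \<and>
     (if q = 1 then
        \<exists>C>0. \<forall>Q\<in>cubes. nn_average Q w \<le> ennreal C * ess_inf_on Q w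
      else
        (SUP Q\<in>cubes. nn_average Q w *
           ennreal_powr (nn_average Q (\<lambda>x. w x powr (1 - q / (q - 1)))) (q - 1)) < top)}"

definition A_infinity :: "(real ^ 'n \<Rightarrow> real) set" where
  "A_infinity = (\<Union>q\<in>{1..}. A_class q)"

definition frac_maximal :: "real \<Rightarrow> (real ^ 'n \<Rightarrow> real) \<Rightarrow> real ^ 'n \<Rightarrow> ennreal" where
  "frac_maximal \<alpha> f x =
     (SUP (l, R) \<in> {(l, R). cube_with_side l R \<and> x \<in> R}.
        ennreal (l powr \<alpha>) * nn_average R (\<lambda>y. \<bar>f y\<bar>))"

definition A_infinity_const :: "(real ^ 'n \<Rightarrow> real) \<Rightarrow> ennreal" where
  "A_infinity_const w =
     (SUP Q\<in>cubes. (\<integral>\<^sup>+x\<in>Q. frac_maximal 0 (\<lambda>y. w y * indicator Q y) x \<partial>lebesgue)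
        / emeasure (weight_measure w) Q)"

end

theory Submission
  imports Defs
begin

text \<open>
  The whole-space inequality is a limit of inequalities on cubes. On a cube \<open>Q\<close> of the exhausting
  sequence, \<open>u\<close> minus its weighted average satisfies the estimate with a constant that depends neither
  on \<open>Q\<close> nor on \<open>u\<close> (\<open>cube_poincare\<close> and \<open>mean_deviation_powr\<close>); the averages tend to zero by the
  definition of the class, and Fatou's lemma gives the statement.

  On one cube three ideas are combined. All of them live on the grid of dyadic subcubes of \<open>Q\<close>, and
  countable additivity over the maximal dyadic cubes with a given property (\<open>reach_le\<close>) turns
  inequalities on single dyadic cubes into inequalities for unions of them.

  The factor \<open>1 - \<delta>\<close> comes from the unweighted inequality \<open>bbm_poincare\<close>. Inserting the midpoint
  between two points compares the differences of \<open>v\<close> at distance at most \<open>d / 2 ^ k\<close> with those at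
  half that distance; the fractional energy is a weighted sum of these quantities over all scales,
  and the comparison bounds it below by a geometric series with ratio \<open>2 powr (- (1 - \<delta>) * p)\<close>, whose
  sum is of size \<open>1 / ((1 - \<delta>) * p)\<close>.

  The linear dependence on \<open>p\<close> and on the weight constant comes from the inequality \<open>good_lambda\<close>.
  Where all mean oscillations of a function with values in \<open>[0, 1]\<close> are at most \<open>\<gamma>\<close>, its dyadic
  averages need many steps of size comparable to \<open>\<gamma>\<close> to climb from \<open>1 / 2\<close> to nearly \<open>1\<close>. Each step
  halves the Lebesgue measure locally, so the cubes of all steps form a sparse family, and the
  Fujii--Wilson condition says that the weight of such a family is packed
  (\<open>carleson_packing\<close>): about \<open>4 * W\<close> steps halve the weighted measure. With \<open>\<gamma>\<close> of size
  \<open>1 / (p * W)\<close> there is room for about \<open>p\<close> halvings, a gain that beats the factor \<open>2 powr p\<close> lost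
  between consecutive dyadic levels of \<open>u\<close>.

  What is left is the weighted measure of the set where some oscillation exceeds \<open>\<gamma>\<close>. For one
  function it satisfies a weak-type bound by the energy integrated against the fractional maximal
  function (\<open>osc_weak_type_weighted\<close>). A strong-type bound follows by applying it to the truncations
  of \<open>u\<close> between consecutive dyadic levels, since the energies of the truncations add up to at most
  that of \<open>u\<close> (\<open>sum_gagliardo_truncate\<close>); this is Maz'ya's truncation method.

  The maximal functions enter through their dyadic versions, which are pointwise lower bounds and are
  Borel measurable as countable suprema of step functions.
\<close>

section \<open>Dyadic cells and the stopping principle\<close>

text \<open>
  Whatever part of its boundary a cube contains, it is squeezed between an open and a closed box that
  differ by a null set.
\<close>

lemma cube_lebesgue:
  fixes b :: "real ^ 'n"
  assumes s: "0 < s" and R: "{x. \<forall>i. b $ i < x $ i \<and> x $ i < b $ i + s} \<subseteq> R"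
      "R \<subseteq> {x. \<forall>i. b $ i \<le> x $ i \<and> x $ i \<le> b $ i + s}"
  shows "R \<in> sets lebesgue" "emeasure lebesgue R = ennreal (s ^ CARD('n))"
    "AE x in lebesgue. x \<in> R \<longleftrightarrow> x \<in> box b (\<chi> i. b $ i + s)"
proof -
  define c where "c = (\<chi> i. b $ i + s)"
  have bx: "{x. \<forall>i. b $ i < x $ i \<and> x $ i < b $ i + s} = box b c"
    by (auto simp: mem_box_cart c_def)
  have cb: "{x. \<forall>i. b $ i \<le> x $ i \<and> x $ i \<le> b $ i + s} = cbox b c"
    by (auto simp: mem_box_cart c_def)
  have sub: "box b c \<subseteq> R" "R \<subseteq> cbox b c" using R bx cb by auto
  have N: "cbox b c - box b c \<in> null_sets lebesgue"
  proof -
    have "negligible (cbox b c - box b c)" by (rule negligible_frontier_interval)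
    then show ?thesis by (simp add: negligible_iff_null_sets)
  qed
  have N2: "R - box b c \<in> null_sets lebesgue"
  proof (rule null_sets_completion_subset)
    show "R - box b c \<subseteq> cbox b c - box b c" using sub by auto
    show "cbox b c - box b c \<in> null_sets lebesgue" by (rule N)
  qed
  have Req: "R = box b c \<union> (R - box b c)" using sub by auto
  show S: "R \<in> sets lebesgue"
    using null_setsD2[OF N2] Req by (metis sets.Un lborelD box_borel sets_completionI_sets sets_lborel)
  have "emeasure lebesgue R = emeasure lebesgue (box b c)"
    using emeasure_Un_null_set[OF _ N2, of "box b c"] Req by simp
  also have "\<dots> = emeasure lborel (box b c)" by simp
  also have "\<dots> = ennreal (\<Prod>k\<in>Basis. (c - b) \<bullet> k)"
  proof (rule emeasure_lborel_box)
    fix k :: "real ^ 'n" assume "k \<in> Basis"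
    then obtain i where "k = axis i 1" by (auto simp: Basis_vec_def)
    then show "b \<bullet> k \<le> c \<bullet> k" using s by (simp add: inner_axis c_def)
  qed
  also have "(\<Prod>k\<in>Basis. (c - b) \<bullet> k) = s ^ CARD('n)"
  proof -
    have "(\<Prod>k\<in>Basis. (c - b) \<bullet> k) = (\<Prod>k\<in>(Basis :: (real^'n) set). s)"
    proof (rule prod.cong, simp)
      fix k :: "real ^ 'n" assume "k \<in> Basis"
      then obtain i where "k = axis i 1" by (auto simp: Basis_vec_def)
      then show "(c - b) \<bullet> k = s" by (simp add: inner_axis c_def)
    qed
    also have "\<dots> = s ^ CARD('n)" by simp
    finally show ?thesis .
  qed
  finally show "emeasure lebesgue R = ennreal (s ^ CARD('n))" .
  show "AE x in lebesgue. x \<in> R \<longleftrightarrow> x \<in> box b (\<chi> i. b $ i + s)"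
    using AE_not_in[OF N2] by eventually_elim (use sub c_def in auto)
qed

locale dyadic_grid =
  fixes a :: "real ^ 'n" and l :: real
  assumes l: "0 < l"
begin

text \<open>
  The half-open dyadic cube of generation \<open>m\<close> through a point is the class of that point under equality
  of scaled and rounded coordinates. Two cells that meet are thus equal or nested without any index
  bookkeeping.
\<close>

definition cell :: "nat \<Rightarrow> real ^ 'n \<Rightarrow> (real ^ 'n) set" where
  "cell m x = {y. \<forall>i. \<lfloor>2 ^ m * ((y $ i - a $ i) / l)\<rfloor> = \<lfloor>2 ^ m * ((x $ i - a $ i) / l)\<rfloor>}"

definition corner :: "nat \<Rightarrow> real ^ 'n \<Rightarrow> real ^ 'n" where
  "corner m x = (\<chi> i. a $ i + l / 2 ^ m * of_int \<lfloor>2 ^ m * ((x $ i - a $ i) / l)\<rfloor>)"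

lemma cell_alt: "cell m x = {y. \<forall>i. corner m x $ i \<le> y $ i \<and> y $ i < corner m x $ i + l / 2 ^ m}"
proof -
  have *: "\<lfloor>2 ^ m * ((s - b) / l)\<rfloor> = k \<longleftrightarrow> b + l / 2 ^ m * of_int k \<le> s \<and> s < b + l / 2 ^ m * of_int k + l / 2 ^ m"
    for s b :: real and k :: int
    unfolding floor_eq_iff using l by (auto simp: field_simps)
  show ?thesis unfolding cell_def corner_def * vec_lambda_beta by (rule refl)
qed

lemma cell_self [simp, intro]: "x \<in> cell m x" by (simp add: cell_def)

lemma cell_eq: "y \<in> cell m x \<Longrightarrow> cell m y = cell m x" by (simp add: cell_def)

lemma cell_Suc: "cell (Suc m) x \<subseteq> cell m x"
proof
  fix y assume y: "y \<in> cell (Suc m) x"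
  have *: "\<lfloor>2 ^ m * t\<rfloor> = \<lfloor>2 ^ Suc m * t\<rfloor> div 2" for t :: real
    using floor_divide_real_eq_div[of 2 "2 ^ Suc m * t"] by simp
  show "y \<in> cell m x" using y unfolding cell_def * by (simp del: power_Suc)
qed

lemma cell_mono: "k \<le> m \<Longrightarrow> cell m x \<subseteq> cell k x"
  by (rule lift_Suc_antimono_le[of "\<lambda>m. cell m x"]) (rule cell_Suc)

lemma cell_eq_le: "y \<in> cell m x \<Longrightarrow> k \<le> m \<Longrightarrow> cell k y = cell k x"
  using cell_mono cell_eq by blast

lemma cell_borel [measurable]: "cell m x \<in> sets borel"
  unfolding cell_alt by measurable

lemma cell_squeeze: "{y. \<forall>i. corner m x $ i < y $ i \<and> y $ i < corner m x $ i + l / 2 ^ m} \<subseteq> cell m x"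
      "cell m x \<subseteq> {y. \<forall>i. corner m x $ i \<le> y $ i \<and> y $ i \<le> corner m x $ i + l / 2 ^ m}"
  unfolding cell_alt by (auto simp: less_imp_le)

lemma cell_emeasure: "emeasure lborel (cell m x) = ennreal ((l / 2 ^ m) ^ CARD('n))"
  using cube_lebesgue(2)[OF _ cell_squeeze[of m x]] l by simp

lemma cell_measure: "measure lborel (cell m x) = (l / 2 ^ m) ^ CARD('n)"
  using cell_emeasure l unfolding measure_def by simp

lemma cell_measure_pos: "0 < measure lborel (cell m x)"
  unfolding cell_measure using l by (intro zero_less_power divide_pos_pos) auto

lemma cell_emeasure_eq: "emeasure lborel (cell m x) = ennreal (measure lborel (cell m x))"
  by (simp add: cell_measure cell_emeasure)

lemma cell_fmeasurable: "cell m x \<in> fmeasurable lborel"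
  by (rule fmeasurableI) (auto simp: cell_emeasure)

lemma cell_measure_Suc: "measure lborel (cell m x) = 2 ^ CARD('n) * measure lborel (cell (Suc m) x)"
  unfolding cell_measure power_mult_distrib[symmetric] by simp

lemma cell_cube: "cube_with_side (l / 2 ^ m) (cell m x)"
  unfolding cube_with_side_def
  by (intro conjI exI[of _ "\<lambda>i. corner m x $ i"]
      exI[of _ "\<lambda>i. {corner m x $ i ..< corner m x $ i + l / 2 ^ m}"])
     (use l in \<open>simp_all add: cell_alt subset_eq\<close>)

lemma cell_convex: "convex (cell m x)"
proof -
  have "cell m x = (\<Inter>i. {y. corner m x $ i \<le> y $ i} \<inter> {y. y $ i < corner m x $ i + l / 2 ^ m})"
    unfolding cell_alt by auto
  moreover have "convex {y::real^'n. c \<le> y $ i}" "convex {y::real^'n. y $ i < c}" for c i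
    using convex_halfspace_ge[of c "axis i 1 :: real^'n"] convex_halfspace_lt[of "axis i 1 :: real^'n" c]
    by (simp_all add: inner_axis inner_commute)
  ultimately show ?thesis by (auto intro!: convex_INT convex_Int)
qed

lemma cell_diam:
  assumes "y \<in> cell m x" "z \<in> cell m x"
  shows "norm (y - z) \<le> sqrt CARD('n) * (l / 2 ^ m)"
proof -
  have "norm (y - z) \<le> sqrt (\<Sum>i\<in>(UNIV::'n set). (l / 2 ^ m)\<^sup>2)"
    unfolding norm_vec_def L2_set_def
  proof (intro real_sqrt_le_mono sum_mono)
    fix i
    have "\<bar>y $ i - z $ i\<bar> \<le> l / 2 ^ m"
      using assms unfolding cell_alt by (smt (verit) mem_Collect_eq)
    then have "\<bar>y $ i - z $ i\<bar>\<^sup>2 \<le> (l / 2 ^ m)\<^sup>2" by (intro power_mono) auto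
    then show "(norm ((y - z) $ i))\<^sup>2 \<le> (l / 2 ^ m)\<^sup>2" by simp
  qed
  also have "\<dots> = sqrt CARD('n) * (l / 2 ^ m)"
    using l by (simp add: real_sqrt_mult)
  finally show ?thesis .
qed

lemma cell_countable: "countable {cell m x | m x. True}"
proof -
  have "{cell m x | m x. True} \<subseteq> (\<lambda>(m, k :: 'n \<Rightarrow> int). {y. \<forall>i. \<lfloor>2 ^ m * ((y $ i - a $ i) / l)\<rfloor> = k i}) ` UNIV"
    unfolding cell_def by force
  then show ?thesis by (rule countable_subset) auto
qed

lemma cell_small:
  assumes "open S" "x \<in> S"
  shows "\<exists>m. cell m x \<subseteq> S"
proof -
  obtain e where e: "0 < e" "ball x e \<subseteq> S" using assms openE by blast
  have "(\<lambda>m. sqrt CARD('n) * l * (1/2) ^ m) \<longlonglongrightarrow> sqrt CARD('n) * l * 0"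
    by (intro tendsto_intros LIMSEQ_power_zero) auto
  then have "eventually (\<lambda>m. sqrt CARD('n) * l * (1/2) ^ m < e) sequentially"
    using e(1) by (auto dest: order_tendstoD)
  then obtain m where m: "sqrt CARD('n) * l * (1/2) ^ m < e"
    by (auto simp: eventually_sequentially)
  have "cell m x \<subseteq> ball x e"
  proof
    fix y assume "y \<in> cell m x"
    then have "norm (x - y) \<le> sqrt CARD('n) * (l / 2 ^ m)" by (intro cell_diam) auto
    also have "\<dots> < e" using m by (simp add: power_divide)
    finally show "y \<in> ball x e" by (simp add: dist_norm)
  qed
  then show ?thesis using e by blast
qed

text \<open>
  Unions of cells with a property are described pointwise; the maximal cells with the property are
  found by stopping at the first generation at which it holds.
\<close>

definition reach :: "((real ^ 'n) set \<Rightarrow> bool) \<Rightarrow> (real ^ 'n) set" where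
  "reach P = {x. \<exists>m. P (cell m x)}"

lemma reach_UN: "reach P = \<Union>{cell m x | m x. P (cell m x)}"
proof (intro equalityI subsetI)
  fix x assume "x \<in> \<Union>{cell m x | m x. P (cell m x)}"
  then obtain m y where "x \<in> cell m y" "P (cell m y)" by auto
  then show "x \<in> reach P" unfolding reach_def using cell_eq[of x m y] by (simp, metis)
qed (auto simp: reach_def)

lemma reach_borel [measurable]: "reach P \<in> sets borel"
  unfolding reach_UN
  by (rule sets.countable_Union) (auto intro: countable_subset[OF _ cell_countable])

lemma reach_mono: "(\<And>m x. P (cell m x) \<Longrightarrow> P' (cell m x)) \<Longrightarrow> reach P \<subseteq> reach P'"
  unfolding reach_def by auto

text \<open>
  The first cells with the property partition the reached set into countably many pieces, so a
  comparison of two measures on these pieces adds up. Every covering argument below is an instance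
  of this stopping principle.
\<close>

lemma reach_le:
  assumes sets: "sets M = sets borel" "sets N = sets borel"
    and le: "\<And>m x. P (cell m x) \<Longrightarrow> (\<And>k. k < m \<Longrightarrow> \<not> P (cell k x)) \<Longrightarrow> emeasure M (cell m x) \<le> emeasure N (cell m x)"
  shows "emeasure M (reach P) \<le> emeasure N (reach P)"
proof -
  define F where "F = {cell m x | m x. P (cell m x) \<and> (\<forall>k<m. \<not> P (cell k x))}"
  have U: "reach P = (\<Union>R\<in>F. R)"
  proof (intro equalityI subsetI)
    fix x assume "x \<in> reach P"
    then have ex: "\<exists>m. P (cell m x)" by (simp add: reach_def)
    define m where "m = (LEAST m. P (cell m x))"
    have "P (cell m x)" unfolding m_def by (rule LeastI_ex[OF ex])
    moreover have "\<forall>k<m. \<not> P (cell k x)" unfolding m_def by (auto dest: not_less_Least)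
    ultimately have "cell m x \<in> F" by (auto simp: F_def)
    then show "x \<in> (\<Union>R\<in>F. R)" by blast
  next
    fix x assume "x \<in> (\<Union>R\<in>F. R)"
    then show "x \<in> reach P" unfolding F_def reach_UN by auto
  qed
  have cF: "countable F" by (rule countable_subset[OF _ cell_countable]) (auto simp: F_def)
  have dF: "disjoint_family_on (\<lambda>R. R) F"
    unfolding disjoint_family_on_def
  proof (intro ballI impI, rule ccontr)
    fix R R' assume R: "R \<in> F" "R' \<in> F" "R \<noteq> R'" "R \<inter> R' \<noteq> {}"
    then obtain z where z: "z \<in> R" "z \<in> R'" by auto
    obtain m x where m: "R = cell m x" "P (cell m x)" "\<forall>k<m. \<not> P (cell k x)" using R by (auto simp: F_def)
    obtain m' x' where m': "R' = cell m' x'" "P (cell m' x')" "\<forall>k<m'. \<not> P (cell k x')" using R by (auto simp: F_def)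
    have eq: "cell k x = cell k z" if "k \<le> m" for k using cell_eq_le z(1) m(1) that by metis
    have eq': "cell k x' = cell k z" if "k \<le> m'" for k using cell_eq_le z(2) m'(1) that by metis
    have "m = m'"
      by (rule linorder_cases[of m m']) (use m m' eq eq' in \<open>metis less_imp_le order_refl\<close>)+
    then show False using eq eq' m m' R by auto
  qed
  have mF: "R \<in> sets borel" if "R \<in> F" for R using that by (auto simp: F_def)
  have "emeasure M (reach P) = (\<integral>\<^sup>+R. emeasure M R \<partial>count_space F)"
    unfolding U by (rule emeasure_UN_countable) (use sets mF cF dF in auto)
  also have "\<dots> \<le> (\<integral>\<^sup>+R. emeasure N R \<partial>count_space F)"
    by (rule nn_integral_mono) (use le in \<open>auto simp: F_def\<close>)
  also have "\<dots> = emeasure N (reach P)"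
    unfolding U by (rule emeasure_UN_countable[symmetric]) (use sets mF cF dF in auto)
  finally show ?thesis .
qed

end

section \<open>A fractional Poincare inequality with the factor 1 - delta\<close>

lemma nn_integral_reflect_dilate:
  fixes f :: "real ^ 'n \<Rightarrow> ennreal"
  assumes [measurable]: "f \<in> borel_measurable borel"
  shows "(\<integral>\<^sup>+y. f y \<partial>lborel) = 2 ^ CARD('n) * (\<integral>\<^sup>+z. f (2 *\<^sub>R z - x) \<partial>lborel)"
proof -
  have "(\<integral>\<^sup>+y. f y \<partial>lborel) = (\<integral>\<^sup>+y. f y \<partial>density (distr lborel borel (\<lambda>z. - x + 2 *\<^sub>R z)) (\<lambda>_. ennreal (\<bar>2\<bar> ^ DIM(real^'n))))"
    by (subst lborel_affine[of 2 "- x"]) auto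
  also have "\<dots> = 2 ^ CARD('n) * (\<integral>\<^sup>+z. f (- x + 2 *\<^sub>R z) \<partial>lborel)"
    by (simp add: nn_integral_density nn_integral_distr nn_integral_cmult flip: ennreal_power)
  finally show ?thesis by simp
qed

lemma powr_add_le:
  fixes s t p :: real
  assumes "1 \<le> p" "0 \<le> s" "0 \<le> t"
  shows "(s + t) powr p \<le> 2 powr (p - 1) * (s powr p + t powr p)"
proof -
  have one: "1 \<le> 2 powr (p - 1)" using assms by (intro ge_one_powr_ge_zero) auto
  show ?thesis
  proof (cases "s = 0 \<or> t = 0")
    case True
    then show ?thesis using mult_right_mono[OF one, of "s powr p"] mult_right_mono[OF one, of "t powr p"] assms by auto
  next
    case False
    have "((1 - 1/2) *\<^sub>R s + (1/2) *\<^sub>R t) powr p \<le> (1 - 1/2) * s powr p + (1/2) * t powr p"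
      using assms False by (intro convex_onD[OF powr_convex]) auto
    then have "((s + t) / 2) powr p \<le> (s powr p + t powr p) / 2"
    proof -
      have "(1 - 1/2) *\<^sub>R s + (1/2) *\<^sub>R t = (s + t) / 2" by simp
      moreover have "(1 - 1/2) * s powr p + (1/2) * t powr p = (s powr p + t powr p) / 2" by simp
      ultimately show ?thesis using \<open>_ \<le> (1 - 1/2) * s powr p + (1/2) * t powr p\<close> by metis
    qed
  then have "(s + t) powr p / 2 powr p \<le> (s powr p + t powr p) / 2"
    using assms by (simp add: powr_divide)
  then show ?thesis by (simp add: powr_diff field_simps)
  qed
qed

text \<open>
  The terms that are present form a geometric progression with ratio at least \<open>2\<close>, so the sum is at most
  twice the last one, and the last one is controlled by \<open>t\<close>.
\<close>

lemma sum_dyadic_powr_le: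
  fixes t q :: real
  assumes q: "1 \<le> q" and t: "0 < t"
  shows "(\<Sum>k<N. if t \<le> 1 / 2 ^ k then (2 powr q) ^ k else 0) \<le> 2 * t powr (- q)"
proof -
  define r :: real where "r = 2 powr q"
  have r: "2 \<le> r" using q powr_mono[of 1 q 2] by (simp add: r_def)
  have top: "r ^ k \<le> t powr (- q)" if "t \<le> 1 / 2 ^ k" for k
  proof -
    have "(1 / 2 ^ k) powr (- q) \<le> t powr (- q)"
      using that t q by (intro powr_mono2') auto
    moreover have "(1 / 2 ^ k) powr (- q) = r ^ k"
      unfolding r_def by (simp add: powr_minus powr_divide powr_power powr_realpow[symmetric] powr_powr mult.commute)
    ultimately show ?thesis by simp
  qed
  have "(\<Sum>k<N. if t \<le> 1 / 2 ^ k then r ^ k else 0) \<le> 2 * t powr (- q) \<and>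
      (t \<le> 2 / 2 ^ N \<longrightarrow> (\<Sum>k<N. if t \<le> 1 / 2 ^ k then r ^ k else 0) \<le> r ^ N)"
  proof (induction N)
    case (Suc N)
    have "r ^ N + r ^ N \<le> r ^ Suc N" using r by (simp add: mult_right_mono flip: mult_2)
    moreover have "t \<le> 1 / 2 ^ N \<Longrightarrow> t \<le> 2 / 2 ^ N" by (erule order_trans) (simp add: divide_right_mono)
    ultimately show ?case using Suc.IH top[of N] by auto
  qed simp
  then show ?thesis unfolding r_def by blast
qed

text \<open>
  Let \<open>I k\<close> collect the \<open>p\<close>-th powers of the differences over pairs at distance at most \<open>d / 2 ^ k\<close>. Passing
  through the midpoint, which stays in the convex set, replaces a pair by two pairs at half the
  distance, at the cost of the factor \<open>2 powr p\<close> from convexity and of the Jacobian \<open>2 ^ n\<close>. Hence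
  \<open>I 0 \<le> E ^ k * I k\<close> with \<open>E = 2 powr (p + n)\<close>. The kernel dominates a sum of \<open>I k\<close> with weights
  \<open>2 powr (q * k)\<close>, equal to \<open>E ^ k\<close> times \<open>r ^ k\<close> with a ratio \<open>r < 1\<close> that is close to \<open>1\<close>
  when \<open>\<delta>\<close> is close to \<open>1\<close>; this is where \<open>1 - \<delta>\<close> is gained.
\<close>

lemma bbm_poincare:
  fixes v :: "real ^ 'n \<Rightarrow> real" and R :: "(real ^ 'n) set"
  assumes v [measurable]: "v \<in> borel_measurable borel" and R [measurable]: "R \<in> sets borel"
    and conv: "convex R" and diam: "\<And>x y. x \<in> R \<Longrightarrow> y \<in> R \<Longrightarrow> norm (x - y) \<le> d" and d: "0 < d"
    and \<delta>: "0 < \<delta>" "\<delta> < 1" and p: "1 \<le> p"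
  defines "q \<equiv> real CARD('n) + \<delta> * p"
  shows "(\<integral>\<^sup>+x\<in>R. (\<integral>\<^sup>+y\<in>R. ennreal (\<bar>v x - v y\<bar> powr p) \<partial>lborel) \<partial>lborel)
    \<le> ennreal (2 * p * (1 - \<delta>) * d powr q) *
      (\<integral>\<^sup>+x\<in>R. (\<integral>\<^sup>+y\<in>R. ennreal (\<bar>v x - v y\<bar> powr p / norm (x - y) powr q) \<partial>lborel) \<partial>lborel)"
proof -
  define g where "g x y = ennreal (\<bar>v x - v y\<bar> powr p)" for x y
  define K where "K x y = ennreal (\<bar>v x - v y\<bar> powr p / norm (x - y) powr q)" for x y
  define near where "near k x y = (indicator {(x, y). x \<in> R \<and> y \<in> R \<and> norm (x - y) \<le> d / 2 ^ k} (x, y) :: ennreal)" for k :: nat and x y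
  define I where "I k = (\<integral>\<^sup>+x. \<integral>\<^sup>+y. g x y * near k x y \<partial>lborel \<partial>lborel)" for k
  have gm [measurable]: "(\<lambda>z. g (fst z) (snd z)) \<in> borel_measurable (borel \<Otimes>\<^sub>M borel)"
    unfolding g_def by measurable
  have Km [measurable]: "(\<lambda>z. K (fst z) (snd z)) \<in> borel_measurable (borel \<Otimes>\<^sub>M borel)"
    unfolding K_def by measurable
  have nearm [measurable]: "(\<lambda>z. near k (fst z) (snd z)) \<in> borel_measurable (borel \<Otimes>\<^sub>M borel)" for k
    unfolding near_def by measurable
  note [measurable] = measurable_compose[OF _ gm, of "\<lambda>x. (f x, h x)" for f h, simplified]
    measurable_compose[OF _ nearm, of "\<lambda>x. (f x, h x)" for f h, simplified]
    measurable_compose[OF _ Km, of "\<lambda>x. (f x, h x)" for f h, simplified]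
  have step: "I k \<le> ennreal (2 powr (p + CARD('n))) * I (Suc k)" for k
  proof -
    define h where "h x y = g x ((1/2) *\<^sub>R (x + y)) * near k x y" for x y
    have hm [measurable]: "(\<lambda>z. h (fst z) (snd z)) \<in> borel_measurable (borel \<Otimes>\<^sub>M borel)"
      unfolding h_def by measurable
    note [measurable] = measurable_compose[OF _ hm, of "\<lambda>x. (f x, h x)" for f h, simplified]
    have "g x y * near k x y \<le> ennreal (2 powr (p - 1)) * (h x y + h y x)" for x y
    proof -
      define z where "z = (1/2) *\<^sub>R (x + y)"
      have "\<bar>v x - v y\<bar> powr p \<le> (\<bar>v x - v z\<bar> + \<bar>v y - v z\<bar>) powr p"
        using p by (intro powr_mono2) auto
      also have "\<dots> \<le> 2 powr (p - 1) * (\<bar>v x - v z\<bar> powr p + \<bar>v y - v z\<bar> powr p)"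
        using p by (intro powr_add_le) auto
      finally have "g x y \<le> ennreal (2 powr (p - 1)) * (g x z + g y z)"
        unfolding g_def by (simp add: ennreal_leI flip: ennreal_plus ennreal_mult)
      then have "g x y * near k x y \<le> (ennreal (2 powr (p - 1)) * (g x z + g y z)) * near k x y"
        by (rule mult_right_mono) simp
      moreover have "near k y x = near k x y" unfolding near_def by (auto simp: indicator_def norm_minus_commute)
      ultimately show ?thesis unfolding h_def z_def[symmetric] by (simp add: z_def algebra_simps)
    qed
    then have "I k \<le> (\<integral>\<^sup>+x. \<integral>\<^sup>+y. ennreal (2 powr (p - 1)) * (h x y + h y x) \<partial>lborel \<partial>lborel)"
      unfolding I_def by (intro nn_integral_mono)
    also have "\<dots> = ennreal (2 powr (p - 1)) * ((\<integral>\<^sup>+x. \<integral>\<^sup>+y. h x y \<partial>lborel \<partial>lborel) + (\<integral>\<^sup>+x. \<integral>\<^sup>+y. h y x \<partial>lborel \<partial>lborel))"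
      by (simp add: nn_integral_cmult nn_integral_add)
    also have "(\<integral>\<^sup>+x. \<integral>\<^sup>+y. h y x \<partial>lborel \<partial>lborel) = (\<integral>\<^sup>+x. \<integral>\<^sup>+y. h x y \<partial>lborel \<partial>lborel)"
      by (rule lborel_pair.Fubini') (simp add: split_beta')
    also have "(\<integral>\<^sup>+x. \<integral>\<^sup>+y. h x y \<partial>lborel \<partial>lborel) \<le> 2 ^ CARD('n) * I (Suc k)"
    proof -
      have "(\<integral>\<^sup>+y. h x y \<partial>lborel) \<le> 2 ^ CARD('n) * (\<integral>\<^sup>+z. g x z * near (Suc k) x z \<partial>lborel)" for x
      proof -
        have "(\<integral>\<^sup>+y. h x y \<partial>lborel) = 2 ^ CARD('n) * (\<integral>\<^sup>+z. h x (2 *\<^sub>R z - x) \<partial>lborel)"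
          by (rule nn_integral_reflect_dilate) simp
        also have "(\<integral>\<^sup>+z. h x (2 *\<^sub>R z - x) \<partial>lborel) \<le> (\<integral>\<^sup>+z. g x z * near (Suc k) x z \<partial>lborel)"
        proof (rule nn_integral_mono)
          fix z
          have "near k x (2 *\<^sub>R z - x) \<le> near (Suc k) x z"
          proof (cases "x \<in> R \<and> 2 *\<^sub>R z - x \<in> R \<and> norm (x - (2 *\<^sub>R z - x)) \<le> d / 2 ^ k")
            case True
            have "(1/2) *\<^sub>R x + (1/2) *\<^sub>R (2 *\<^sub>R z - x) \<in> R"
              using True by (intro convexD[OF conv]) auto
            moreover have "(1/2) *\<^sub>R x + (1/2) *\<^sub>R (2 *\<^sub>R z - x) = z" by (simp add: algebra_simps)
            moreover have "x - (2 *\<^sub>R z - x) = 2 *\<^sub>R (x - z)" by (simp add: algebra_simps scaleR_2)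
            then have "norm (x - (2 *\<^sub>R z - x)) = 2 * norm (x - z)" by (metis norm_scaleR abs_numeral)
            then have "norm (x - z) \<le> d / 2 ^ Suc k" using True by (simp add: field_simps)
            ultimately show ?thesis using True by (simp add: near_def)
          qed (simp add: near_def)
          moreover have "(1/2) *\<^sub>R (x + (2 *\<^sub>R z - x)) = z" by simp
          ultimately show "h x (2 *\<^sub>R z - x) \<le> g x z * near (Suc k) x z"
            unfolding h_def by (simp add: mult_left_mono)
        qed
        finally show ?thesis by (simp add: mult_left_mono)
      qed
      then have "(\<integral>\<^sup>+x. \<integral>\<^sup>+y. h x y \<partial>lborel \<partial>lborel) \<le> (\<integral>\<^sup>+x. 2 ^ CARD('n) * (\<integral>\<^sup>+z. g x z * near (Suc k) x z \<partial>lborel) \<partial>lborel)"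
        by (intro nn_integral_mono)
      then show ?thesis unfolding I_def by (simp add: nn_integral_cmult)
    qed
    finally have "I k \<le> ennreal (2 powr (p - 1)) * (2 ^ CARD('n) * I (Suc k) + 2 ^ CARD('n) * I (Suc k))"
      by (simp add: mult_left_mono add_mono)
    also have "\<dots> = ennreal (2 powr (p - 1) * 2 ^ CARD('n) * 2) * I (Suc k)"
      by (simp add: ennreal_mult algebra_simps flip: ennreal_power mult_2)
    also have "2 powr (p - 1) * 2 ^ CARD('n) * 2 = 2 powr (p + CARD('n))"
      by (simp add: powr_add powr_diff powr_realpow)
    finally show ?thesis .
  qed
  define E where "E = 2 powr (p + CARD('n))"
  have E: "0 < E" by (simp add: E_def)
  have steps: "I 0 \<le> ennreal (E ^ k) * I k" for k
  proof (induction k)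
    case (Suc k)
    have "I 0 \<le> ennreal (E ^ k) * (ennreal E * I (Suc k))"
      using Suc.IH step[of k] unfolding E_def[symmetric] by (meson mult_left_mono order_trans zero_le)
    then show ?case using E by (simp add: ennreal_mult mult_ac)
  qed simp
  define r where "r = 2 powr (- ((1 - \<delta>) * p))"
  define s where "s = (1 - \<delta>) * p"
  have s: "0 < s" using \<delta> p by (simp add: s_def)
  have r: "0 < r" "r < 1" using \<delta> p by (auto simp: r_def powr_less_one)
  have rE: "r ^ k * E ^ k = (2 powr q) ^ k" for k
  proof -
    have "r * E = 2 powr q" by (simp add: r_def E_def q_def algebra_simps flip: powr_add)
    then show ?thesis by (metis power_mult_distrib)
  qed
  have q1: "1 \<le> q" unfolding q_def using \<delta> p by (intro add_increasing2) (auto simp: Suc_le_eq)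
  define J where "J = (\<integral>\<^sup>+x. \<integral>\<^sup>+y. K x y * near 0 x y \<partial>lborel \<partial>lborel)"
  have partial: "(\<Sum>k<N. ennreal (r ^ k)) * I 0 \<le> ennreal (2 * d powr q) * J" for N
  proof -
    have "(\<Sum>k<N. ennreal (r ^ k)) * I 0 = (\<Sum>k<N. ennreal (r ^ k) * I 0)" by (simp add: sum_distrib_right)
    also have "\<dots> \<le> (\<Sum>k<N. ennreal ((2 powr q) ^ k) * I k)"
    proof (rule sum_mono)
      fix k
      have "ennreal (r ^ k) * I 0 \<le> ennreal (r ^ k) * (ennreal (E ^ k) * I k)"
        using steps[of k] by (rule mult_left_mono) simp
      also have "\<dots> = ennreal ((2 powr q) ^ k) * I k"
        using r E by (simp add: rE mult.assoc[symmetric] flip: ennreal_mult)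
      finally show "ennreal (r ^ k) * I 0 \<le> ennreal ((2 powr q) ^ k) * I k" .
    qed
    also have "\<dots> = (\<integral>\<^sup>+x. \<integral>\<^sup>+y. (\<Sum>k<N. ennreal ((2 powr q) ^ k) * (g x y * near k x y)) \<partial>lborel \<partial>lborel)"
      unfolding I_def by (simp add: nn_integral_sum nn_integral_cmult)
    also have "\<dots> \<le> (\<integral>\<^sup>+x. \<integral>\<^sup>+y. ennreal (2 * d powr q) * (K x y * near 0 x y) \<partial>lborel \<partial>lborel)"
    proof (intro nn_integral_mono)
      fix x y :: "real ^ 'n"
      show "(\<Sum>k<N. ennreal ((2 powr q) ^ k) * (g x y * near k x y)) \<le> ennreal (2 * d powr q) * (K x y * near 0 x y)"
      proof (cases "x \<in> R \<and> y \<in> R \<and> x \<noteq> y")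
        case True
        define t where "t = norm (x - y) / d"
        have t: "0 < t" using True d by (simp add: t_def)
        have 1: "near 0 x y = 1" using True diam[of x y] by (simp add: near_def)
        have 2: "ennreal ((2 powr q) ^ k) * (g x y * near k x y) = ennreal ((if t \<le> 1 / 2 ^ k then (2 powr q) ^ k else 0) * \<bar>v x - v y\<bar> powr p)" for k
          using True d by (auto simp: near_def g_def indicator_def t_def field_simps ennreal_mult)
        have "(\<Sum>k<N. ennreal ((2 powr q) ^ k) * (g x y * near k x y)) = ennreal ((\<Sum>k<N. if t \<le> 1 / 2 ^ k then (2 powr q) ^ k else 0) * \<bar>v x - v y\<bar> powr p)"
          unfolding 2 by (subst sum_ennreal) (auto simp: sum_distrib_right)
        also have "\<dots> \<le> ennreal (2 * t powr (- q) * \<bar>v x - v y\<bar> powr p)"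
          by (intro ennreal_leI mult_right_mono sum_dyadic_powr_le q1 t) auto
        also have "2 * t powr (- q) * \<bar>v x - v y\<bar> powr p = 2 * d powr q * (\<bar>v x - v y\<bar> powr p / norm (x - y) powr q)"
          using d True by (simp add: t_def powr_minus powr_divide field_simps)
        also have "ennreal \<dots> = ennreal (2 * d powr q) * (K x y * near 0 x y)"
          unfolding K_def 1 by (subst ennreal_mult) auto
        finally show ?thesis .
      next
        case False
        then have "g x y * near k x y = 0" for k using p by (auto simp: g_def near_def)
        then show ?thesis by (simp only: mult_zero_right sum.neutral_const zero_le)
      qed
    qed
    also have "\<dots> = ennreal (2 * d powr q) * J"
      unfolding J_def by (simp add: nn_integral_cmult)
    finally show ?thesis .
  qed
  have geo: "(\<Sum>k. ennreal (r ^ k)) = ennreal (1 / (1 - r))"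
    using r by (subst suminf_ennreal_eq[OF _ geometric_sums]) auto
  have "(\<Sum>k. I 0 * ennreal (r ^ k)) \<le> ennreal (2 * d powr q) * J"
    using partial by (intro suminf_le_const summableI) (simp add: sum_distrib_left mult.commute)
  then have main: "ennreal (1 / (1 - r)) * I 0 \<le> ennreal (2 * d powr q) * J"
    by (simp add: geo mult.commute)
  have "1 - r \<le> s"
  proof -
    have "1 + (- s * ln 2) \<le> exp (- s * ln 2)" by (rule exp_ge_add_one_self)
    then have "1 - r \<le> s * ln 2" by (simp add: r_def s_def powr_def mult.commute)
    also have "\<dots> \<le> s" using s ln_2_less_1 by (simp add: mult_le_cancel_left1)
    finally show ?thesis .
  qed
  then have "1 / s \<le> 1 / (1 - r)" using r by (simp add: frac_le)
  then have "ennreal (1 / s) * I 0 \<le> ennreal (2 * d powr q) * J"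
    using main by (meson ennreal_leI mult_right_mono order_trans zero_le)
  then have "ennreal s * (ennreal (1 / s) * I 0) \<le> ennreal s * (ennreal (2 * d powr q) * J)"
    by (rule mult_left_mono) simp
  then have "I 0 \<le> ennreal (2 * p * (1 - \<delta>) * d powr q) * J"
  proof -
    have "ennreal s * ennreal (1 / s) = 1" using s by (simp flip: ennreal_mult)
    moreover have "ennreal s * ennreal (2 * d powr q) = ennreal (2 * p * (1 - \<delta>) * d powr q)"
      using s by (subst ennreal_mult[symmetric]) (auto simp: s_def algebra_simps)
    ultimately show ?thesis
      using \<open>ennreal s * (ennreal (1 / s) * I 0) \<le> ennreal s * (ennreal (2 * d powr q) * J)\<close>
      by (metis mult.assoc mult_1)
  qed
  moreover have "I 0 = (\<integral>\<^sup>+x\<in>R. (\<integral>\<^sup>+y\<in>R. g x y \<partial>lborel) \<partial>lborel)"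
    unfolding I_def by (intro nn_integral_cong) (use diam in \<open>auto simp: near_def indicator_def intro!: nn_integral_cong\<close>)
  moreover have "J = (\<integral>\<^sup>+x\<in>R. (\<integral>\<^sup>+y\<in>R. K x y \<partial>lborel) \<partial>lborel)"
    unfolding J_def by (intro nn_integral_cong) (use diam in \<open>auto simp: near_def indicator_def intro!: nn_integral_cong\<close>)
  ultimately show ?thesis unfolding g_def K_def by simp
qed

section \<open>Averages and oscillations over cells\<close>

context dyadic_grid
begin

definition avg :: "(real ^ 'n \<Rightarrow> real) \<Rightarrow> (real ^ 'n) set \<Rightarrow> real" where
  "avg v R = (LINT x:R|lborel. v x) / measure lborel R"

definition osc :: "(real ^ 'n \<Rightarrow> real) \<Rightarrow> (real ^ 'n) set \<Rightarrow> real" where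
  "osc v R = avg (\<lambda>x. \<bar>v x - avg v R\<bar>) R"

lemma set_integrable_bounded:
  fixes f :: "real ^ 'n \<Rightarrow> real"
  assumes "f \<in> borel_measurable borel" "\<And>x. \<bar>f x\<bar> \<le> B"
  shows "set_integrable lborel (cell m x) f"
  unfolding set_integrable_def
proof (rule integrableI_bounded_set_indicator[where B = B])
  show "emeasure lborel (cell m x) < \<infinity>" by (simp add: cell_emeasure)
qed (use assms in auto)

lemma avg_integral: "(LINT y:cell m x|lborel. v y) = avg v (cell m x) * measure lborel (cell m x)"
  using cell_measure_pos[of m x] by (simp add: avg_def)

lemma avg_mono:
  assumes "u \<in> borel_measurable borel" "v \<in> borel_measurable borel"
    and "\<And>x. \<bar>u x\<bar> \<le> B" "\<And>x. \<bar>v x\<bar> \<le> B" and "\<And>y. y \<in> cell m x \<Longrightarrow> u y \<le> v y"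
  shows "avg u (cell m x) \<le> avg v (cell m x)"
  unfolding avg_def using assms set_integrable_bounded[of u B] set_integrable_bounded[of v B]
  by (intro divide_right_mono set_integral_mono) auto

lemma avg_const: "avg (\<lambda>_. c) (cell m x) = c"
  using cell_measure_pos[of m x] unfolding avg_def
  by (simp add: set_lebesgue_integral_def cell_emeasure less_top)

lemma avg_minus_const:
  assumes "v \<in> borel_measurable borel" "\<And>x. \<bar>v x\<bar> \<le> B"
  shows "avg (\<lambda>x. v x - c) (cell m x) = avg v (cell m x) - c"
proof -
  have "(LINT y:cell m x|lborel. v y - c) = (LINT y:cell m x|lborel. v y) - (LINT y:cell m x|lborel. c)"
    by (intro set_integral_diff set_integrable_bounded[of _ B] set_integrable_bounded[of _ "\<bar>c\<bar>"]) (use assms in auto)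
  then show ?thesis using avg_const[of c m x] unfolding avg_def by (simp add: diff_divide_distrib)
qed

lemma density_avg:
  assumes "v \<in> borel_measurable borel" "\<And>x. \<bar>v x\<bar> \<le> B" "\<And>x. 0 \<le> v x"
  shows "emeasure (density lborel (\<lambda>x. ennreal (v x))) (cell m x) = ennreal (avg v (cell m x) * measure lborel (cell m x))"
proof -
  have "emeasure (density lborel (\<lambda>x. ennreal (v x))) (cell m x) = (\<integral>\<^sup>+y\<in>cell m x. ennreal (v y) \<partial>lborel)"
    using assms by (simp add: emeasure_density)
  also have "\<dots> = (\<integral>\<^sup>+y. ennreal (indicator (cell m x) y *\<^sub>R v y) \<partial>lborel)"
    by (intro nn_integral_cong) (auto simp: indicator_def)
  also have "\<dots> = ennreal (LINT y:cell m x|lborel. v y)"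
    unfolding set_lebesgue_integral_def
    by (rule nn_integral_eq_integral)
       (use set_integrable_bounded[of v B] assms in \<open>auto simp: set_integrable_def indicator_def\<close>)
  finally show ?thesis by (simp add: avg_integral)
qed

lemma osc_nonneg: "0 \<le> osc v R"
  unfolding osc_def avg_def set_lebesgue_integral_def by (intro divide_nonneg_nonneg Bochner_Integration.integral_nonneg) auto

lemma avg_nonneg: "(\<And>x. 0 \<le> v x) \<Longrightarrow> 0 \<le> avg v R"
  unfolding avg_def set_lebesgue_integral_def by (intro divide_nonneg_nonneg Bochner_Integration.integral_nonneg) auto

lemma avg_le:
  assumes "v \<in> borel_measurable borel" "\<And>x. 0 \<le> v x" "\<And>x. v x \<le> 1"
  shows "avg v (cell m x) \<le> 1"
  using avg_mono[of v "\<lambda>_. 1" 1 m x] assms by (simp add: avg_const)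

lemma osc_ge:
  assumes v: "v \<in> borel_measurable borel" "\<And>x. 0 \<le> v x" "\<And>x. v x \<le> 1"
  shows "\<bar>v y - avg v (cell m x)\<bar> \<le> 1"
  using avg_le[OF v, of m x] avg_nonneg[of v "cell m x", OF v(2)] v(2)[of y] v(3)[of y] by linarith

text \<open>
  Enlarging the domain of integration from the subcell to the cell costs only the oscillation over the
  cell.
\<close>

lemma avg_subcell:
  assumes v: "v \<in> borel_measurable borel" "\<And>x. 0 \<le> v x" "\<And>x. v x \<le> 1" and sub: "cell k y \<subseteq> cell m x"
  shows "(avg v (cell k y) - avg v (cell m x)) * measure lborel (cell k y) \<le> osc v (cell m x) * measure lborel (cell m x)"
proof -
  let ?f = "\<lambda>z. \<bar>v z - avg v (cell m x)\<bar>"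
  have f: "?f \<in> borel_measurable borel" using v by simp
  have f1: "\<bar>?f z\<bar> \<le> 1" for z using osc_ge[OF v] by simp
  have v1: "\<bar>v z\<bar> \<le> 1" for z using v(2,3)[of z] by auto
  have "avg v (cell k y) - avg v (cell m x) = avg (\<lambda>z. v z - avg v (cell m x)) (cell k y)"
    by (rule avg_minus_const[symmetric]) (use v v1 in auto)
  also have "\<dots> \<le> avg ?f (cell k y)"
    by (rule avg_mono[where B = 1]) (use v f f1 in auto)
  finally have "(avg v (cell k y) - avg v (cell m x)) * measure lborel (cell k y) \<le> (LINT z:cell k y|lborel. ?f z)"
    using cell_measure_pos[of k y] by (simp add: avg_integral)
  also have "\<dots> \<le> (LINT z:cell m x|lborel. ?f z)"
    using set_integrable_bounded[OF f f1, of k y] set_integrable_bounded[OF f f1, of m x] sub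
    unfolding set_lebesgue_integral_def set_integrable_def
    by (intro integral_mono) (auto simp: indicator_def)
  also have "\<dots> = osc v (cell m x) * measure lborel (cell m x)" by (simp add: avg_integral osc_def)
  finally show ?thesis .
qed

lemma avg_child:
  assumes v: "v \<in> borel_measurable borel" "\<And>x. 0 \<le> v x" "\<And>x. v x \<le> 1"
  shows "avg v (cell (Suc m) x) \<le> avg v (cell m x) + 2 ^ CARD('n) * osc v (cell m x)"
proof -
  have "(avg v (cell (Suc m) x) - avg v (cell m x)) * measure lborel (cell (Suc m) x)
      \<le> (2 ^ CARD('n) * osc v (cell m x)) * measure lborel (cell (Suc m) x)"
    using avg_subcell[OF v cell_Suc, of m x] by (simp add: cell_measure_Suc[of m x] mult_ac)
  then have "avg v (cell (Suc m) x) - avg v (cell m x) \<le> 2 ^ CARD('n) * osc v (cell m x)"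
    using cell_measure_pos[of "Suc m" x] by simp
  then show ?thesis by simp
qed

text \<open>
  On a maximal subcell whose average exceeds the one of the big cell by \<open>c\<close>, the deviation from the big
  average has mean at least \<open>c\<close>.
\<close>

lemma osc_weak_type:
  assumes v: "v \<in> borel_measurable borel" "\<And>x. 0 \<le> v x" "\<And>x. v x \<le> 1" and c: "0 < c"
  shows "c * measure lborel (reach (\<lambda>R. R \<subseteq> cell m x \<and> avg v (cell m x) + c < avg v R)) \<le> osc v (cell m x) * measure lborel (cell m x)"
proof -
  let ?f = "\<lambda>z. \<bar>v z - avg v (cell m x)\<bar>"
  let ?P = "\<lambda>R. R \<subseteq> cell m x \<and> avg v (cell m x) + c < avg v R"
  have f: "?f \<in> borel_measurable borel" using v by simp
  have f1: "\<bar>?f z\<bar> \<le> 1" for z using osc_ge[OF v] by simp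
  have v1: "\<bar>v z\<bar> \<le> 1" for z using v(2,3)[of z] by auto
  have sub: "reach ?P \<subseteq> cell m x" by (auto simp: reach_def)
  have "emeasure (density lborel (\<lambda>_. ennreal c)) (reach ?P) \<le> emeasure (density lborel (\<lambda>x. ennreal (?f x))) (reach ?P)"
  proof (rule reach_le)
    fix k y assume P: "?P (cell k y)"
    have "avg (\<lambda>_. c) (cell k y) \<le> avg (\<lambda>z. v z - avg v (cell m x)) (cell k y)"
      using P by (subst avg_minus_const[where B = 1]) (use v v1 in \<open>auto simp: avg_const\<close>)
    also have "\<dots> \<le> avg ?f (cell k y)"
      by (rule avg_mono[where B = 1]) (use v f f1 in auto)
    finally have "avg (\<lambda>_. c) (cell k y) \<le> avg ?f (cell k y)" .
    then show "emeasure (density lborel (\<lambda>_. ennreal c)) (cell k y) \<le> emeasure (density lborel (\<lambda>x. ennreal (?f x))) (cell k y)"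
      using density_avg[of "\<lambda>_. c" c k y] density_avg[OF f f1, of k y] c
      by (simp add: ennreal_leI mult_right_mono)
  qed simp_all
  also have "\<dots> \<le> emeasure (density lborel (\<lambda>x. ennreal (?f x))) (cell m x)"
    using sub by (intro emeasure_mono) auto
  also have "\<dots> = ennreal (osc v (cell m x) * measure lborel (cell m x))"
    unfolding osc_def by (rule density_avg) (use f f1 in auto)
  also have "emeasure (density lborel (\<lambda>_. ennreal c)) (reach ?P) = ennreal c * emeasure lborel (reach ?P)"
    by (simp add: emeasure_density nn_integral_cmult)
  also have "emeasure lborel (reach ?P) = ennreal (measure lborel (reach ?P))"
    using emeasure_mono[OF sub, of lborel] by (intro emeasure_eq_ennreal_measure) (auto simp: cell_emeasure top_unique)
  finally show ?thesis
    using c osc_nonneg[of v "cell m x"] by (simp flip: ennreal_mult)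
qed

text \<open>
  In the application \<open>v\<close> and \<open>v'\<close> are consecutive truncations: where the upper one is positive, the lower
  one is saturated. If the upper one has a substantial average, then a small oscillation forces the
  average of the lower one to be close to \<open>1\<close>.
\<close>

lemma osc_jump:
  assumes v: "v \<in> borel_measurable borel" "\<And>x. 0 \<le> v x" "\<And>x. v x \<le> 1"
    and v': "v' \<in> borel_measurable borel" "\<And>x. 0 \<le> v' x" "\<And>x. v' x \<le> 1"
    and on: "\<And>x. 0 < v' x \<Longrightarrow> v x = 1"
  shows "avg v' (cell m x) * (1 - avg v (cell m x)) \<le> osc v (cell m x)"
proof -
  let ?f = "\<lambda>z. \<bar>v z - avg v (cell m x)\<bar>"
  let ?A = "avg v (cell m x)"
  have A: "0 \<le> ?A" "?A \<le> 1" using avg_le[OF v] avg_nonneg v by auto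
  have "avg (\<lambda>z. v' z * (1 - ?A)) (cell m x) \<le> avg ?f (cell m x)"
  proof (rule avg_mono[where B = 1])
    show "\<bar>\<bar>v y - ?A\<bar>\<bar> \<le> 1" for y using osc_ge[OF v] by simp
    show "\<bar>v' y * (1 - ?A)\<bar> \<le> 1" for y using A v'(2,3)[of y] by (simp add: abs_mult mult_le_one)
    show "v' y * (1 - ?A) \<le> \<bar>v y - ?A\<bar>" for y
    proof (cases "0 < v' y")
      case True
      then have "v y = 1" by (rule on)
      then show ?thesis using A v'(2,3)[of y] by (simp add: mult_left_le_one_le)
    next
      case False
      then have "v' y = 0" using v'(2)[of y] by simp
      then show ?thesis by simp
    qed
  qed (use v v' in auto)
  then show ?thesis unfolding osc_def by (simp add: avg_def set_integral_mult_left)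
qed

text \<open>
  A dyadic Lebesgue density statement. Let \<open>B\<close> be the exceptional set. Inside any open set containing
  \<open>B\<close>, the maximal cells meeting \<open>B\<close> cover \<open>B\<close> but are at most half filled by it, so \<open>B\<close> has at
  most half the measure of the open set; outer regularity makes \<open>B\<close> null.
\<close>

lemma ae_dense_cell:
  assumes E: "E \<in> sets borel"
  shows "AE x in lborel. x \<in> E \<inter> cell 0 a \<longrightarrow> (\<exists>m. measure lborel (cell m x) < 2 * measure lborel (E \<inter> cell m x))"
proof -
  define B where "B = (E \<inter> cell 0 a) - reach (\<lambda>R. measure lborel R < 2 * measure lborel (E \<inter> R))"
  have Bb [measurable]: "B \<in> sets borel" unfolding B_def using E by auto
  have fin: "emeasure lborel B < top"
  proof -
    have "emeasure lborel B \<le> emeasure lborel (cell 0 a)" by (rule emeasure_mono) (auto simp: B_def)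
    also have "\<dots> < top" by (simp add: cell_emeasure)
    finally show ?thesis .
  qed
  have half: "2 * emeasure lborel B \<le> emeasure lborel B + ennreal e" if e: "0 < e" for e :: real
  proof -
    obtain S where S: "open S" "B \<subseteq> S" "S - B \<in> lmeasurable" "emeasure lebesgue (S - B) < ennreal e"
      using sets_lebesgue_outer_open[of B e] e by (metis Bb sets_completionI_sets sets_lborel)
    define P where "P R \<longleftrightarrow> R \<subseteq> S \<and> R \<inter> B \<noteq> {}" for R
    have BP: "B \<subseteq> reach P"
      using cell_small[OF S(1)] S(2) by (fastforce simp: reach_def P_def)
    have PS: "reach P \<subseteq> S" by (auto simp: reach_def P_def)
    have "emeasure (density lborel (\<lambda>x. 2 * indicator B x)) (reach P) \<le> emeasure lborel (reach P)"
    proof (rule reach_le)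
      fix m x assume "P (cell m x)"
      then obtain y where y: "y \<in> cell m x" "y \<in> B" by (auto simp: P_def)
      have eq: "cell m y = cell m x" using cell_eq y(1) .
      have "2 * measure lborel (E \<inter> cell m x) \<le> measure lborel (cell m x)"
        using y(2) eq[symmetric] by (auto simp: B_def reach_def not_less)
      moreover have "measure lborel (B \<inter> cell m x) \<le> measure lborel (E \<inter> cell m x)"
        by (rule measure_mono_fmeasurable) (use E in \<open>auto simp: B_def intro: fmeasurableI2[OF cell_fmeasurable]\<close>)
      ultimately have *: "2 * measure lborel (B \<inter> cell m x) \<le> measure lborel (cell m x)" by simp
      have "emeasure (density lborel (\<lambda>x. 2 * indicator B x)) (cell m x) = 2 * emeasure lborel (B \<inter> cell m x)"
        by (simp add: emeasure_density nn_integral_cmult mult.assoc flip: indicator_inter_arith)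
      also have "emeasure lborel (B \<inter> cell m x) = ennreal (measure lborel (B \<inter> cell m x))"
        using fin by (intro emeasure_eq_ennreal_measure) (metis emeasure_mono inf_le1 Bb sets_lborel top_unique less_irrefl)
      also have "2 * \<dots> \<le> emeasure lborel (cell m x)"
        using * unfolding cell_emeasure_eq by (simp add: ennreal_leI flip: ennreal_numeral ennreal_mult)
      finally show "emeasure (density lborel (\<lambda>x. 2 * indicator B x)) (cell m x) \<le> emeasure lborel (cell m x)" .
    qed simp_all
    also have "emeasure (density lborel (\<lambda>x. 2 * indicator B x)) (reach P) = 2 * emeasure lborel (B \<inter> reach P)"
      by (simp add: emeasure_density nn_integral_cmult mult.assoc flip: indicator_inter_arith)
    also have "B \<inter> reach P = B" using BP by auto
    finally have "2 * emeasure lborel B \<le> emeasure lborel S"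
      by (rule order_trans) (use PS S(1) in \<open>auto intro: emeasure_mono\<close>)
    also have "\<dots> = emeasure lborel B + emeasure lborel (S - B)"
      using S by (subst plus_emeasure) (auto intro!: arg_cong[where f = "emeasure lborel"])
    also have "emeasure lborel (S - B) \<le> ennreal e"
      using S(4) S(1) by (simp add: less_imp_le)
    finally show ?thesis by (simp add: add_mono)
  qed
  have "2 * emeasure lborel B \<le> emeasure lborel B"
    by (rule ennreal_le_epsilon) (use half in auto)
  then have "emeasure lborel B = 0"
    using fin unfolding mult_2
    by (metis add.right_neutral ennreal_add_left_cancel_le less_top zero_le order_antisym infinity_ennreal_def less_irrefl)
  then have "B \<in> null_sets lborel" by auto
  then show ?thesis
    by (rule AE_not_in[THEN AE_mp]) (auto simp: B_def reach_def)
qed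

end

section \<open>A good-lambda inequality under the Fujii--Wilson condition\<close>

lemma (in dyadic_grid) cell_fun_borel:
  fixes F :: "(real ^ 'n) set \<Rightarrow> ennreal"
  shows "(\<lambda>y. F (cell k y)) \<in> borel_measurable borel"
proof -
  have "(\<lambda>y. F (cell k y)) -` A \<in> sets borel" for A
  proof -
    have "(\<lambda>y. F (cell k y)) -` A = \<Union>{cell k x | x. F (cell k x) \<in> A}"
    proof (intro equalityI subsetI)
      fix y assume "y \<in> \<Union>{cell k x | x. F (cell k x) \<in> A}"
      then obtain x where "y \<in> cell k x" "F (cell k x) \<in> A" by auto
      then show "y \<in> (\<lambda>y. F (cell k y)) -` A" using cell_eq[of y k x] by simp
    qed auto
    also have "\<dots> \<in> sets borel"
      by (rule sets.countable_Union) (auto intro: countable_subset[OF _ cell_countable])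
    finally show ?thesis .
  qed
  then show ?thesis by (auto simp: measurable_def)
qed

text \<open>
  The Fujii--Wilson condition is required only for the cells of one grid and with the dyadic maximal
  function in place of the full one. Both changes make it weaker, so a weight with finite constant
  satisfies it on every grid.
\<close>

locale fujii_wilson_grid = dyadic_grid a l for a :: "real ^ 'n" and l :: real +
  fixes w :: "real ^ 'n \<Rightarrow> ennreal" and W :: real
  assumes w_borel [measurable]: "w \<in> borel_measurable borel"
    and w_finite: "\<And>m x. emeasure (density lborel w) (cell m x) < top"
    and W_pos: "0 < W"
    and fujii_wilson: "\<And>m x. (\<integral>\<^sup>+y\<in>cell m x.
        (SUP k. if cell k y \<subseteq> cell m x then emeasure (density lborel w) (cell k y) / emeasure lborel (cell k y) else 0) \<partial>lborel)
      \<le> ennreal W * emeasure (density lborel w) (cell m x)"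
begin

abbreviation \<mu> :: "(real ^ 'n) measure" where "\<mu> \<equiv> density lborel w"

definition local_max :: "(real ^ 'n) set \<Rightarrow> real ^ 'n \<Rightarrow> ennreal" where
  "local_max R y = (SUP k. if cell k y \<subseteq> R then emeasure \<mu> (cell k y) / emeasure lborel (cell k y) else 0)"

lemma local_max_borel [measurable]: "local_max R \<in> borel_measurable borel"
  unfolding local_max_def by (intro borel_measurable_SUP cell_fun_borel) auto

definition level :: "(real ^ 'n \<Rightarrow> real) \<Rightarrow> real \<Rightarrow> (real ^ 'n) set \<Rightarrow> bool" where
  "level v s R \<longleftrightarrow> R \<subseteq> cell 0 a \<and> s < avg v R"

end

text \<open>
  The levels of \<open>avg v\<close> are separated by \<open>(2 ^ n + 2) * \<gamma>\<close>: the summand \<open>2 ^ n * \<gamma>\<close> is the largest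
  possible overshoot of a stopping cell over its level, and \<open>2 * \<gamma>\<close> is what makes the next level reach
  at most half of the cell.
\<close>

locale good_lambda = fujii_wilson_grid a l w W for a :: "real ^ 'n" and l w W +
  fixes v :: "real ^ 'n \<Rightarrow> real" and \<gamma> :: real and K :: nat
  assumes v: "v \<in> borel_measurable borel" "\<And>x. 0 \<le> v x" "\<And>x. v x \<le> 1"
    and top_avg: "avg v (cell 0 a) \<le> 1 / 2"
    and \<gamma>: "0 < \<gamma>" and K: "4 * W \<le> real K"
begin

definition height :: "nat \<Rightarrow> real" where
  "height j = 1 / 2 + real j * ((2 ^ CARD('n) + 2) * \<gamma>)"

text \<open>
  Only cells that meet this set of small oscillation take part in the stopping argument. Such a cell
  and all its ancestors have oscillation at most \<open>\<gamma>\<close>.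
\<close>

definition calm :: "(real ^ 'n) set" where
  "calm = {x \<in> cell 0 a. \<forall>m. osc v (cell m x) \<le> \<gamma>}"

definition calm_above :: "nat \<Rightarrow> (real ^ 'n) set \<Rightarrow> bool" where
  "calm_above j R \<longleftrightarrow> level v (height j) R \<and> R \<inter> calm \<noteq> {}"

definition above :: "nat \<Rightarrow> (real ^ 'n) set" where
  "above j = reach (level v (height j))"

lemma above_borel [measurable]: "above j \<in> sets borel" by (simp add: above_def)

lemma height_mono: "i \<le> j \<Longrightarrow> height i \<le> height j"
  using \<gamma> by (auto simp: height_def intro!: mult_right_mono)

lemma calm_above_mono: "i \<le> j \<Longrightarrow> calm_above j R \<Longrightarrow> calm_above i R"
  using height_mono[of i j] by (auto simp: calm_above_def level_def)

lemma above_antimono: "i \<le> j \<Longrightarrow> above j \<subseteq> above i"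
  unfolding above_def using height_mono[of i j] by (intro reach_mono) (auto simp: level_def)

lemma calm_osc: "cell m x \<inter> calm \<noteq> {} \<Longrightarrow> k \<le> m \<Longrightarrow> osc v (cell k x) \<le> \<gamma>"
proof -
  assume "cell m x \<inter> calm \<noteq> {}" and km: "k \<le> m"
  then obtain y where y: "y \<in> cell m x" "y \<in> calm" by auto
  have "cell k y = cell k x" using cell_eq_le[OF y(1) km] .
  then show "osc v (cell k x) \<le> \<gamma>" using y(2) unfolding calm_def by (metis (lifting) mem_Collect_eq)
qed

text \<open>
  The parent of a stopping cell also meets the calm set, so it did not stop because its average was too
  small; passing to a child raises the average by at most \<open>2 ^ n * \<gamma>\<close>. For a cell of generation
  zero the hypothesis on the average over the top cell takes over.
\<close>

lemma first_avg:
  assumes first: "calm_above j (cell m x)" "\<And>k. k < m \<Longrightarrow> \<not> calm_above j (cell k x)"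
  shows "avg v (cell m x) \<le> height j + 2 ^ CARD('n) * \<gamma>"
proof (cases m)
  case 0
  have "x \<in> cell 0 a" using first(1) by (auto simp: calm_above_def level_def)
  then have "cell m x = cell 0 a" using cell_eq 0 by simp
  then have "avg v (cell m x) \<le> 1 / 2" using top_avg by simp
  also have "\<dots> \<le> height j + 2 ^ CARD('n) * \<gamma>" using \<gamma> by (simp add: height_def)
  finally show ?thesis .
next
  case (Suc k)
  have "x \<in> cell 0 a" using first(1) by (auto simp: calm_above_def level_def)
  then have "cell 0 x = cell 0 a" by (rule cell_eq)
  then have sub: "cell k x \<subseteq> cell 0 a" using cell_mono[of 0 k x] by simp
  have meet: "cell k x \<inter> calm \<noteq> {}" using first(1) cell_Suc[of k x] Suc by (auto simp: calm_above_def)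
  have "avg v (cell k x) \<le> height j" using first(2)[of k] Suc sub meet by (auto simp: calm_above_def level_def)
  moreover have "2 ^ CARD('n) * osc v (cell k x) \<le> 2 ^ CARD('n) * \<gamma>"
    using calm_osc[OF meet] by (intro mult_left_mono) auto
  ultimately have "avg v (cell (Suc k) x) \<le> height j + 2 ^ CARD('n) * \<gamma>"
    using avg_child[OF v, of k x] by linarith
  then show ?thesis using Suc by simp
qed

text \<open>
  The average over the stopping cell exceeds its level by at most \<open>2 ^ n * \<gamma>\<close>, so reaching the next level means exceeding
  the average over the cell by another \<open>2 * \<gamma>\<close>, and \<open>osc_weak_type\<close> applies.
\<close>

lemma next_level_half:
  assumes first: "calm_above j (cell m x)" "\<And>k. k < m \<Longrightarrow> \<not> calm_above j (cell k x)"
  shows "2 * measure lborel (above (Suc j) \<inter> cell m x) \<le> measure lborel (cell m x)"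
proof -
  let ?Q = "\<lambda>R. R \<subseteq> cell m x \<and> avg v (cell m x) + 2 * \<gamma> < avg v R"
  have meet: "cell m x \<inter> calm \<noteq> {}" using first by (simp add: calm_above_def)
  have hS: "height (Suc j) = height j + 2 ^ CARD('n) * \<gamma> + 2 * \<gamma>" by (simp add: height_def algebra_simps)
  have "above (Suc j) \<inter> cell m x \<subseteq> reach ?Q"
  proof
    fix y assume y: "y \<in> above (Suc j) \<inter> cell m x"
    then obtain k where k: "cell k y \<subseteq> cell 0 a" "height (Suc j) < avg v (cell k y)"
      by (auto simp: above_def reach_def level_def)
    have lt: "avg v (cell m x) + 2 * \<gamma> < avg v (cell k y)" using first_avg[OF first] k(2) hS by simp
    have eq: "cell m y = cell m x" using y cell_eq by auto
    have "m \<le> k"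
    proof (rule ccontr)
      assume "\<not> m \<le> k"
      then have km: "k < m" by simp
      have Dk: "cell k y = cell k x" using cell_eq_le[of y m x k] y km by simp
      have "cell m x \<subseteq> cell k x" using cell_mono km by simp
      then have "cell k x \<inter> calm \<noteq> {}" using meet by auto
      moreover have "height j < avg v (cell k x)" using k(2) height_mono[of j "Suc j"] Dk by simp
      ultimately have "calm_above j (cell k x)" using k(1) Dk by (simp add: calm_above_def level_def)
      then show False using first(2)[OF km] by simp
    qed
    then have "cell k y \<subseteq> cell m x" using cell_mono[of m k y] eq by simp
    then show "y \<in> reach ?Q" using lt by (auto simp: reach_def)
  qed
  moreover have "reach ?Q \<in> fmeasurable lborel"
  proof (rule fmeasurableI2[OF cell_fmeasurable[of m x]])
    show "reach ?Q \<subseteq> cell m x" by (auto simp: reach_def)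
  qed simp
  ultimately have "measure lborel (above (Suc j) \<inter> cell m x) \<le> measure lborel (reach ?Q)"
    by (intro measure_mono_fmeasurable) auto
  then have "(2 * \<gamma>) * measure lborel (above (Suc j) \<inter> cell m x) \<le> (2 * \<gamma>) * measure lborel (reach ?Q)"
    using \<gamma> by (intro mult_left_mono) auto
  also have "\<dots> \<le> osc v (cell m x) * measure lborel (cell m x)"
    using osc_weak_type[OF v, of "2 * \<gamma>" m x] \<gamma> by simp
  also have "\<dots> \<le> \<gamma> * measure lborel (cell m x)"
    using calm_osc[OF meet, of m] by (intro mult_right_mono) auto
  finally have "\<gamma> * (2 * measure lborel (above (Suc j) \<inter> cell m x)) \<le> \<gamma> * measure lborel (cell m x)" by (simp add: mult_ac)
  then show ?thesis using \<gamma> by (simp only: mult_le_cancel_left_pos)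
qed

text \<open>
  Each maximal cell \<open>S\<close> of level \<open>j\<close> inside \<open>R\<close> keeps at least half of its volume outside the next
  level, and on that part the dyadic maximal function of the weight is at least the average of the
  weight over \<open>S\<close>. These parts are disjoint for different cells and different levels.
\<close>

lemma layer_le:
  assumes first: "calm_above i (cell m x)" "\<And>k. k < m \<Longrightarrow> \<not> calm_above i (cell k x)" and ij: "i \<le> j"
  shows "emeasure \<mu> (reach (calm_above j) \<inter> cell m x)
    \<le> (\<integral>\<^sup>+y\<in>cell m x. 2 * local_max (cell m x) y * indicator (above j - above (Suc j)) y \<partial>lborel)"
proof -
  let ?R = "cell m x"
  let ?Q = "\<lambda>S. calm_above j S \<and> S \<subseteq> ?R"
  let ?N = "density lborel (\<lambda>y. 2 * local_max ?R y * indicator (above j - above (Suc j)) y)"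
  have eq: "reach (calm_above j) \<inter> ?R = reach ?Q"
  proof (intro equalityI subsetI)
    fix y assume y: "y \<in> reach (calm_above j) \<inter> ?R"
    then obtain k where k: "calm_above j (cell k y)" by (auto simp: reach_def)
    have "m \<le> k"
    proof (rule ccontr)
      assume "\<not> m \<le> k"
      then have km: "k < m" by simp
      have "cell k y = cell k x" using cell_eq_le[of y m x k] y km by simp
      then have "calm_above i (cell k x)" using calm_above_mono[OF ij k] by simp
      then show False using first(2)[OF km] by simp
    qed
    then have "cell k y \<subseteq> ?R" using cell_mono[of m k y] cell_eq[of y m x] y by simp
    then show "y \<in> reach ?Q" using k by (auto simp: reach_def)
  next
    fix y assume "y \<in> reach ?Q" then show "y \<in> reach (calm_above j) \<inter> ?R" by (auto simp: reach_def)
  qed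
  have "emeasure \<mu> (reach ?Q) \<le> emeasure ?N (reach ?Q)"
  proof (rule reach_le)
    fix k y assume Qk: "?Q (cell k y)" and Qf: "\<And>k'. k' < k \<Longrightarrow> \<not> ?Q (cell k' y)"
    let ?S = "cell k y"
    have ff: "\<not> calm_above j (cell k' y)" if "k' < k" for k'
    proof
      assume Pk: "calm_above j (cell k' y)"
      then have ns: "\<not> cell k' y \<subseteq> ?R" using Qf[OF that] by simp
      have yR: "y \<in> ?R" using Qk by auto
      have "k' < m" using ns cell_mono[of m k' y] cell_eq[OF yR] by (metis not_less)
      moreover have "cell k' y = cell k' x" using cell_eq_le[OF yR] calculation by simp
      ultimately show False using calm_above_mono[OF ij Pk] first(2) by simp
    qed
    have half: "2 * measure lborel (above (Suc j) \<inter> ?S) \<le> measure lborel ?S"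
      using next_level_half[of j k y] Qk ff by simp
    have ST: "?S \<subseteq> above j"
    proof
      fix z assume "z \<in> ?S"
      then have "cell k z = ?S" by (rule cell_eq)
      then show "z \<in> above j" using Qk unfolding above_def reach_def calm_above_def by (metis mem_Collect_eq)
    qed
    let ?E = "?S - above (Suc j)"
    have "measure lborel ?E = measure lborel ?S - measure lborel (?S \<inter> above (Suc j))"
      by (subst measure_Diff[symmetric]) (auto simp: cell_emeasure Diff_Int intro: fmeasurableD2[OF fmeasurableI2[OF cell_fmeasurable]] )
    then have mE: "measure lborel ?S \<le> 2 * measure lborel ?E" using half by (simp add: Int_commute)
    have fE: "emeasure lborel ?E = ennreal (measure lborel ?E)"
      by (rule emeasure_eq_ennreal_measure) (use emeasure_mono[of ?E ?S lborel] in \<open>auto simp: cell_emeasure top_unique\<close>)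
    have S1: "emeasure lborel ?S \<le> 2 * emeasure lborel ?E"
      unfolding fE cell_emeasure_eq using mE by (simp add: ennreal_leI flip: ennreal_numeral ennreal_mult)
    let ?c = "emeasure \<mu> ?S / emeasure lborel ?S"
    have "emeasure \<mu> ?S = ?c * emeasure lborel ?S"
      using cell_measure_pos[of k y] unfolding cell_emeasure_eq by (simp add: ennreal_divide_times ennreal_mult_divide_eq)
    also have "\<dots> \<le> ?c * (2 * emeasure lborel ?E)" by (rule mult_left_mono[OF S1]) simp
    also have "\<dots> = (\<integral>\<^sup>+z. 2 * ?c * indicator ?E z \<partial>lborel)"
      by (subst nn_integral_cmult_indicator) (auto simp: mult_ac)
    also have "\<dots> \<le> (\<integral>\<^sup>+z\<in>?S. 2 * local_max ?R z * indicator (above j - above (Suc j)) z \<partial>lborel)"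
    proof (rule nn_integral_mono)
      fix z
      have "?c \<le> local_max ?R z" if "z \<in> ?S"
        using cell_eq[OF that] Qk unfolding local_max_def by (intro SUP_upper2[of k]) auto
      then show "2 * ?c * indicator ?E z \<le> 2 * local_max ?R z * indicator (above j - above (Suc j)) z * indicator ?S z"
        using ST by (auto simp: indicator_def intro: mult_left_mono)
    qed
    also have "\<dots> = emeasure ?N ?S" by (simp add: emeasure_density)
    finally show "emeasure \<mu> ?S \<le> emeasure ?N ?S" .
  qed simp_all
  also have "\<dots> \<le> emeasure ?N ?R" by (rule emeasure_mono) (auto simp: reach_def)
  also have "\<dots> = (\<integral>\<^sup>+y\<in>?R. 2 * local_max ?R y * indicator (above j - above (Suc j)) y \<partial>lborel)"
    by (simp add: emeasure_density)
  finally show ?thesis unfolding eq .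
qed

text \<open>
  The layers between consecutive levels are disjoint, so the integrals of the maximal function over them
  add up to at most its integral over the whole cell, which the Fujii--Wilson condition bounds. Since
  the reached sets decrease, \<open>k\<close> times the weight of the last of them is at most the sum of the weights.
\<close>

lemma carleson_packing:
  assumes first: "calm_above i (cell m x)" "\<And>k. k < m \<Longrightarrow> \<not> calm_above i (cell k x)"
  shows "of_nat k * emeasure \<mu> (reach (calm_above (i + k)) \<inter> cell m x) \<le> ennreal (2 * W) * emeasure \<mu> (cell m x)"
proof -
  let ?R = "cell m x"
  have "of_nat k * emeasure \<mu> (reach (calm_above (i + k)) \<inter> ?R) = (\<Sum>j<k. emeasure \<mu> (reach (calm_above (i + k)) \<inter> ?R))" by simp
  also have "\<dots> \<le> (\<Sum>j<k. emeasure \<mu> (reach (calm_above (i + j)) \<inter> ?R))"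
  proof (intro sum_mono emeasure_mono Int_mono order_refl reach_mono)
    fix j m y assume "j \<in> {..<k}" "calm_above (i + k) (cell m y)"
    then show "calm_above (i + j) (cell m y)" by (intro calm_above_mono[of "i + j" "i + k"]) auto
  qed auto
  also have "\<dots> \<le> (\<Sum>j<k. \<integral>\<^sup>+y\<in>?R. 2 * local_max ?R y * indicator (above (i + j) - above (Suc (i + j))) y \<partial>lborel)"
    by (intro sum_mono layer_le[of i]) (use first in auto)
  also have "\<dots> = (\<integral>\<^sup>+y. (\<Sum>j<k. 2 * local_max ?R y * indicator (above (i + j) - above (Suc (i + j))) y * indicator ?R y) \<partial>lborel)"
    by (rule nn_integral_sum[symmetric]) measurable
  also have "\<dots> \<le> (\<integral>\<^sup>+y\<in>?R. 2 * local_max ?R y \<partial>lborel)"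
  proof (rule nn_integral_mono)
    fix y
    have "(\<Sum>j<k. indicator (above (i + j) - above (Suc (i + j))) y :: ennreal) = indicator (\<Union>j<k. above (i + j) - above (Suc (i + j))) y"
    proof (rule indicator_UN_disjoint[symmetric])
      show "disjoint_family_on (\<lambda>j. above (i + j) - above (Suc (i + j))) {..<k}"
        unfolding disjoint_family_on_def
      proof (intro ballI impI)
        fix p q :: nat assume "p \<noteq> q"
        then consider "Suc p \<le> q" | "Suc q \<le> p" by linarith
        then show "(above (i + p) - above (Suc (i + p))) \<inter> (above (i + q) - above (Suc (i + q))) = {}"
          by cases (use above_antimono[of "Suc (i + p)" "i + q"] above_antimono[of "Suc (i + q)" "i + p"] in auto)
      qed
    qed simp
    then have le1: "(\<Sum>j<k. indicator (above (i + j) - above (Suc (i + j))) y :: ennreal) \<le> 1" by (simp add: indicator_def)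
    have "(\<Sum>j<k. 2 * local_max ?R y * indicator (above (i + j) - above (Suc (i + j))) y * indicator ?R y)
      = (2 * local_max ?R y * indicator ?R y) * (\<Sum>j<k. indicator (above (i + j) - above (Suc (i + j))) y)"
      by (simp add: sum_distrib_left mult_ac)
    also have "\<dots> \<le> (2 * local_max ?R y * indicator ?R y) * 1" by (rule mult_left_mono[OF le1]) simp
    finally show "(\<Sum>j<k. 2 * local_max ?R y * indicator (above (i + j) - above (Suc (i + j))) y * indicator ?R y) \<le> 2 * local_max ?R y * indicator ?R y" by simp
  qed
  also have "\<dots> = 2 * (\<integral>\<^sup>+y\<in>?R. local_max ?R y \<partial>lborel)" by (simp add: nn_integral_cmult mult.assoc)
  also have "\<dots> \<le> 2 * (ennreal W * emeasure \<mu> ?R)"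
    using fujii_wilson[of m x] unfolding local_max_def[symmetric] by (rule mult_left_mono) simp
  also have "\<dots> = ennreal (2 * W) * emeasure \<mu> ?R"
    using W_pos by (simp add: ennreal_mult mult.assoc)
  finally show ?thesis .
qed

text \<open>
  Half of \<open>K\<close> is at least \<open>2 * W\<close>, so the packing estimate halves the weight of each stopping cell after
  \<open>K\<close> levels.
\<close>

lemma halving: "2 * emeasure \<mu> (reach (calm_above (i + K))) \<le> emeasure \<mu> (reach (calm_above i))"
proof -
  let ?A = "reach (calm_above (i + K))"
  let ?M = "density lborel (\<lambda>y. 2 * (w y * indicator ?A y))"
  have M: "emeasure ?M B = 2 * emeasure \<mu> (?A \<inter> B)" if [measurable]: "B \<in> sets borel" for B
    by (simp add: emeasure_density nn_integral_cmult mult.assoc flip: indicator_inter_arith)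
  have sub: "?A \<subseteq> reach (calm_above i)" by (rule reach_mono) (auto intro: calm_above_mono[of i "i + K"])
  have "emeasure ?M (reach (calm_above i)) \<le> emeasure \<mu> (reach (calm_above i))"
  proof (rule reach_le)
    fix m x assume first: "calm_above i (cell m x)" "\<And>k. k < m \<Longrightarrow> \<not> calm_above i (cell k x)"
    have "ennreal (2 * W) * (2 * emeasure \<mu> (?A \<inter> cell m x)) = ennreal (4 * W) * emeasure \<mu> (?A \<inter> cell m x)"
      using W_pos by (simp add: mult.assoc[symmetric] flip: ennreal_mult ennreal_numeral)
    also have "\<dots> \<le> of_nat K * emeasure \<mu> (?A \<inter> cell m x)"
      using K by (intro mult_right_mono) (simp_all add: ennreal_leI flip: ennreal_of_nat_eq_real_of_nat)
    also have "\<dots> \<le> ennreal (2 * W) * emeasure \<mu> (cell m x)" by (rule carleson_packing[OF first])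
    finally have "2 * emeasure \<mu> (?A \<inter> cell m x) \<le> emeasure \<mu> (cell m x)"
      using W_pos by (subst (asm) ennreal_mult_le_mult_iff) auto
    then show "emeasure ?M (cell m x) \<le> emeasure \<mu> (cell m x)" by (simp add: M)
  qed simp_all
  then show ?thesis using sub by (simp add: M Int_absorb2)
qed

lemma exponential_decay: "2 ^ N * emeasure \<mu> (reach (calm_above (N * K))) \<le> emeasure \<mu> (reach (calm_above 0))"
proof (induction N)
  case (Suc N)
  have "2 ^ Suc N * emeasure \<mu> (reach (calm_above (Suc N * K))) = 2 ^ N * (2 * emeasure \<mu> (reach (calm_above (N * K + K))))"
    by (simp add: mult_ac add.commute)
  also have "\<dots> \<le> 2 ^ N * emeasure \<mu> (reach (calm_above (N * K)))"
    by (rule mult_left_mono[OF halving]) simp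
  finally show ?case using Suc.IH by simp
qed simp

text \<open>
  Suppose that \<open>v'\<close> averages more than \<open>1 / 2\<close> over a cell through a calm point. Then \<open>v\<close> averages nearly
  \<open>1\<close> there, so the cell lies above all the levels, and exponential decay applies.
\<close>

lemma good_lambda:
  assumes v': "v' \<in> borel_measurable borel" "\<And>x. 0 \<le> v' x" "\<And>x. v' x \<le> 1"
    and on: "\<And>x. 0 < v' x \<Longrightarrow> v x = 1"
    and small: "height (N * K) + 2 * \<gamma> < 1"
  shows "emeasure \<mu> (reach (level v' (1 / 2)))
    \<le> emeasure \<mu> (reach (\<lambda>R. R \<subseteq> cell 0 a \<and> \<gamma> < osc v R)) + ennreal ((1 / 2) ^ N) * emeasure \<mu> (reach (level v (1 / 2)))"
proof -
  have "reach (level v' (1 / 2)) \<subseteq> reach (\<lambda>R. R \<subseteq> cell 0 a \<and> \<gamma> < osc v R) \<union> reach (calm_above (N * K))"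
  proof
    fix x assume "x \<in> reach (level v' (1 / 2))"
    then obtain m where m: "cell m x \<subseteq> cell 0 a" "1 / 2 < avg v' (cell m x)" by (auto simp: reach_def level_def)
    then have x0: "x \<in> cell 0 a" by auto
    then have "cell 0 x = cell 0 a" by (rule cell_eq)
    then have sub: "cell k x \<subseteq> cell 0 a" for k using cell_mono[of 0 k x] by simp
    show "x \<in> reach (\<lambda>R. R \<subseteq> cell 0 a \<and> \<gamma> < osc v R) \<union> reach (calm_above (N * K))"
    proof (cases "x \<in> calm")
      case False
      then show ?thesis using x0 sub by (auto simp: calm_def reach_def not_le)
    next
      case True
      have A: "avg v (cell m x) \<le> 1" by (rule avg_le[OF v])
      have "1 / 2 * (1 - avg v (cell m x)) \<le> avg v' (cell m x) * (1 - avg v (cell m x))"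
        using m(2) A by (intro mult_right_mono) auto
      also have "\<dots> \<le> osc v (cell m x)" by (rule osc_jump[OF v v' on])
      also have "\<dots> \<le> \<gamma>" using True by (simp add: calm_def)
      finally have "height (N * K) < avg v (cell m x)" using small by simp
      then have "calm_above (N * K) (cell m x)" using sub True by (auto simp: calm_above_def level_def)
      then show ?thesis by (auto simp: reach_def)
    qed
  qed
  then have "emeasure \<mu> (reach (level v' (1 / 2)))
      \<le> emeasure \<mu> (reach (\<lambda>R. R \<subseteq> cell 0 a \<and> \<gamma> < osc v R)) + emeasure \<mu> (reach (calm_above (N * K)))"
    by (intro order_trans[OF emeasure_mono emeasure_subadditive]) auto
  moreover have "emeasure \<mu> (reach (calm_above (N * K))) \<le> ennreal ((1 / 2) ^ N) * emeasure \<mu> (reach (level v (1 / 2)))"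
  proof -
    have "emeasure \<mu> (reach (calm_above (N * K))) = ennreal ((1 / 2) ^ N) * (2 ^ N * emeasure \<mu> (reach (calm_above (N * K))))"
    proof -
      have "ennreal ((1 / 2) ^ N) * 2 ^ N = 1"
        using ennreal_power[of 2 N] ennreal_mult[of "(1 / 2) ^ N" "2 ^ N"] by (simp flip: power_mult_distrib)
      then show ?thesis by (simp add: mult.assoc[symmetric])
    qed
    also have "\<dots> \<le> ennreal ((1 / 2) ^ N) * emeasure \<mu> (reach (calm_above 0))"
      by (rule mult_left_mono[OF exponential_decay]) simp
    also have "\<dots> \<le> ennreal ((1 / 2) ^ N) * emeasure \<mu> (reach (level v (1 / 2)))"
      by (intro mult_left_mono emeasure_mono reach_mono) (auto simp: calm_above_def height_def)
    finally show ?thesis .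
  qed
  ultimately show ?thesis by (meson add_left_mono order_trans)
qed

end

section \<open>A weighted weak-type bound for the oscillation\<close>

definition gagliardo :: "real \<Rightarrow> real \<Rightarrow> (real ^ 'n \<Rightarrow> real) \<Rightarrow> real ^ 'n \<Rightarrow> ennreal" where
  "gagliardo p q v x = (\<integral>\<^sup>+y. ennreal (\<bar>v x - v y\<bar> powr p / norm (x - y) powr q) \<partial>lborel)"

lemma gagliardo_borel [measurable]:
  assumes [measurable]: "v \<in> borel_measurable borel"
  shows "gagliardo p q v \<in> borel_measurable borel"
  unfolding gagliardo_def by measurable

text \<open>
  A form of Young's inequality with the free parameter \<open>s\<close>; integrating it and choosing \<open>s\<close> suitably
  replaces Jensen's inequality at the price of a constant.
\<close>

lemma le_add_powr:
  fixes s t p :: real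
  assumes s: "0 < s" and p: "1 \<le> p" and t: "0 \<le> t"
  shows "t \<le> s + s powr (1 - p) * t powr p"
proof (cases "t \<le> s")
  case True then show ?thesis by (simp add: add_increasing2)
next
  case False
  then have "1 \<le> s powr (1 - p) * t powr (p - 1)"
    using s p powr_mono2[of "p - 1" s t] by (simp add: powr_diff field_simps)
  then have "t * 1 \<le> t * (s powr (1 - p) * t powr (p - 1))" using t by (rule mult_left_mono)
  also have "\<dots> = s powr (1 - p) * t powr p"
    using False s powr_mult_base[of t "p - 1"] by simp
  finally show ?thesis using s by simp
qed

context fujii_wilson_grid
begin

text \<open>
  The dyadic version of the fractional maximal function; it is Borel measurable and bounds the full one
  from below.
\<close>

definition frac_max :: "real \<Rightarrow> real ^ 'n \<Rightarrow> ennreal" where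
  "frac_max \<alpha> x = (SUP k. ennreal ((l / 2 ^ k) powr \<alpha>) * (emeasure \<mu> (cell k x) / emeasure lborel (cell k x)))"

lemma frac_max_borel [measurable]: "frac_max \<alpha> \<in> borel_measurable borel"
  unfolding frac_max_def
proof (rule borel_measurable_SUP)
  fix k show "(\<lambda>x. ennreal ((l / 2 ^ k) powr \<alpha>) * (emeasure \<mu> (cell k x) / emeasure lborel (cell k x))) \<in> borel_measurable borel"
    by (rule cell_fun_borel[of "\<lambda>R. ennreal ((l / 2 ^ k) powr \<alpha>) * (emeasure \<mu> R / emeasure lborel R)" k])
qed simp

text \<open>
  The mean oscillation is at most the mean of the differences over pairs of points. Splitting each
  difference by \<open>le_add_powr\<close> at height \<open>s = \<gamma> / 2\<close>, the first part accounts for only half of \<open>\<gamma>\<close>, so the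
  \<open>p\<close>-th powers must account for the other half.
\<close>

lemma osc_le_p_osc:
  fixes p \<gamma> :: real
  assumes v [measurable]: "v \<in> borel_measurable borel" and v01: "\<And>x. 0 \<le> v x" "\<And>x. v x \<le> 1"
    and p: "1 \<le> p" and \<gamma>: "0 < \<gamma>" "\<gamma> < osc v (cell m x)"
  shows "ennreal ((\<gamma> / 2) powr p * (measure lborel (cell m x))\<^sup>2)
    \<le> (\<integral>\<^sup>+y\<in>cell m x. (\<integral>\<^sup>+z\<in>cell m x. ennreal (\<bar>v y - v z\<bar> powr p) \<partial>lborel) \<partial>lborel)"
proof -
  let ?R = "cell m x" and ?A = "avg v (cell m x)" and ?V = "measure lborel (cell m x)"
  define s where "s = \<gamma> / 2"
  have s: "0 < s" using \<gamma> by (simp add: s_def)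
  define h where "h y = (\<integral>\<^sup>+z\<in>?R. ennreal (\<bar>v y - v z\<bar> powr p) \<partial>lborel)" for y
  have hm [measurable]: "h \<in> borel_measurable borel" unfolding h_def by measurable
  have V: "0 < ?V" by (rule cell_measure_pos)
  have emV: "emeasure lborel ?R = ennreal ?V" by (rule cell_emeasure_eq)
  have diff1: "\<bar>v y - v z\<bar> \<le> 1" for y z
    using v01(1)[of y] v01(2)[of y] v01(1)[of z] v01(2)[of z] by linarith
  have pt: "ennreal (\<bar>v y - ?A\<bar> * ?V) \<le> ennreal (s * ?V) + ennreal (s powr (1 - p)) * h y" for y
  proof -
    have i1: "set_integrable lborel ?R (\<lambda>z. \<bar>v y - v z\<bar>)"
      by (rule set_integrable_bounded[where B = 1]) (use diff1 in auto)
    have "(LINT z:?R|lborel. v z - v y) = (?A - v y) * ?V"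
    proof -
      have "avg (\<lambda>z. v z - v y) ?R = ?A - v y"
        by (rule avg_minus_const[where B = 1]) (use v01 in auto)
      then show ?thesis using avg_integral[of m x "\<lambda>z. v z - v y"] by simp
    qed
    then have "\<bar>v y - ?A\<bar> * ?V = \<bar>LINT z:?R|lborel. v z - v y\<bar>"
      using V by (simp add: abs_mult abs_minus_commute)
    also have "\<dots> \<le> (LINT z:?R|lborel. \<bar>v y - v z\<bar>)"
    proof -
      have "\<bar>LINT z:?R|lborel. v z - v y\<bar> \<le> (LINT z|lborel. norm (indicator ?R z *\<^sub>R (v z - v y)))"
        unfolding set_lebesgue_integral_def using integral_norm_bound[of lborel "\<lambda>z. indicator ?R z *\<^sub>R (v z - v y)"] by simp
      also have "\<dots> = (LINT z:?R|lborel. \<bar>v y - v z\<bar>)"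
        unfolding set_lebesgue_integral_def by (intro Bochner_Integration.integral_cong) (auto simp: abs_mult abs_minus_commute)
      finally show ?thesis .
    qed
    finally have "ennreal (\<bar>v y - ?A\<bar> * ?V) \<le> ennreal (LINT z:?R|lborel. \<bar>v y - v z\<bar>)" by (rule ennreal_leI)
    also have "\<dots> = (\<integral>\<^sup>+z\<in>?R. ennreal \<bar>v y - v z\<bar> \<partial>lborel)"
    proof -
      have "(\<integral>\<^sup>+z. ennreal (indicator ?R z *\<^sub>R \<bar>v y - v z\<bar>) \<partial>lborel) = ennreal (LINT z:?R|lborel. \<bar>v y - v z\<bar>)"
        unfolding set_lebesgue_integral_def using i1 by (intro nn_integral_eq_integral) (auto simp: set_integrable_def)
      moreover have "(\<integral>\<^sup>+z. ennreal (indicator ?R z *\<^sub>R \<bar>v y - v z\<bar>) \<partial>lborel) = (\<integral>\<^sup>+z\<in>?R. ennreal \<bar>v y - v z\<bar> \<partial>lborel)"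
        by (intro nn_integral_cong) (auto simp: indicator_def)
      ultimately show ?thesis by simp
    qed
    also have "\<dots> \<le> (\<integral>\<^sup>+z. ennreal s * indicator ?R z + ennreal (s powr (1 - p)) * (ennreal (\<bar>v y - v z\<bar> powr p) * indicator ?R z) \<partial>lborel)"
    proof (rule nn_integral_mono)
      fix z
      have "ennreal \<bar>v y - v z\<bar> \<le> ennreal s + ennreal (s powr (1 - p)) * ennreal (\<bar>v y - v z\<bar> powr p)"
        using le_add_powr[OF s p, of "\<bar>v y - v z\<bar>"] s by (simp add: ennreal_leI flip: ennreal_plus ennreal_mult)
      then show "ennreal \<bar>v y - v z\<bar> * indicator ?R z \<le> ennreal s * indicator ?R z + ennreal (s powr (1 - p)) * (ennreal (\<bar>v y - v z\<bar> powr p) * indicator ?R z)"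
        by (simp add: indicator_def)
    qed
    also have "\<dots> = ennreal (s * ?V) + ennreal (s powr (1 - p)) * h y"
      unfolding h_def using s by (simp add: nn_integral_add nn_integral_cmult emV ennreal_mult)
    finally show ?thesis .
  qed
  have f1: "\<bar>\<bar>v y - ?A\<bar>\<bar> \<le> 1" for y using osc_ge[OF v v01] by simp
  let ?H = "\<integral>\<^sup>+y\<in>?R. h y \<partial>lborel"
  have "ennreal (2 * s * ?V\<^sup>2) \<le> ennreal (osc v ?R * ?V * ?V)"
    using \<gamma> V by (intro ennreal_leI) (simp add: s_def power2_eq_square mult_right_mono)
  also have "\<dots> = ennreal (avg (\<lambda>y. \<bar>v y - ?A\<bar>) ?R * ?V) * ennreal ?V"
    using osc_nonneg[of v ?R] V by (subst ennreal_mult) (auto simp: osc_def)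
  also have "\<dots> = (\<integral>\<^sup>+y\<in>?R. ennreal \<bar>v y - ?A\<bar> \<partial>lborel) * ennreal ?V"
    by (subst density_avg[symmetric, where B = 1]) (use f1 in \<open>auto simp: emeasure_density\<close>)
  also have "\<dots> = (\<integral>\<^sup>+y. ennreal (\<bar>v y - ?A\<bar> * ?V) * indicator ?R y \<partial>lborel)"
    using V by (subst nn_integral_multc[symmetric]) (auto simp: ennreal_mult mult_ac)
  also have "\<dots> \<le> (\<integral>\<^sup>+y. ennreal (s * ?V) * indicator ?R y + ennreal (s powr (1 - p)) * (h y * indicator ?R y) \<partial>lborel)"
    by (rule nn_integral_mono) (use pt in \<open>auto simp: indicator_def\<close>)
  also have "\<dots> = ennreal (s * ?V\<^sup>2) + ennreal (s powr (1 - p)) * ?H"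
    using s V by (simp add: nn_integral_add nn_integral_cmult emV power2_eq_square mult.assoc flip: ennreal_mult)
  finally have "ennreal (s * ?V\<^sup>2) + ennreal (s * ?V\<^sup>2) \<le> ennreal (s * ?V\<^sup>2) + ennreal (s powr (1 - p)) * ?H"
    using s V by (simp add: mult.assoc flip: ennreal_plus)
  then have "ennreal (s * ?V\<^sup>2) \<le> ennreal (s powr (1 - p)) * ?H"
    by (simp add: ennreal_add_left_cancel_le)
  then have "ennreal (s powr (p - 1)) * ennreal (s * ?V\<^sup>2) \<le> ennreal (s powr (p - 1)) * (ennreal (s powr (1 - p)) * ?H)"
    by (rule mult_left_mono) simp
  also have "\<dots> = ?H"
  proof -
    have "ennreal (s powr (p - 1)) * ennreal (s powr (1 - p)) = 1"
      using s by (simp flip: ennreal_mult powr_add)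
    then show ?thesis by (simp add: mult.assoc[symmetric])
  qed
  also have "ennreal (s powr (p - 1)) * ennreal (s * ?V\<^sup>2) = ennreal (s powr p * ?V\<^sup>2)"
    using s powr_mult_base[of s "p - 1"] by (simp add: mult_ac flip: ennreal_mult)
  finally show ?thesis unfolding s_def h_def .
qed

text \<open>
  On a maximal cell \<open>R\<close> with oscillation above \<open>\<gamma>\<close>, the unweighted Poincare inequality bounds \<open>\<gamma> powr p\<close> by the
  average energy over \<open>R\<close> times the side length to the power \<open>\<delta> * p\<close>. Multiplying by the weight of \<open>R\<close>
  produces the quantity whose supremum is the fractional maximal function.
\<close>

lemma osc_weak_type_weighted:
  fixes p \<delta> \<gamma> :: real
  assumes v [measurable]: "v \<in> borel_measurable borel" and v01: "\<And>x. 0 \<le> v x" "\<And>x. v x \<le> 1"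
    and p: "1 \<le> p" and \<delta>: "0 < \<delta>" "\<delta> < 1" and \<gamma>: "0 < \<gamma>"
  defines "q \<equiv> real CARD('n) + \<delta> * p"
  shows "ennreal ((\<gamma> / 2) powr p) * emeasure \<mu> (reach (\<lambda>R. R \<subseteq> cell 0 a \<and> \<gamma> < osc v R))
    \<le> ennreal (2 * p * (1 - \<delta>) * sqrt CARD('n) powr (CARD('n) + p)) *
      (\<integral>\<^sup>+x\<in>cell 0 a. gagliardo p q v x * frac_max (\<delta> * p) x \<partial>lborel)"
proof -
  let ?n = "real CARD('n)"
  let ?C = "2 * p * (1 - \<delta>) * sqrt CARD('n) powr (CARD('n) + p)"
  let ?P = "\<lambda>R. R \<subseteq> cell 0 a \<and> \<gamma> < osc v R"
  let ?M = "density lborel (\<lambda>x. ennreal ((\<gamma> / 2) powr p) * w x)"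
  let ?N = "density lborel (\<lambda>x. ennreal ?C * (gagliardo p q v x * frac_max (\<delta> * p) x))"
  have n1: "1 \<le> ?n" by (simp add: Suc_le_eq)
  have C: "0 \<le> ?C" using p \<delta> by simp
  have M: "emeasure ?M B = ennreal ((\<gamma> / 2) powr p) * emeasure \<mu> B" if [measurable]: "B \<in> sets borel" for B
    by (simp add: emeasure_density nn_integral_cmult mult.assoc)
  have N: "emeasure ?N B = ennreal ?C * (\<integral>\<^sup>+x\<in>B. gagliardo p q v x * frac_max (\<delta> * p) x \<partial>lborel)" if [measurable]: "B \<in> sets borel" for B
    by (simp add: emeasure_density nn_integral_cmult mult.assoc)
  have "emeasure ?M (reach ?P) \<le> emeasure ?N (reach ?P)"
  proof (rule reach_le)
    fix m x assume R: "?P (cell m x)"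
    let ?R = "cell m x" and ?V = "measure lborel (cell m x)"
    define r where "r = l / 2 ^ m"
    have r: "0 < r" using l by (simp add: r_def)
    have V: "0 < ?V" by (rule cell_measure_pos)
    have Vr: "?V = r powr ?n" using r by (simp add: cell_measure r_def powr_realpow)
    let ?d = "sqrt ?n * r"
    have dq: "?d powr q \<le> sqrt ?n powr (?n + p) * r powr (\<delta> * p) * ?V"
    proof -
      have "?d powr q = sqrt ?n powr q * r powr q" using r by (simp add: powr_mult)
      also have "\<dots> \<le> sqrt ?n powr (?n + p) * r powr q"
        using n1 \<delta> p by (intro mult_right_mono powr_mono) (auto simp: q_def)
      also have "r powr q = r powr (\<delta> * p) * ?V" by (simp add: q_def Vr powr_add)
      finally show ?thesis by simp
    qed
    let ?J = "\<integral>\<^sup>+y\<in>?R. gagliardo p q v y \<partial>lborel"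
    have "ennreal ((\<gamma> / 2) powr p * ?V\<^sup>2)
        \<le> (\<integral>\<^sup>+y\<in>?R. (\<integral>\<^sup>+z\<in>?R. ennreal (\<bar>v y - v z\<bar> powr p) \<partial>lborel) \<partial>lborel)"
      by (rule osc_le_p_osc) (use v v01 p \<gamma> R in auto)
    also have "\<dots> \<le> ennreal (2 * p * (1 - \<delta>) * ?d powr q) *
      (\<integral>\<^sup>+x\<in>?R. (\<integral>\<^sup>+y\<in>?R. ennreal (\<bar>v x - v y\<bar> powr p / norm (x - y) powr q) \<partial>lborel) \<partial>lborel)"
      unfolding q_def
      by (rule bbm_poincare) (use l n1 p \<delta> cell_convex cell_diam[of _ m x] in \<open>auto simp: r_def\<close>)
    also have "\<dots> \<le> ennreal (?C * r powr (\<delta> * p) * ?V) * ?J"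
    proof (rule mult_mono)
      have "2 * p * (1 - \<delta>) * ?d powr q \<le> 2 * p * (1 - \<delta>) * (sqrt ?n powr (?n + p) * r powr (\<delta> * p) * ?V)"
        using dq p \<delta> by (intro mult_left_mono) auto
      then show "ennreal (2 * p * (1 - \<delta>) * ?d powr q) \<le> ennreal (?C * r powr (\<delta> * p) * ?V)"
        by (intro ennreal_leI) (simp add: mult_ac)
      show "(\<integral>\<^sup>+x\<in>?R. (\<integral>\<^sup>+y\<in>?R. ennreal (\<bar>v x - v y\<bar> powr p / norm (x - y) powr q) \<partial>lborel) \<partial>lborel) \<le> ?J"
        unfolding gagliardo_def by (intro nn_integral_mono mult_right_mono) (auto simp: indicator_def)
    qed auto
    finally have "ennreal ((\<gamma> / 2) powr p * ?V\<^sup>2) \<le> ennreal (?C * r powr (\<delta> * p) * ?V) * ?J" .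
    then have "ennreal (1 / ?V) * ennreal ((\<gamma> / 2) powr p * ?V\<^sup>2) \<le> ennreal (1 / ?V) * (ennreal (?C * r powr (\<delta> * p) * ?V) * ?J)"
      by (rule mult_left_mono) simp
    moreover have "ennreal (1 / ?V) * ennreal ((\<gamma> / 2) powr p * ?V\<^sup>2) = ennreal ((\<gamma> / 2) powr p) * emeasure lborel ?R"
      unfolding cell_emeasure_eq using V by (simp add: power2_eq_square flip: ennreal_mult)
    moreover have "ennreal (1 / ?V) * (ennreal (?C * r powr (\<delta> * p) * ?V) * ?J) = ennreal ?C * (ennreal (r powr (\<delta> * p)) * ?J)"
    proof -
      have "ennreal (1 / ?V) * ennreal (?C * r powr (\<delta> * p) * ?V) = ennreal ?C * ennreal (r powr (\<delta> * p))"
        using V C by (simp flip: ennreal_mult)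
      then show ?thesis by (simp add: mult.assoc[symmetric])
    qed
    ultimately have key: "ennreal ((\<gamma> / 2) powr p) * emeasure lborel ?R \<le> ennreal ?C * (ennreal (r powr (\<delta> * p)) * ?J)" by simp
    let ?c = "emeasure \<mu> ?R / emeasure lborel ?R"
    have "emeasure ?M ?R = ennreal ((\<gamma> / 2) powr p) * (?c * emeasure lborel ?R)"
      using V by (simp add: M cell_emeasure_eq ennreal_divide_times ennreal_mult_divide_eq)
    also have "\<dots> = ?c * (ennreal ((\<gamma> / 2) powr p) * emeasure lborel ?R)" by (simp add: mult_ac)
    also have "\<dots> \<le> ?c * (ennreal ?C * (ennreal (r powr (\<delta> * p)) * ?J))" by (rule mult_left_mono[OF key]) simp
    also have "\<dots> = ennreal ?C * (\<integral>\<^sup>+y\<in>?R. gagliardo p q v y * (ennreal (r powr (\<delta> * p)) * ?c) \<partial>lborel)"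
    proof -
      have "?J * (ennreal (r powr (\<delta> * p)) * ?c) = (\<integral>\<^sup>+y\<in>?R. gagliardo p q v y * (ennreal (r powr (\<delta> * p)) * ?c) \<partial>lborel)"
        by (subst nn_integral_multc[symmetric]) (auto simp: mult_ac)
      moreover have "?c * (ennreal ?C * (ennreal (r powr (\<delta> * p)) * ?J)) = ennreal ?C * (?J * (ennreal (r powr (\<delta> * p)) * ?c))"
        by (simp only: mult_ac)
      ultimately show ?thesis by (simp only:)
    qed
    also have "\<dots> \<le> ennreal ?C * (\<integral>\<^sup>+y\<in>?R. gagliardo p q v y * frac_max (\<delta> * p) y \<partial>lborel)"
    proof (intro mult_left_mono nn_integral_mono)
      fix y
      have "ennreal (r powr (\<delta> * p)) * ?c \<le> frac_max (\<delta> * p) y" if "y \<in> ?R"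
        unfolding frac_max_def using cell_eq[OF that] by (intro SUP_upper2[of m]) (auto simp: r_def)
      then show "gagliardo p q v y * (ennreal (r powr (\<delta> * p)) * ?c) * indicator ?R y \<le> gagliardo p q v y * frac_max (\<delta> * p) y * indicator ?R y"
        by (cases "y \<in> ?R") (auto intro: mult_left_mono)
    qed simp
    also have "\<dots> = emeasure ?N ?R" by (simp add: N)
    finally show "emeasure ?M ?R \<le> emeasure ?N ?R" .
  qed simp_all
  also have "\<dots> \<le> emeasure ?N (cell 0 a)" by (rule emeasure_mono) (auto simp: reach_def)
  finally show ?thesis by (simp add: M N)
qed

end

section \<open>Truncation: from weak type to strong type\<close>

text \<open>
  The part of \<open>t\<close> between the levels \<open>r\<close> and \<open>2 * r\<close>, rescaled to \<open>[0, 1]\<close>.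
\<close>

definition truncate :: "real \<Rightarrow> real \<Rightarrow> real" where
  "truncate r t = min 1 (max 0 (t / r - 1))"

lemma truncate_bounds: "0 \<le> truncate r t" "truncate r t \<le> 1"
  by (auto simp: truncate_def)

lemma truncate_borel [measurable]: "truncate r \<in> borel_measurable borel"
  unfolding truncate_def by measurable

lemma truncate_mono: "0 < r \<Longrightarrow> s \<le> t \<Longrightarrow> truncate r s \<le> truncate r t"
  unfolding truncate_def by (intro min.mono max.mono diff_mono divide_right_mono) auto

text \<open>
  Stacking the slices between consecutive dyadic levels gives back the part of \<open>t\<close> between the lowest and
  the highest level.
\<close>

lemma sum_truncate:
  assumes r: "0 < r"
  shows "(\<Sum>k<N. r * 2 ^ k * truncate (r * 2 ^ k) t) = min (r * 2 ^ N - r) (max 0 (t - r))"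
proof (induction N)
  case (Suc N)
  define s where "s = r * 2 ^ N"
  have s: "r \<le> s" using r by (simp add: s_def)
  have "s * truncate s t = min s (max 0 (t - s))"
    using s r by (auto simp: truncate_def min_def max_def field_simps)
  then have "(\<Sum>k<Suc N. r * 2 ^ k * truncate (r * 2 ^ k) t) = min (s - r) (max 0 (t - r)) + min s (max 0 (t - s))"
    using Suc.IH by (simp add: s_def)
  also have "\<dots> = min (2 * s - r) (max 0 (t - r))" using s r by (auto simp: min_def max_def)
  finally show ?case by (simp add: s_def mult_ac)
qed (simp add: r)

lemma powr_add_ge:
  fixes s t p :: real
  assumes "1 \<le> p" "0 \<le> s" "0 \<le> t"
  shows "s powr p + t powr p \<le> (s + t) powr p"
proof -
  have base: "y powr p = y * y powr (p - 1)" if "0 \<le> y" for y :: real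
    using that assms powr_mult_base[of y "p - 1"] by (cases "y = 0") auto
  have "s powr p + t powr p = s * s powr (p - 1) + t * t powr (p - 1)" using base assms by simp
  also have "\<dots> \<le> s * (s + t) powr (p - 1) + t * (s + t) powr (p - 1)"
    using assms by (intro add_mono mult_left_mono powr_mono2) auto
  also have "\<dots> = (s + t) powr p" using base[of "s + t"] assms by (simp add: distrib_right)
  finally show ?thesis .
qed

lemma sum_powr_le:
  fixes f :: "nat \<Rightarrow> real"
  assumes "1 \<le> p" "\<And>k. 0 \<le> f k"
  shows "(\<Sum>k<N. f k powr p) \<le> (\<Sum>k<N. f k) powr p"
proof (induction N)
  case (Suc N)
  then show ?case using powr_add_ge[OF assms(1) sum_nonneg[of "{..<N}" f] assms(2)[of N]] assms(2) by simp
qed simp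

text \<open>
  All slices are monotone, so their increments between \<open>s\<close> and \<open>t\<close> have the same sign and add up to at
  most the distance of \<open>s\<close> and \<open>t\<close>; the \<open>p\<close>-th powers are superadditive.
\<close>

lemma sum_truncate_diff:
  assumes r: "0 < r" and p: "1 \<le> p"
  shows "(\<Sum>k<N. (r * 2 ^ k) powr p * \<bar>truncate (r * 2 ^ k) s - truncate (r * 2 ^ k) t\<bar> powr p) \<le> \<bar>s - t\<bar> powr p"
proof -
  have *: "(\<Sum>k<N. (r * 2 ^ k) powr p * \<bar>truncate (r * 2 ^ k) s - truncate (r * 2 ^ k) t\<bar> powr p) \<le> \<bar>s - t\<bar> powr p"
    if "t \<le> s" for s t :: real
  proof -
    let ?f = "\<lambda>k. r * 2 ^ k * (truncate (r * 2 ^ k) s - truncate (r * 2 ^ k) t)"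
    have f: "0 \<le> ?f k" for k using truncate_mono[OF _ that, of "r * 2 ^ k"] r by simp
    have "(\<Sum>k<N. (r * 2 ^ k) powr p * \<bar>truncate (r * 2 ^ k) s - truncate (r * 2 ^ k) t\<bar> powr p) = (\<Sum>k<N. ?f k powr p)"
      using r truncate_mono[OF _ that] by (intro sum.cong) (auto simp: powr_mult)
    also have "\<dots> \<le> (\<Sum>k<N. ?f k) powr p" by (rule sum_powr_le[OF p f])
    also have "(\<Sum>k<N. ?f k) = min (r * 2 ^ N - r) (max 0 (s - r)) - min (r * 2 ^ N - r) (max 0 (t - r))"
      by (simp add: right_diff_distrib sum_subtractf sum_truncate[OF r])
    also have "\<dots> powr p \<le> \<bar>s - t\<bar> powr p"
      using p that by (intro powr_mono2) (auto simp: min_def max_def)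
    finally show ?thesis .
  qed
  show ?thesis
  proof (cases "t \<le> s")
    case False
    then show ?thesis using *[of s t] by (simp add: abs_minus_commute)
  qed (rule *)
qed

lemma truncate_eq_1:
  assumes "0 < r" "2 * r \<le> t"
  shows "truncate r t = 1"
proof -
  have "2 \<le> t / r" using assms by (simp add: field_simps)
  then show ?thesis by (simp add: truncate_def)
qed

lemma truncate_gt:
  assumes "0 < r" "0 < truncate r t"
  shows "r < t"
proof -
  have "0 < t / r - 1" using assms(2) unfolding truncate_def by linarith
  then show ?thesis using assms(1) by (simp add: field_simps)
qed

lemma truncate_level:
  assumes r: "0 < r" and t: "2 * r \<le> t"
  obtains k where "truncate (r * 2 ^ k) t = 1" "t \<le> 4 * (r * 2 ^ k)"
proof -
  obtain j0 where j0: "t / r < 2 ^ j0" using real_arch_pow[of 2 "t / r"] by auto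
  \<comment> \<open>The level sought lies two steps below the first one that exceeds \<open>t\<close>.\<close>
  define j where "j = (LEAST j. t < r * 2 ^ j)"
  have ex: "t < r * 2 ^ j0" using j0 r by (simp add: field_simps)
  have j: "t < r * 2 ^ j" unfolding j_def by (rule LeastI[of "\<lambda>j. t < r * 2 ^ j", OF ex])
  have "2 \<le> j"
  proof (rule ccontr)
    assume "\<not> 2 \<le> j"
    then have "j \<le> 1" by simp
    then have "(2::real) ^ j \<le> 2 ^ 1" by (intro power_increasing) auto
    then have "r * 2 ^ j \<le> r * 2" using r by simp
    then show False using j t by simp
  qed
  then obtain k where k: "j = Suc (Suc k)" by (metis Suc_le_D numeral_2_eq_2 Suc_le_mono)
  have "\<not> t < r * 2 ^ Suc k" using not_less_Least[of "Suc k" "\<lambda>j. t < r * 2 ^ j"] k j_def by auto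
  then have "2 * (r * 2 ^ k) \<le> t" by simp
  then have "truncate (r * 2 ^ k) t = 1" using r by (intro truncate_eq_1) auto
  moreover have "t \<le> 4 * (r * 2 ^ k)" using j k by simp
  ultimately show ?thesis using that by blast
qed

lemma truncate_next: "0 < r \<Longrightarrow> 0 < truncate (r * 2 ^ Suc k) t \<Longrightarrow> truncate (r * 2 ^ k) t = 1"
  using truncate_gt[of "r * 2 ^ Suc k" t] truncate_eq_1[of "r * 2 ^ k" t] by simp

text \<open>
  The pointwise inequality \<open>sum_truncate_diff\<close> is integrated against the kernel; a nonlocal energy behaves
  under truncation as well as a gradient does, although the truncations interact.
\<close>

lemma sum_gagliardo_truncate:
  assumes r: "0 < r" and p: "1 \<le> p" and u [measurable]: "u \<in> borel_measurable borel"
  shows "(\<Sum>k<N. ennreal ((r * 2 ^ k) powr p) * gagliardo p q (\<lambda>x. truncate (r * 2 ^ k) (u x - c)) x) \<le> gagliardo p q u x"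
proof -
  let ?v = "\<lambda>k x. truncate (r * 2 ^ k) (u x - c)"
  have "(\<Sum>k<N. ennreal ((r * 2 ^ k) powr p) * gagliardo p q (?v k) x)
      = (\<integral>\<^sup>+y. (\<Sum>k<N. ennreal ((r * 2 ^ k) powr p) * ennreal (\<bar>?v k x - ?v k y\<bar> powr p / norm (x - y) powr q)) \<partial>lborel)"
    unfolding gagliardo_def by (simp add: nn_integral_sum nn_integral_cmult)
  also have "\<dots> \<le> gagliardo p q u x"
    unfolding gagliardo_def
  proof (rule nn_integral_mono)
    fix y
    have "(\<Sum>k<N. ennreal ((r * 2 ^ k) powr p) * ennreal (\<bar>?v k x - ?v k y\<bar> powr p / norm (x - y) powr q))
      = ennreal ((\<Sum>k<N. (r * 2 ^ k) powr p * \<bar>?v k x - ?v k y\<bar> powr p) / norm (x - y) powr q)"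
      by (subst sum_divide_distrib, subst sum_ennreal[symmetric]) (auto simp: ennreal_mult[symmetric])
    also have "\<dots> \<le> ennreal (\<bar>u x - u y\<bar> powr p / norm (x - y) powr q)"
      using sum_truncate_diff[OF r p, where N = N and s = "u x - c" and t = "u y - c"]
      by (intro ennreal_leI divide_right_mono) auto
    finally show "(\<Sum>k<N. ennreal ((r * 2 ^ k) powr p) * ennreal (\<bar>?v k x - ?v k y\<bar> powr p / norm (x - y) powr q))
      \<le> ennreal (\<bar>u x - u y\<bar> powr p / norm (x - y) powr q)" .
  qed
  finally show ?thesis .
qed

lemma ennreal_absorb_half:
  assumes "A \<le> X + ennreal (1 / 2) * A" "A < top"
  shows "A \<le> 2 * X"
proof (cases "X = top")
  case False
  obtain x where x: "X = ennreal x" "0 \<le> x" using False by (cases X) auto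
  obtain y where y: "A = ennreal y" "0 \<le> y" using assms(2) by (cases A) auto
  have "ennreal y \<le> ennreal (x + 1 / 2 * y)"
    using assms(1) x y by (simp only: ennreal_plus ennreal_mult mult_nonneg_nonneg zero_le_divide_1_iff zero_le_numeral)
  then have "y \<le> x + 1 / 2 * y" using x y by (subst (asm) ennreal_le_iff) auto
  then have "y \<le> 2 * x" by simp
  then show ?thesis using x y ennreal_leI[of y "2 * x"] by (simp add: ennreal_mult)
qed (simp add: ennreal_mult_top)

context fujii_wilson_grid
begin

text \<open>
  Let \<open>\<alpha> k\<close> be the weighted measure of the set where some dyadic average of the \<open>k\<close>-th truncation exceeds
  \<open>1 / 2\<close>. By density of cells it controls the level set of \<open>u - m\<close> at \<open>r * 2 ^ (k + 1)\<close>. The good-lambda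
  inequality is a recursion for \<open>\<alpha>\<close> whose coefficient is small enough to be absorbed after summation
  with the weights \<open>(r * 2 ^ k) powr p\<close>; absorption is legitimate because \<open>\<alpha> k\<close> is at most the finite
  weight of the cube. The inhomogeneous terms are summed by the truncation method. The lowest level \<open>r\<close>
  contributes an error that is made at most \<open>e\<close> by the choice of \<open>r\<close>.
\<close>

lemma positive_part_estimate:
  fixes p \<delta> \<gamma> m :: real and u :: "real ^ 'n \<Rightarrow> real" and K M :: nat
  assumes u [measurable]: "u \<in> borel_measurable borel"
    and median: "2 * measure lborel {x \<in> cell 0 a. m < u x} \<le> measure lborel (cell 0 a)"
    and p: "1 \<le> p" and \<delta>: "0 < \<delta>" "\<delta> < 1" and \<gamma>: "0 < \<gamma>" and K: "4 * W \<le> real K"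
    and M: "2 powr p * (1 / 2) ^ M \<le> 1 / 2"
    and small: "1 / 2 + real (M * K) * ((2 ^ CARD('n) + 2) * \<gamma>) + 2 * \<gamma> < 1"
  defines "q \<equiv> real CARD('n) + \<delta> * p"
  defines "C \<equiv> 2 * p * (1 - \<delta>) * sqrt CARD('n) powr (CARD('n) + p)"
  shows "(\<integral>\<^sup>+x\<in>cell 0 a. ennreal (max 0 (u x - m) powr p) \<partial>\<mu>)
    \<le> ennreal (2 * 8 powr p * (2 / \<gamma>) powr p * C) * (\<integral>\<^sup>+x\<in>cell 0 a. gagliardo p q u x * frac_max (\<delta> * p) x \<partial>lborel)"
proof (rule ennreal_le_epsilon)
  fix e :: real assume e: "0 < e"
  let ?Q = "cell 0 a"
  define J where "J = (\<integral>\<^sup>+x\<in>?Q. gagliardo p q u x * frac_max (\<delta> * p) x \<partial>lborel)"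
  define Y where "Y = measure \<mu> ?Q"
  have Y: "emeasure \<mu> ?Q = ennreal Y" "0 \<le> Y"
    using w_finite[of 0 a] unfolding Y_def by (auto intro!: emeasure_eq_ennreal_measure simp: less_top)
  define E where "E = (2 powr p + 2 * 4 powr p) * Y"
  have E: "0 \<le> E" using Y by (simp add: E_def)
  \<comment> \<open>The error terms that come from the lowest level add up to \<open>r powr p * E\<close>.\<close>
  define r where "r = (e / (E + 1)) powr (1 / p)"
  have r: "0 < r" using e E by (simp add: r_def)
  have rE: "r powr p * E \<le> e"
    using e E p by (simp add: r_def powr_powr field_simps)
  define v where "v k x = truncate (r * 2 ^ k) (u x - m)" for k :: nat and x
  have vm [measurable]: "v k \<in> borel_measurable borel" for k unfolding v_def by measurable
  have v01: "0 \<le> v k x" "v k x \<le> 1" for k x by (auto simp: v_def truncate_bounds)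
  have vnext: "0 < v (Suc k) x \<Longrightarrow> v k x = 1" for k x unfolding v_def by (rule truncate_next[OF r])
  define \<alpha> where "\<alpha> k = emeasure \<mu> (reach (level (v k) (1 / 2)))" for k
  define \<beta> where "\<beta> k = emeasure \<mu> (reach (\<lambda>R. R \<subseteq> ?Q \<and> \<gamma> < osc (v k) R))" for k
  have reachQ: "reach (level f s) \<subseteq> ?Q" for f s by (auto simp: reach_def level_def)
  have \<alpha>Y: "\<alpha> k \<le> ennreal Y" for k
    unfolding \<alpha>_def Y(1)[symmetric] by (rule emeasure_mono[OF reachQ]) simp
  have top_avg: "avg (v k) ?Q \<le> 1 / 2" for k
  proof -
    let ?I = "\<lambda>x. indicator {x \<in> ?Q. m < u x} x :: real"
    have "avg (v k) ?Q \<le> avg ?I ?Q"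
    proof (rule avg_mono[where B = 1])
      fix y assume "y \<in> ?Q"
      show "v k y \<le> ?I y"
      proof (cases "m < u y")
        case True
        then show ?thesis using \<open>y \<in> ?Q\<close> v01(2)[of k y] by simp
      next
        case False
        moreover have "0 < r * 2 ^ k" using r by simp
        ultimately have "\<not> 0 < truncate (r * 2 ^ k) (u y - m)"
          using truncate_gt[of "r * 2 ^ k" "u y - m"] by linarith
        then show ?thesis using False by (simp add: v_def)
      qed
    qed (use v01 in \<open>auto simp: indicator_def\<close>)
    also have "avg ?I ?Q = measure lborel {x \<in> ?Q. m < u x} / measure lborel ?Q"
    proof -
      have "{x \<in> ?Q. m < u x} \<in> fmeasurable lborel"
        by (rule fmeasurableI2[OF cell_fmeasurable]) auto
      then have "(LINT x:?Q|lborel. ?I x) = measure lborel {x \<in> ?Q. m < u x}"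
        unfolding set_lebesgue_integral_def
        by (simp add: indicator_inter_arith[symmetric] Int_absorb1 fmeasurable_def)
      then show ?thesis by (simp add: avg_def)
    qed
    also have "\<dots> \<le> 1 / 2" using median cell_measure_pos[of 0 a] by (simp add: field_simps)
    finally show ?thesis .
  qed
  have rec: "\<alpha> (Suc k) \<le> \<beta> k + ennreal ((1 / 2) ^ M) * \<alpha> k" for k
  proof -
    interpret gl: good_lambda a l w W "v k" \<gamma> K
      by unfold_locales (use v01 top_avg \<gamma> K in auto)
    show ?thesis unfolding \<alpha>_def \<beta>_def
      by (rule gl.good_lambda) (use v01 vnext small in \<open>auto simp: gl.height_def\<close>)
  qed
  define L where "L k = (r * 2 ^ k) powr p" for k :: nat
  have L: "0 \<le> L k" "L (Suc k) = 2 powr p * L k" "L 0 = r powr p" for k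
    using r by (auto simp: L_def powr_mult mult_ac)
  define C1 where "C1 = (2 / \<gamma>) powr p * C"
  have C: "0 \<le> C" using p \<delta> by (simp add: C_def)
  have C1: "0 \<le> C1" using C by (simp add: C1_def)
  have weak: "(\<Sum>k<N. ennreal (L k) * \<beta> k) \<le> ennreal C1 * J" for N
  proof -
    have w1: "\<beta> k \<le> ennreal C1 * (\<integral>\<^sup>+x\<in>?Q. gagliardo p q (v k) x * frac_max (\<delta> * p) x \<partial>lborel)" (is "_ \<le> _ * ?G") for k
    proof -
      have "ennreal ((2 / \<gamma>) powr p) * (ennreal ((\<gamma> / 2) powr p) * \<beta> k) \<le> ennreal ((2 / \<gamma>) powr p) * (ennreal C * ?G)"
        unfolding \<beta>_def C_def q_def
        by (intro mult_left_mono osc_weak_type_weighted) (use v01 p \<delta> \<gamma> in auto)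
      moreover have "ennreal ((2 / \<gamma>) powr p) * ennreal ((\<gamma> / 2) powr p) = 1"
        using \<gamma> by (simp add: powr_divide flip: ennreal_mult)
      moreover have "ennreal ((2 / \<gamma>) powr p) * ennreal C = ennreal C1"
        using C by (simp add: C1_def flip: ennreal_mult)
      ultimately show ?thesis by (simp add: mult.assoc[symmetric])
    qed
    have "(\<Sum>k<N. ennreal (L k) * \<beta> k) \<le> (\<Sum>k<N. ennreal (L k) * (ennreal C1 * (\<integral>\<^sup>+x\<in>?Q. gagliardo p q (v k) x * frac_max (\<delta> * p) x \<partial>lborel)))"
      by (intro sum_mono mult_left_mono w1) simp
    also have "\<dots> = ennreal C1 * (\<integral>\<^sup>+x. (\<Sum>k<N. ennreal (L k) * (gagliardo p q (v k) x * frac_max (\<delta> * p) x * indicator ?Q x)) \<partial>lborel)"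
      by (simp add: nn_integral_sum nn_integral_cmult sum_distrib_left mult.left_commute)
    also have "\<dots> \<le> ennreal C1 * J"
      unfolding J_def
    proof (intro mult_left_mono nn_integral_mono)
      fix x
      have "(\<Sum>k<N. ennreal (L k) * (gagliardo p q (v k) x * frac_max (\<delta> * p) x * indicator ?Q x))
        = (\<Sum>k<N. ennreal (L k) * gagliardo p q (v k) x) * (frac_max (\<delta> * p) x * indicator ?Q x)"
        unfolding sum_distrib_right by (simp add: mult.assoc)
      also have "\<dots> \<le> gagliardo p q u x * (frac_max (\<delta> * p) x * indicator ?Q x)"
        unfolding L_def v_def by (intro mult_right_mono sum_gagliardo_truncate r p u) simp
      finally show "(\<Sum>k<N. ennreal (L k) * (gagliardo p q (v k) x * frac_max (\<delta> * p) x * indicator ?Q x))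
        \<le> gagliardo p q u x * frac_max (\<delta> * p) x * indicator ?Q x" by (simp add: mult.assoc)
    qed simp
    finally show ?thesis .
  qed
  define X where "X = ennreal (r powr p * Y) + ennreal (2 powr p * C1) * J"
  have sumA: "(\<Sum>k<N. ennreal (L k) * \<alpha> k) \<le> 2 * X" for N
  proof (rule ennreal_absorb_half)
    let ?S = "\<Sum>k<N. ennreal (L k) * \<alpha> k"
    have "?S \<le> (\<Sum>k<Suc N. ennreal (L k) * \<alpha> k)" by simp
    also have "\<dots> = ennreal (L 0) * \<alpha> 0 + (\<Sum>k<N. ennreal (L (Suc k)) * \<alpha> (Suc k))"
      by (rule sum.lessThan_Suc_shift)
    also have "\<dots> \<le> ennreal (r powr p * Y) + (\<Sum>k<N. ennreal (2 powr p) * (ennreal (L k) * \<beta> k) + ennreal (1 / 2) * (ennreal (L k) * \<alpha> k))"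
    proof (intro add_mono sum_mono)
      show "ennreal (L 0) * \<alpha> 0 \<le> ennreal (r powr p * Y)"
        unfolding L(3) using \<alpha>Y[of 0] Y by (simp add: ennreal_mult mult_left_mono)
      fix k
      have "ennreal (L (Suc k)) * \<alpha> (Suc k) \<le> ennreal (L (Suc k)) * (\<beta> k + ennreal ((1 / 2) ^ M) * \<alpha> k)"
        by (rule mult_left_mono[OF rec]) simp
      also have "\<dots> = ennreal (2 powr p) * (ennreal (L k) * \<beta> k) + ennreal (2 powr p * (1 / 2) ^ M) * (ennreal (L k) * \<alpha> k)"
        unfolding L(2) using L(1) by (simp add: ennreal_mult distrib_left mult_ac)
      also have "\<dots> \<le> ennreal (2 powr p) * (ennreal (L k) * \<beta> k) + ennreal (1 / 2) * (ennreal (L k) * \<alpha> k)"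
        by (intro add_left_mono mult_right_mono ennreal_leI M) simp
      finally show "ennreal (L (Suc k)) * \<alpha> (Suc k) \<le> ennreal (2 powr p) * (ennreal (L k) * \<beta> k) + ennreal (1 / 2) * (ennreal (L k) * \<alpha> k)" .
    qed
    also have "\<dots> = ennreal (r powr p * Y) + (ennreal (2 powr p) * (\<Sum>k<N. ennreal (L k) * \<beta> k) + ennreal (1 / 2) * ?S)"
      by (simp add: sum.distrib sum_distrib_left)
    also have "\<dots> \<le> ennreal (r powr p * Y) + (ennreal (2 powr p) * (ennreal C1 * J) + ennreal (1 / 2) * ?S)"
      by (intro add_mono mult_left_mono weak order_refl) auto
    also have "\<dots> = X + ennreal (1 / 2) * ?S"
      using C1 by (simp add: X_def ennreal_mult mult.assoc add.assoc)
    finally show "?S \<le> X + ennreal (1 / 2) * ?S" .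
    have "\<alpha> k < top" for k using \<alpha>Y[of k] by (simp add: le_less_trans)
    then show "?S < top" by (simp add: ennreal_mult_less_top)
  qed
  have dense: "AE x in lborel. \<forall>k. x \<in> {x. v k x = 1} \<inter> ?Q \<longrightarrow> (\<exists>j. measure lborel (cell j x) < 2 * measure lborel ({x. v k x = 1} \<inter> cell j x))"
    unfolding AE_all_countable by (intro allI ae_dense_cell) auto
  have inlevel: "AE x in lborel. \<forall>k. v k x = 1 \<longrightarrow> x \<in> ?Q \<longrightarrow> x \<in> reach (level (v k) (1 / 2))"
    using dense
  proof eventually_elim
    case (elim x)
    show ?case
    proof (intro allI impI)
      fix k assume vk: "v k x = 1" and xQ: "x \<in> ?Q"
      let ?E = "{x. v k x = 1}"
      obtain j where j: "measure lborel (cell j x) < 2 * measure lborel (?E \<inter> cell j x)" using elim vk xQ by blast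
      let ?I = "\<lambda>y. indicator (?E \<inter> cell j x) y :: real"
      have "avg ?I (cell j x) = measure lborel (?E \<inter> cell j x) / measure lborel (cell j x)"
      proof -
        have "?E \<inter> cell j x \<in> fmeasurable lborel"
          by (rule fmeasurableI2[OF cell_fmeasurable]) auto
        then have "(LINT y:cell j x|lborel. ?I y) = measure lborel (?E \<inter> cell j x)"
          unfolding set_lebesgue_integral_def
          by (simp add: indicator_inter_arith[symmetric] Int_absorb1 fmeasurable_def)
        then show ?thesis by (simp add: avg_def)
      qed
      moreover have "1 / 2 < measure lborel (?E \<inter> cell j x) / measure lborel (cell j x)"
        using j cell_measure_pos[of j x] by (simp add: field_simps)
      moreover have "avg ?I (cell j x) \<le> avg (v k) (cell j x)"
        by (rule avg_mono[where B = 1]) (use v01 in \<open>auto simp: indicator_def\<close>)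
      ultimately have "1 / 2 < avg (v k) (cell j x)" by linarith
      moreover have "cell j x \<subseteq> ?Q" using cell_mono[of 0 j x] cell_eq[OF xQ] by simp
      ultimately show "x \<in> reach (level (v k) (1 / 2))" by (auto simp: reach_def level_def)
    qed
  qed
  have "(\<integral>\<^sup>+x\<in>?Q. ennreal (max 0 (u x - m) powr p) \<partial>\<mu>)
    = (\<integral>\<^sup>+x. w x * (ennreal (max 0 (u x - m) powr p) * indicator ?Q x) \<partial>lborel)"
    by (subst nn_integral_density) auto
  also have "\<dots> \<le> (\<integral>\<^sup>+x. w x * (ennreal ((2 * r) powr p) * indicator ?Q x
      + (\<Sum>k. ennreal (4 powr p) * (ennreal (L k) * indicator (reach (level (v k) (1 / 2))) x))) \<partial>lborel)"
  proof (rule nn_integral_mono_AE)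
    show "AE x in lborel. w x * (ennreal (max 0 (u x - m) powr p) * indicator ?Q x) \<le> w x * (ennreal ((2 * r) powr p) * indicator ?Q x
      + (\<Sum>k. ennreal (4 powr p) * (ennreal (L k) * indicator (reach (level (v k) (1 / 2))) x)))"
      using inlevel
    proof eventually_elim
      case (elim x)
      let ?S = "\<Sum>k. ennreal (4 powr p) * (ennreal (L k) * indicator (reach (level (v k) (1 / 2))) x)"
      have "ennreal (max 0 (u x - m) powr p) \<le> ennreal ((2 * r) powr p) + ?S" if xQ: "x \<in> ?Q"
      proof (cases "u x - m \<le> 2 * r")
        case True
        then have "max 0 (u x - m) powr p \<le> (2 * r) powr p" using r p by (intro powr_mono2) auto
        then show ?thesis by (simp add: add_increasing2 ennreal_leI)
      next
        case False
        then obtain k where k: "truncate (r * 2 ^ k) (u x - m) = 1" "u x - m \<le> 4 * (r * 2 ^ k)"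
          using truncate_level[OF r, of "u x - m"] by auto
        have "x \<in> reach (level (v k) (1 / 2))" using elim k(1) xQ by (auto simp: v_def)
        then have "ennreal (4 powr p) * ennreal (L k) \<le> ?S"
          using sum_le_suminf[of "\<lambda>k. ennreal (4 powr p) * (ennreal (L k) * indicator (reach (level (v k) (1 / 2))) x)" "{k}"]
          by simp
        moreover have "max 0 (u x - m) powr p \<le> (4 * (r * 2 ^ k)) powr p"
          using k(2) r p by (intro powr_mono2) auto
        then have "ennreal (max 0 (u x - m) powr p) \<le> ennreal (4 powr p) * ennreal (L k)"
          using r by (simp add: L_def powr_mult ennreal_leI flip: ennreal_mult)
        ultimately show ?thesis by (meson add_increasing order_trans zero_le)
      qed
      then show ?case by (intro mult_left_mono) (auto simp: indicator_def)
    qed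
  qed
  also have "\<dots> = ennreal ((2 * r) powr p) * ennreal Y + (\<Sum>k. ennreal (4 powr p) * (ennreal (L k) * \<alpha> k))"
  proof -
    have "(\<integral>\<^sup>+x. w x * (ennreal ((2 * r) powr p) * indicator ?Q x
      + (\<Sum>k. ennreal (4 powr p) * (ennreal (L k) * indicator (reach (level (v k) (1 / 2))) x))) \<partial>lborel)
      = (\<integral>\<^sup>+x. ennreal ((2 * r) powr p) * indicator ?Q x
      + (\<Sum>k. ennreal (4 powr p) * (ennreal (L k) * indicator (reach (level (v k) (1 / 2))) x)) \<partial>\<mu>)"
      by (subst nn_integral_density) auto
    also have "\<dots> = ennreal ((2 * r) powr p) * ennreal Y + (\<Sum>k. ennreal (4 powr p) * (ennreal (L k) * \<alpha> k))"
      unfolding \<alpha>_def Y(1)[symmetric] by (simp add: nn_integral_add nn_integral_cmult nn_integral_suminf)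
    finally show ?thesis .
  qed
  also have "(\<Sum>k. ennreal (4 powr p) * (ennreal (L k) * \<alpha> k)) \<le> ennreal (4 powr p) * (2 * X)"
    unfolding ennreal_suminf_cmult
    by (intro mult_left_mono suminf_le_const summableI sumA) simp
  also have "ennreal ((2 * r) powr p) * ennreal Y + ennreal (4 powr p) * (2 * X)
      = ennreal (r powr p * E) + ennreal (2 * 8 powr p * (2 / \<gamma>) powr p * C) * J"
  proof -
    have "2 * ennreal (4 powr p) * ennreal (2 powr p * C1) = ennreal (2 * 8 powr p * (2 / \<gamma>) powr p * C)"
    proof -
      have "2 * ennreal (4 powr p) * ennreal (2 powr p * C1) = ennreal (2 * 4 powr p * (2 powr p * C1))"
        using C1 by (simp add: ennreal_mult)
      also have "2 * 4 powr p * (2 powr p * C1) = 2 * (4 * 2) powr p * C1" by (subst powr_mult) auto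
      finally show ?thesis by (simp add: C1_def mult.assoc)
    qed
    moreover have "ennreal ((2 * r) powr p) * ennreal Y + 2 * ennreal (4 powr p) * ennreal (r powr p * Y) = ennreal (r powr p * E)"
    proof -
      have "ennreal ((2 * r) powr p) * ennreal Y + 2 * ennreal (4 powr p) * ennreal (r powr p * Y)
        = ennreal ((2 * r) powr p * Y + 2 * 4 powr p * (r powr p * Y))"
        using Y by (simp add: ennreal_mult)
      also have "(2 * r) powr p * Y + 2 * 4 powr p * (r powr p * Y) = r powr p * E"
        using r by (simp add: E_def powr_mult algebra_simps)
      finally show ?thesis .
    qed
    ultimately show ?thesis unfolding X_def by (simp add: distrib_left mult.assoc[symmetric] add.assoc[symmetric] mult.commute[of _ 2])
  qed
  also have "ennreal (r powr p * E) + ennreal (2 * 8 powr p * (2 / \<gamma>) powr p * C) * J \<le> ennreal e + ennreal (2 * 8 powr p * (2 / \<gamma>) powr p * C) * J"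
    using rE by (intro add_right_mono ennreal_leI)
  finally show "(\<integral>\<^sup>+x\<in>?Q. ennreal (max 0 (u x - m) powr p) \<partial>\<mu>) \<le> ennreal (2 * 8 powr p * (2 / \<gamma>) powr p * C) * J + ennreal e"
    by (simp add: add_mono add.commute)
qed

end

section \<open>The inequality on one cube\<close>

text \<open>
  The median is the infimum of the levels above which \<open>u\<close> stays on at most half of the cell. It makes both
  \<open>u - m\<close> and \<open>m - u\<close> satisfy the hypothesis of \<open>positive_part_estimate\<close>, a property that
  an average need not have.
\<close>

lemma (in dyadic_grid) exists_median:
  fixes u :: "real ^ 'n \<Rightarrow> real"
  assumes u [measurable]: "u \<in> borel_measurable borel"
  obtains m where "2 * measure lborel {x \<in> cell 0 a. m < u x} \<le> measure lborel (cell 0 a)"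
    and "2 * measure lborel {x \<in> cell 0 a. u x < m} \<le> measure lborel (cell 0 a)"
proof -
  let ?Q = "cell 0 a"
  define V where "V = measure lborel ?Q"
  have V: "0 < V" unfolding V_def by (rule cell_measure_pos)
  define \<phi> where "\<phi> t = measure lborel {x \<in> ?Q. t < u x}" for t
  have fin: "emeasure lborel A \<noteq> \<infinity>" if "A \<subseteq> ?Q" for A
    using emeasure_mono[OF that, of lborel] by (auto simp: cell_emeasure top_unique)
  have fm: "{x \<in> ?Q. R x} \<in> fmeasurable lborel" if "{x \<in> ?Q. R x} \<in> sets borel" for R
    by (rule fmeasurableI2[OF cell_fmeasurable]) (use that in auto)
  have sets_part: "{x \<in> ?Q. t < u x} \<in> sets borel" "{x \<in> ?Q. u x \<le> t} \<in> sets borel" for t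
  proof -
    have "{x \<in> ?Q. t < u x} = ?Q \<inter> {x. t < u x}" "{x \<in> ?Q. u x \<le> t} = ?Q \<inter> {x. u x \<le> t}" by auto
    moreover have "{x \<in> space borel. t < u x} \<in> sets borel" "{x \<in> space borel. u x \<le> t} \<in> sets borel"
      by (rule borel_measurable_less[OF borel_measurable_const u] borel_measurable_le[OF u borel_measurable_const])+
    ultimately show "{x \<in> ?Q. t < u x} \<in> sets borel" "{x \<in> ?Q. u x \<le> t} \<in> sets borel" by (simp_all add: sets.Int)
  qed
  have anti: "\<phi> t \<le> \<phi> s" if "s \<le> t" for s t
    unfolding \<phi>_def by (rule measure_mono_fmeasurable[OF _ _ fm]) (use that sets_part in auto)
  have compl: "measure lborel {x \<in> ?Q. u x \<le> t} = V - \<phi> t" for t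
  proof -
    have "V = measure lborel ({x \<in> ?Q. u x \<le> t} \<union> {x \<in> ?Q. t < u x})"
      unfolding V_def by (rule arg_cong[where f = "measure lborel"]) auto
    also have "\<dots> = measure lborel {x \<in> ?Q. u x \<le> t} + \<phi> t"
      unfolding \<phi>_def by (rule measure_Un_AE) (auto intro!: fm sets_part)
    finally show ?thesis by simp
  qed
  have "(\<lambda>n. \<phi> (real n)) \<longlonglongrightarrow> measure lborel (\<Inter>n. {x \<in> ?Q. real n < u x})"
    unfolding \<phi>_def
    by (rule Lim_measure_decseq) (use fin sets_part in \<open>auto simp: decseq_def\<close>)
  also have "(\<Inter>n. {x \<in> ?Q. real n < u x}) = {}"
  proof -
    have "x \<notin> (\<Inter>n. {x \<in> ?Q. real n < u x})" for x
      using reals_Archimedean2[of "u x"] by (auto intro!: exI dest: less_imp_le simp: not_less)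
    then show ?thesis by blast
  qed
  finally have "(\<lambda>n. \<phi> (real n)) \<longlonglongrightarrow> 0" by simp
  then have "eventually (\<lambda>n. \<phi> (real n) < V / 2) sequentially" using V by (intro order_tendstoD) auto
  then obtain n1 where n1: "\<phi> (real n1) < V / 2" by (auto simp: eventually_sequentially)
  have "(\<lambda>n. \<phi> (- real n)) \<longlonglongrightarrow> measure lborel (\<Union>n. {x \<in> ?Q. - real n < u x})"
    unfolding \<phi>_def
    by (rule Lim_measure_incseq[OF _ _ fin]) (use sets_part in \<open>auto simp: incseq_def\<close>)
  also have "(\<Union>n. {x \<in> ?Q. - real n < u x}) = ?Q"
  proof -
    have "\<exists>n. - real n < u x" for x using reals_Archimedean2[of "- u x"] by (auto simp: minus_less_iff)
    then show ?thesis by auto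
  qed
  finally have "(\<lambda>n. \<phi> (- real n)) \<longlonglongrightarrow> V" by (simp add: V_def)
  then have "eventually (\<lambda>n. V / 2 < \<phi> (- real n)) sequentially" using V by (intro order_tendstoD) auto
  then obtain n2 where n2: "V / 2 < \<phi> (- real n2)" by (auto simp: eventually_sequentially)
  define S where "S = {t. 2 * \<phi> t \<le> V}"
  have S1: "real n1 \<in> S" using n1 by (simp add: S_def)
  have lower: "- real n2 \<le> t" if "t \<in> S" for t
    using that n2 anti[of t "- real n2"] by (force simp: S_def)
  have bdd: "bdd_below S" by (rule bdd_belowI[of _ "- real n2"]) (rule lower)
  define m where "m = Inf S"
  define d where "d n = inverse (real (Suc n))" for n
  have d: "0 < d n" for n by (simp add: d_def)
  have d_anti: "d n \<le> d k" if "k \<le> n" for k n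
    using that unfolding d_def by (intro le_imp_inverse_le) auto
  have d_small: "\<exists>n. d n < t" if "0 < t" for t
    using reals_Archimedean[OF that] by (simp add: d_def)
  have "(\<lambda>n. \<phi> (m + d n)) \<longlonglongrightarrow> measure lborel (\<Union>n. {x \<in> ?Q. m + d n < u x})"
    unfolding \<phi>_def
  proof (rule Lim_measure_incseq[OF _ _ fin])
    show "incseq (\<lambda>n. {x \<in> ?Q. m + d n < u x})"
    proof (intro monoI subsetI)
      fix k n x assume "k \<le> n" "x \<in> {x \<in> ?Q. m + d k < u x}"
      then show "x \<in> {x \<in> ?Q. m + d n < u x}" using d_anti[of k n] by simp
    qed
  qed (use sets_part in auto)
  also have "(\<Union>n. {x \<in> ?Q. m + d n < u x}) = {x \<in> ?Q. m < u x}"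
  proof -
    have "\<exists>n. m + d n < s" if "m < s" for s
      using d_small[of "s - m"] that by (auto simp: algebra_simps)
    moreover have "m < s" if "m + d n < s" for s n using that d[of n] by linarith
    ultimately show ?thesis by blast
  qed
  finally have lim1: "(\<lambda>n. \<phi> (m + d n)) \<longlonglongrightarrow> \<phi> m" by (simp add: \<phi>_def)
  have "\<phi> (m + d n) \<le> V / 2" for n
  proof -
    have "Inf S < m + d n" using d[of n] by (simp add: m_def)
    then obtain s where s: "s \<in> S" "s < m + d n"
      using cInf_less_iff[of S] S1 bdd by blast
    then show ?thesis using anti[of s "m + d n"] by (simp add: S_def)
  qed
  then have A: "\<phi> m \<le> V / 2" using lim1 by (intro LIMSEQ_le_const2) auto
  have "(\<lambda>n. measure lborel {x \<in> ?Q. u x \<le> m - d n}) \<longlonglongrightarrow> measure lborel (\<Union>n. {x \<in> ?Q. u x \<le> m - d n})"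
  proof (rule Lim_measure_incseq[OF _ _ fin])
    show "incseq (\<lambda>n. {x \<in> ?Q. u x \<le> m - d n})"
    proof (intro monoI subsetI)
      fix k n x assume "k \<le> n" "x \<in> {x \<in> ?Q. u x \<le> m - d k}"
      then show "x \<in> {x \<in> ?Q. u x \<le> m - d n}" using d_anti[of k n] by simp
    qed
  qed (use sets_part in auto)
  also have "(\<Union>n. {x \<in> ?Q. u x \<le> m - d n}) = {x \<in> ?Q. u x < m}"
  proof -
    have "\<exists>n. s \<le> m - d n" if s: "s < m" for s
    proof -
      obtain n where "d n < m - s" using d_small[of "m - s"] s by auto
      then have "s \<le> m - d n" by simp
      then show ?thesis by blast
    qed
    moreover have "s < m" if "s \<le> m - d n" for s n using that d[of n] by linarith
    ultimately show ?thesis by blast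
  qed
  finally have lim2: "(\<lambda>n. measure lborel {x \<in> ?Q. u x \<le> m - d n}) \<longlonglongrightarrow> measure lborel {x \<in> ?Q. u x < m}" .
  have "measure lborel {x \<in> ?Q. u x \<le> m - d n} \<le> V / 2" for n
  proof -
    have "m - d n \<notin> S"
    proof
      assume "m - d n \<in> S"
      then have "m \<le> m - d n" unfolding m_def by (rule cInf_lower[OF _ bdd])
      then show False using d[of n] by simp
    qed
    then show ?thesis by (simp add: compl S_def)
  qed
  then have B: "measure lborel {x \<in> ?Q. u x < m} \<le> V / 2" using lim2 by (intro LIMSEQ_le_const2) auto
  show ?thesis using that[of m] A B by (simp add: \<phi>_def V_def)
qed

text \<open>
  An explicit constant that is convenient rather than optimal: \<open>16384 = 16 * (8 * 2 * 64)\<close>, where \<open>64\<close> is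
  the constant in the choice of \<open>\<gamma>\<close> below.
\<close>

definition poincare_const :: "'n::finite itself \<Rightarrow> real" where
  "poincare_const _ = 16384 * 2 ^ CARD('n) * (sqrt CARD('n) powr CARD('n) * sqrt CARD('n))"

context fujii_wilson_grid
begin

text \<open>
  Three parameters are chosen: \<open>K\<close> is about \<open>4 * W\<close>, so that \<open>K\<close> levels halve the weight; \<open>M\<close> is about
  \<open>p + 1\<close>, so that \<open>M\<close> halvings beat \<open>2 powr p\<close>; and \<open>\<gamma>\<close> is so small that \<open>M * K\<close> levels fit between
  \<open>1 / 2\<close> and \<open>1\<close>. The constant carries \<open>1 / \<gamma>\<close> and hence \<open>p * W\<close> to the first power. The positive and
  the negative part of \<open>u - m\<close> are treated alike.
\<close>

lemma local_poincare:
  fixes p \<delta> :: real and u :: "real ^ 'n \<Rightarrow> real"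
  assumes u [measurable]: "u \<in> borel_measurable borel"
    and p: "1 \<le> p" and \<delta>: "0 < \<delta>" "\<delta> < 1" and W: "1 \<le> W"
  shows "\<exists>m. (\<integral>\<^sup>+x\<in>cell 0 a. ennreal (\<bar>u x - m\<bar> powr p) \<partial>\<mu>)
    \<le> ennreal ((1 - \<delta>) * (poincare_const TYPE('n) * p * W) powr p) *
      (\<integral>\<^sup>+x\<in>cell 0 a. gagliardo p (real CARD('n) + \<delta> * p) u x * frac_max (\<delta> * p) x \<partial>lborel)"
proof -
  let ?n = "real CARD('n)" and ?s = "sqrt (real CARD('n))"
  define \<gamma> where "\<gamma> = 1 / (64 * 2 ^ CARD('n) * p * W)"
  define K where "K = nat \<lceil>4 * W\<rceil>"
  define M where "M = nat \<lceil>p\<rceil> + 1"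
  have n1: "1 \<le> ?n" by (simp add: Suc_le_eq)
  have s1: "1 \<le> ?s" using n1 by simp
  have \<gamma>: "0 < \<gamma>" using p W by (simp add: \<gamma>_def)
  have K: "4 * W \<le> real K" "real K \<le> 5 * W" using W unfolding K_def by linarith+
  have M': "p + 1 \<le> real M" "real M \<le> 3 * p" using p unfolding M_def by linarith+
  have M: "2 powr p * (1 / 2) ^ M \<le> 1 / 2"
  proof -
    have "2 powr p * (1 / 2) ^ M = 2 powr (p - real M)"
      by (simp add: powr_diff powr_realpow power_divide)
    also have "\<dots> \<le> 2 powr (- 1)" using M' by (intro powr_mono) auto
    finally show ?thesis by (simp add: powr_minus)
  qed
  have two: "(2::real) \<le> 2 ^ CARD('n)" using power_increasing[of 1 "CARD('n)" "2::real"] by (simp add: Suc_le_eq)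
  have small: "1 / 2 + real (M * K) * ((2 ^ CARD('n) + 2) * \<gamma>) + 2 * \<gamma> < 1"
  proof -
    have "real (M * K) * ((2 ^ CARD('n) + 2) * \<gamma>) \<le> (3 * p * (5 * W)) * ((2 * 2 ^ CARD('n)) * \<gamma>)"
      unfolding of_nat_mult using M' K p W \<gamma> two by (intro mult_mono mult_right_mono) auto
    also have "\<dots> = 30 / 64" using p W by (simp add: \<gamma>_def)
    finally have A: "real (M * K) * ((2 ^ CARD('n) + 2) * \<gamma>) \<le> 30 / 64" .
    have "1 * 1 \<le> p * W" using p W by (intro mult_mono) auto
    then have "2 * 1 \<le> 2 ^ CARD('n) * (p * W)" using two by (intro mult_mono) auto
    then have "64 * 2 \<le> 64 * (2 ^ CARD('n) * (p * W))" by linarith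
    then have "64 * 2 \<le> 64 * 2 ^ CARD('n) * p * W" by (simp only: mult.assoc)
    then have "\<gamma> \<le> 1 / (64 * 2)" unfolding \<gamma>_def by (intro divide_left_mono) auto
    then show ?thesis using A by simp
  qed
  obtain m where m: "2 * measure lborel {x \<in> cell 0 a. m < u x} \<le> measure lborel (cell 0 a)"
    "2 * measure lborel {x \<in> cell 0 a. u x < m} \<le> measure lborel (cell 0 a)"
    using exists_median[OF u] by blast
  define C where "C = 2 * p * (1 - \<delta>) * ?s powr (?n + p)"
  define B where "B = 2 * 8 powr p * (2 / \<gamma>) powr p * C"
  define J where "J = (\<integral>\<^sup>+x\<in>cell 0 a. gagliardo p (?n + \<delta> * p) u x * frac_max (\<delta> * p) x \<partial>lborel)"
  have pos: "(\<integral>\<^sup>+x\<in>cell 0 a. ennreal (max 0 (u x - m) powr p) \<partial>\<mu>) \<le> ennreal B * J"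
    unfolding B_def C_def J_def using m(1) p \<delta> \<gamma> K M small by (intro positive_part_estimate) auto
  have gm: "gagliardo p q (\<lambda>x. - u x) = gagliardo p q u" for q
    unfolding gagliardo_def by (simp add: abs_minus_commute)
  have "(\<integral>\<^sup>+x\<in>cell 0 a. ennreal (max 0 (- u x - - m) powr p) \<partial>\<mu>) \<le> ennreal B * J"
    unfolding B_def C_def J_def gm[symmetric] using m(2) p \<delta> \<gamma> K M small by (intro positive_part_estimate) auto
  then have neg: "(\<integral>\<^sup>+x\<in>cell 0 a. ennreal (max 0 (m - u x) powr p) \<partial>\<mu>) \<le> ennreal B * J" by simp
  have "(\<integral>\<^sup>+x\<in>cell 0 a. ennreal (\<bar>u x - m\<bar> powr p) \<partial>\<mu>)
    = (\<integral>\<^sup>+x. ennreal (max 0 (u x - m) powr p) * indicator (cell 0 a) x + ennreal (max 0 (m - u x) powr p) * indicator (cell 0 a) x \<partial>\<mu>)"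
  proof (rule nn_integral_cong)
    fix x
    have "ennreal (\<bar>u x - m\<bar> powr p) = ennreal (max 0 (u x - m) powr p) + ennreal (max 0 (m - u x) powr p)"
      using p by (cases "m \<le> u x") (auto simp: max_def)
    then show "ennreal (\<bar>u x - m\<bar> powr p) * indicator (cell 0 a) x = ennreal (max 0 (u x - m) powr p) * indicator (cell 0 a) x + ennreal (max 0 (m - u x) powr p) * indicator (cell 0 a) x"
      by (simp add: distrib_right)
  qed
  also have "\<dots> = (\<integral>\<^sup>+x\<in>cell 0 a. ennreal (max 0 (u x - m) powr p) \<partial>\<mu>) + (\<integral>\<^sup>+x\<in>cell 0 a. ennreal (max 0 (m - u x) powr p) \<partial>\<mu>)"
    by (rule nn_integral_add) auto
  also have "\<dots> \<le> ennreal B * J + ennreal B * J" by (intro add_mono pos neg)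
  also have "\<dots> = ennreal (2 * B) * J"
    by (simp add: ennreal_mult' mult.assoc flip: mult_2)
  also have "\<dots> \<le> ennreal ((1 - \<delta>) * (poincare_const TYPE('n) * p * W) powr p) * J"
  proof (intro mult_right_mono ennreal_leI)
    \<comment> \<open>The factors \<open>p\<close> and \<open>sqrt n powr n\<close> occur outside the \<open>p\<close>-th power and are absorbed into it, so that
      no \<open>p\<close>-dependent factor besides \<open>p * W\<close> survives the \<open>p\<close>-th root.\<close>
    have pp: "p \<le> 2 powr p"
    proof -
      have "p \<le> 2 powr (p - 1) * 2"
      proof -
        have "1 + (p - 1) * ln 2 \<le> 2 powr (p - 1)" using exp_ge_add_one_self[of "(p - 1) * ln 2"] by (simp add: powr_def)
        moreover have "p \<le> (1 + (p - 1) * ln 2) * 2"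
        proof -
          have "(p - 1) * 1 \<le> (p - 1) * (ln 2 * 2)" using p ln2_ge_two_thirds by (intro mult_left_mono) auto
          then show ?thesis by (simp add: algebra_simps)
        qed
        ultimately show ?thesis by simp
      qed
      then show ?thesis by (simp add: powr_diff)
    qed
    have sn: "1 \<le> ?s powr ?n" using s1 n1 by (simp add: ge_one_powr_ge_zero)
    have "8 * p * ?s powr ?n \<le> 8 powr p * 2 powr p * (?s powr ?n) powr p"
    proof (intro mult_mono pp)
      show "8 \<le> 8 powr p" using powr_mono[of 1 p 8] p by simp
      show "?s powr ?n \<le> (?s powr ?n) powr p" using powr_mono[of 1 p "?s powr ?n"] p sn by simp
    qed (use p in auto)
    also have "\<dots> = (16 * ?s powr ?n) powr p" using sn by (simp add: powr_mult[symmetric])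
    finally have F: "8 * p * ?s powr ?n \<le> (16 * ?s powr ?n) powr p" .
    have "2 * B = (1 - \<delta>) * ((8 * p * ?s powr ?n) * (8 powr p * (2 / \<gamma>) powr p * ?s powr p))"
      by (simp add: B_def C_def powr_add)
    also have "\<dots> \<le> (1 - \<delta>) * ((16 * ?s powr ?n) powr p * (8 powr p * (2 / \<gamma>) powr p * ?s powr p))"
      using \<delta> F by (intro mult_left_mono mult_right_mono) auto
    also have "(16 * ?s powr ?n) powr p * (8 powr p * (2 / \<gamma>) powr p * ?s powr p) = (16 * ?s powr ?n * (8 * (2 / \<gamma>) * ?s)) powr p"
      using sn \<gamma> s1 by (simp add: powr_mult[symmetric])
    also have "16 * ?s powr ?n * (8 * (2 / \<gamma>) * ?s) = poincare_const TYPE('n) * p * W"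
      using p W by (simp add: \<gamma>_def poincare_const_def)
    finally show "2 * B \<le> (1 - \<delta>) * (poincare_const TYPE('n) * p * W) powr p" .
  qed simp
  finally show ?thesis unfolding J_def by blast
qed

end

section \<open>Weights, cubes and fractional maximal functions\<close>

lemma L1_loc_measurable:
  fixes f :: "real ^ 'n \<Rightarrow> real"
  assumes "f \<in> L1_loc lebesgue"
  shows "f \<in> borel_measurable lebesgue"
proof (rule borel_measurable_LIMSEQ_real)
  fix i :: nat
  show "(\<lambda>x. indicator (cball 0 (real i)) x * f x) \<in> borel_measurable lebesgue"
  proof -
    have "set_integrable lebesgue (cball 0 (real i)) f" using assms by (simp add: L1_loc_def)
    then show ?thesis unfolding set_integrable_def by (auto dest!: borel_measurable_integrable)
  qed
next
  fix x :: "real ^ 'n"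
  obtain N :: nat where "norm x \<le> real N" using real_arch_simple by blast
  then have "eventually (\<lambda>i. indicator (cball 0 (real i)) x * f x = f x) sequentially"
    by (intro eventually_sequentiallyI[of N]) (auto simp: indicator_def)
  then show "(\<lambda>i. indicator (cball 0 (real i)) x * f x) \<longlonglongrightarrow> f x"
    by (rule tendsto_eventually)
qed

text \<open>
  Replacing an arbitrary constant \<open>m\<close> by the mean costs a fixed factor, because the distance from \<open>m\<close> to
  the mean is at most twice the mean deviation from \<open>m\<close> in the sense of \<open>p\<close>-th powers.
\<close>

lemma mean_deviation_powr:
  fixes u :: "'a \<Rightarrow> real" and p m :: real
  assumes Q: "Q \<in> sets M" and u: "u \<in> borel_measurable M" "set_integrable M Q u"
    and Y: "0 < measure M Q" "emeasure M Q < \<infinity>" and p: "1 \<le> p"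
  shows "(\<integral>\<^sup>+x\<in>Q. ennreal (\<bar>u x - (LINT x:Q|M. u x) / measure M Q\<bar> powr p) \<partial>M)
    \<le> ennreal (4 powr p) * (\<integral>\<^sup>+x\<in>Q. ennreal (\<bar>u x - m\<bar> powr p) \<partial>M)"
proof (cases "(\<integral>\<^sup>+x\<in>Q. ennreal (\<bar>u x - m\<bar> powr p) \<partial>M) = top")
  case False
  note [measurable] = Q u(1)
  define c where "c = (LINT x:Q|M. u x) / measure M Q"
  define V where "V = measure M Q"
  have V: "0 < V" "emeasure M Q = ennreal V" using Y by (auto simp: V_def intro!: emeasure_eq_ennreal_measure)
  obtain X where X: "(\<integral>\<^sup>+x\<in>Q. ennreal (\<bar>u x - m\<bar> powr p) \<partial>M) = ennreal X" "0 \<le> X"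
    using False by (cases "\<integral>\<^sup>+x\<in>Q. ennreal (\<bar>u x - m\<bar> powr p) \<partial>M") auto
  have iconst: "set_integrable M Q (\<lambda>_. b)" for b :: real
    using Y Q by (simp add: set_integrable_def)
  have idev: "set_integrable M Q (\<lambda>x. u x - m)" by (intro set_integral_diff u iconst)
  have "(LINT x:Q|M. u x - m) = (c - m) * V"
  proof -
    have "(LINT x:Q|M. u x - m) = (LINT x:Q|M. u x) - (LINT x:Q|M. m)" by (intro set_integral_diff u iconst)
    also have "(LINT x:Q|M. m) = m * V" using Y Q by (simp add: set_lebesgue_integral_def V_def less_top)
    also have "(LINT x:Q|M. u x) = c * V" using V by (simp add: c_def V_def)
    finally show ?thesis by (simp only: left_diff_distrib)
  qed
  then have "\<bar>c - m\<bar> * V = \<bar>LINT x:Q|M. u x - m\<bar>" using V by (simp add: abs_mult)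
  also have "ennreal \<dots> \<le> (\<integral>\<^sup>+x. ennreal (norm (indicator Q x *\<^sub>R (u x - m))) \<partial>M)"
    unfolding set_lebesgue_integral_def using idev integral_norm_bound_ennreal[of M "\<lambda>x. indicator Q x *\<^sub>R (u x - m)"]
    by (simp add: set_integrable_def)
  also have "\<dots> = (\<integral>\<^sup>+x\<in>Q. ennreal \<bar>u x - m\<bar> \<partial>M)"
    by (intro nn_integral_cong) (auto simp: indicator_def)
  finally have mean: "ennreal (\<bar>c - m\<bar> * V) \<le> (\<integral>\<^sup>+x\<in>Q. ennreal \<bar>u x - m\<bar> \<partial>M)" .
  have bound: "\<bar>c - m\<bar> * V \<le> s * V + s powr (1 - p) * X" if s: "0 < s" for s
  proof -
    have "(\<integral>\<^sup>+x\<in>Q. ennreal \<bar>u x - m\<bar> \<partial>M) \<le> (\<integral>\<^sup>+x. ennreal s * indicator Q x + ennreal (s powr (1 - p)) * (ennreal (\<bar>u x - m\<bar> powr p) * indicator Q x) \<partial>M)"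
    proof (rule nn_integral_mono)
      fix x
      have "ennreal \<bar>u x - m\<bar> \<le> ennreal s + ennreal (s powr (1 - p)) * ennreal (\<bar>u x - m\<bar> powr p)"
        using le_add_powr[OF s p, of "\<bar>u x - m\<bar>"] s by (simp add: ennreal_leI flip: ennreal_plus ennreal_mult)
      then show "ennreal \<bar>u x - m\<bar> * indicator Q x \<le> ennreal s * indicator Q x + ennreal (s powr (1 - p)) * (ennreal (\<bar>u x - m\<bar> powr p) * indicator Q x)"
        by (simp add: indicator_def)
    qed
    also have "\<dots> = ennreal (s * V + s powr (1 - p) * X)"
      using s V X(2) by (simp add: nn_integral_add nn_integral_cmult X(1) ennreal_mult)
    finally have "ennreal (\<bar>c - m\<bar> * V) \<le> ennreal (s * V + s powr (1 - p) * X)" using mean by (rule order_trans[rotated])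
    then show ?thesis using s V X by (subst (asm) ennreal_le_iff) auto
  qed
  have cm: "\<bar>c - m\<bar> powr p * V \<le> 2 powr p * X"
  proof (cases "X = 0")
    case True
    have "\<bar>c - m\<bar> \<le> 0 + e" if "0 < e" for e using bound[OF that] True V by simp
    then have "\<bar>c - m\<bar> \<le> 0" by (rule field_le_epsilon)
    then show ?thesis using p True by simp
  next
    case False
    \<comment> \<open>This choice balances the two terms of \<open>bound\<close>.\<close>
    define s where "s = (X / V) powr (1 / p)"
    have s: "0 < s" using False X V by (simp add: s_def)
    have sp: "s powr p = X / V" using False X V p by (simp add: s_def powr_powr)
    have "s powr (1 - p) * X = s * V" using s sp V False by (simp add: powr_diff)
    then have "\<bar>c - m\<bar> * V \<le> (2 * s) * V" using bound[OF s] by linarith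
    then have "\<bar>c - m\<bar> \<le> 2 * s" using V by (simp only: mult_le_cancel_right_pos)
    then have "\<bar>c - m\<bar> powr p \<le> (2 * s) powr p" using p by (intro powr_mono2) auto
    also have "\<dots> = 2 powr p * (X / V)" using s sp by (simp add: powr_mult)
    finally show ?thesis using V by (simp add: field_simps)
  qed
  have "(\<integral>\<^sup>+x\<in>Q. ennreal (\<bar>u x - c\<bar> powr p) \<partial>M)
      \<le> (\<integral>\<^sup>+x. ennreal (2 powr (p - 1)) * (ennreal (\<bar>u x - m\<bar> powr p) * indicator Q x) + ennreal (2 powr (p - 1) * \<bar>c - m\<bar> powr p) * indicator Q x \<partial>M)"
  proof (rule nn_integral_mono)
    fix x
    have "\<bar>u x - c\<bar> powr p \<le> (\<bar>u x - m\<bar> + \<bar>c - m\<bar>) powr p" using p by (intro powr_mono2) auto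
    also have "\<dots> \<le> 2 powr (p - 1) * (\<bar>u x - m\<bar> powr p + \<bar>c - m\<bar> powr p)" using p by (intro powr_add_le) auto
    finally have "ennreal (\<bar>u x - c\<bar> powr p) \<le> ennreal (2 powr (p - 1)) * ennreal (\<bar>u x - m\<bar> powr p) + ennreal (2 powr (p - 1) * \<bar>c - m\<bar> powr p)"
      by (simp add: ennreal_leI distrib_left flip: ennreal_plus ennreal_mult)
    then show "ennreal (\<bar>u x - c\<bar> powr p) * indicator Q x \<le> ennreal (2 powr (p - 1)) * (ennreal (\<bar>u x - m\<bar> powr p) * indicator Q x) + ennreal (2 powr (p - 1) * \<bar>c - m\<bar> powr p) * indicator Q x"
      by (simp add: indicator_def)
  qed
  also have "\<dots> = ennreal (2 powr (p - 1) * X + 2 powr (p - 1) * (\<bar>c - m\<bar> powr p * V))"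
    using V X(2) by (simp add: nn_integral_add nn_integral_cmult X(1) ennreal_mult mult.assoc)
  also have "\<dots> \<le> ennreal (4 powr p * X)"
  proof (rule ennreal_leI)
    have "2 powr (p - 1) * X + 2 powr (p - 1) * (\<bar>c - m\<bar> powr p * V) \<le> 2 powr (p - 1) * X + 2 powr (p - 1) * (2 powr p * X)"
      by (intro add_left_mono mult_left_mono cm) simp
    also have "\<dots> = 2 powr (p - 1) * (1 + 2 powr p) * X" by (simp add: algebra_simps)
    also have "\<dots> \<le> 2 powr (p - 1) * (2 * 2 powr p) * X"
      using p X by (intro mult_right_mono mult_left_mono) (auto simp: ge_one_powr_ge_zero)
    also have "2 powr (p - 1) * (2 * 2 powr p) = 4 powr p"
      using powr_mult[of 2 2 p] by (simp add: powr_diff)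
    finally show "2 powr (p - 1) * X + 2 powr (p - 1) * (\<bar>c - m\<bar> powr p * V) \<le> 4 powr p * X" .
  qed
  also have "\<dots> = ennreal (4 powr p) * ennreal X" using X by (simp add: ennreal_mult)
  finally show ?thesis unfolding c_def X(1) .
qed (simp add: ennreal_mult_top)

lemma weight_borel_representative:
  fixes w :: "real ^ 'n \<Rightarrow> real"
  assumes w: "weight w"
  obtains w' where "w' \<in> borel_measurable borel" "AE x in lborel. w x = w' x"
    "\<And>B. B \<in> sets borel \<Longrightarrow> emeasure (density lborel (\<lambda>x. ennreal (w' x))) B = emeasure (weight_measure w) B"
proof -
  have wm [measurable]: "w \<in> borel_measurable lebesgue" using w by (auto simp: weight_def intro: L1_loc_measurable)
  obtain w' where w': "w' \<in> borel_measurable lborel" "AE x in lborel. w x = w' x"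
    using completion_ex_borel_measurable_real[OF wm] by blast
  have [measurable]: "w' \<in> borel_measurable borel" using w'(1) by simp
  show ?thesis
  proof (rule that[of w'])
    fix B :: "(real ^ 'n) set" assume [measurable]: "B \<in> sets borel"
    have "emeasure (weight_measure w) B = (\<integral>\<^sup>+x\<in>B. ennreal (w x) \<partial>lebesgue)"
      unfolding weight_measure_def by (rule emeasure_density) auto
    also have "\<dots> = (\<integral>\<^sup>+x\<in>B. ennreal (w' x) \<partial>lborel)"
      unfolding nn_integral_completion by (rule nn_integral_cong_AE) (use w'(2) in auto)
    finally show "emeasure (density lborel (\<lambda>x. ennreal (w' x))) B = emeasure (weight_measure w) B"
      by (simp add: emeasure_density)
  qed (use w' in auto)
qed

lemma weight_finite:
  assumes w: "weight w" and B: "B \<in> sets lebesgue" "bounded B"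
  shows "emeasure (weight_measure w) B < top"
proof -
  obtain e where "\<forall>x\<in>B. norm x \<le> e" using B(2) by (auto simp: bounded_iff)
  then have e: "B \<subseteq> cball 0 e" by auto
  have wm [measurable]: "w \<in> borel_measurable lebesgue" using w by (auto simp: weight_def intro: L1_loc_measurable)
  have int: "set_integrable lebesgue (cball 0 e) w" using w by (simp add: weight_def L1_loc_def)
  have "emeasure (weight_measure w) B \<le> emeasure (weight_measure w) (cball 0 e)"
    by (rule emeasure_mono[OF e]) (simp add: weight_measure_def)
  also have "\<dots> = (\<integral>\<^sup>+x\<in>cball 0 e. ennreal (w x) \<partial>lebesgue)"
    unfolding weight_measure_def by (rule emeasure_density) auto
  also have "\<dots> \<le> (\<integral>\<^sup>+x. ennreal (norm (indicator (cball 0 e) x *\<^sub>R w x)) \<partial>lebesgue)"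
    by (intro nn_integral_mono) (auto simp: indicator_def intro: ennreal_leI)
  also have "\<dots> < top" using int by (auto simp: set_integrable_def integrable_iff_bounded)
  finally show ?thesis .
qed

lemma weight_positive:
  assumes w: "weight w" and B: "B \<in> sets lebesgue" "0 < emeasure lebesgue B"
  shows "0 < emeasure (weight_measure w) B"
proof (rule ccontr)
  have wm [measurable]: "w \<in> borel_measurable lebesgue" using w by (auto simp: weight_def intro: L1_loc_measurable)
  note [measurable] = B(1)
  assume "\<not> 0 < emeasure (weight_measure w) B"
  then have "(\<integral>\<^sup>+x\<in>B. ennreal (w x) \<partial>lebesgue) = 0"
    unfolding weight_measure_def by (simp add: emeasure_density)
  then have "AE x in lebesgue. ennreal (w x) * indicator B x = 0"
    by (subst (asm) nn_integral_0_iff_AE) auto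
  then have "AE x in lebesgue. x \<notin> B"
    using w unfolding weight_def by (auto elim!: eventually_elim2[of _ _ ] simp: indicator_def ennreal_eq_0_iff split: if_splits)
  then have "B \<in> null_sets lebesgue" using B(1) by (simp add: AE_iff_null_sets)
  then show False using B(2) by auto
qed

lemma cube_bounded: "cube_with_side s Q \<Longrightarrow> bounded (Q :: (real ^ 'n) set)"
proof -
  assume "cube_with_side s Q"
  then obtain b I where I: "\<forall>i. {b i <..< b i + s} \<subseteq> I i \<and> I i \<subseteq> {b i .. b i + s}" "Q = {x. \<forall>i. x $ i \<in> I i}"
    unfolding cube_with_side_def by auto
  have "Q \<subseteq> cbox (\<chi> i. b i) (\<chi> i. b i + s)"
  proof
    fix x assume "x \<in> Q"
    then have "x $ i \<in> {b i .. b i + s}" for i using I(2) subsetD[OF conjunct2[OF spec[OF I(1)]], of "x $ i" i] by simp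
    then show "x \<in> cbox (\<chi> i. b i) (\<chi> i. b i + s)" by (simp add: mem_box_cart)
  qed
  then show "bounded Q" by (rule bounded_subset[OF bounded_cbox])
qed

lemma cube_measurable:
  fixes Q :: "(real ^ 'n) set"
  assumes "cube_with_side s Q"
  shows "Q \<in> sets lebesgue" "emeasure lebesgue Q = ennreal (s ^ CARD('n))" "0 < s"
    and "\<exists>b. AE x in lebesgue. x \<in> Q \<longleftrightarrow> x \<in> dyadic_grid.cell b s 0 b"
proof -
  obtain b I where s: "0 < s" and I: "\<forall>i. {b i <..< b i + s} \<subseteq> I i \<and> I i \<subseteq> {b i .. b i + s}" "Q = {x. \<forall>i. x $ i \<in> I i}"
    using assms unfolding cube_with_side_def by auto
  define a :: "real ^ 'n" where "a = (\<chi> i. b i)"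
  have sq: "{x. \<forall>i. a $ i < x $ i \<and> x $ i < a $ i + s} \<subseteq> Q" "Q \<subseteq> {x. \<forall>i. a $ i \<le> x $ i \<and> x $ i \<le> a $ i + s}"
  proof -
    show "{x. \<forall>i. a $ i < x $ i \<and> x $ i < a $ i + s} \<subseteq> Q"
    proof
      fix x assume "x \<in> {x. \<forall>i. a $ i < x $ i \<and> x $ i < a $ i + s}"
      then have "x $ i \<in> {b i <..< b i + s}" for i by (simp add: a_def)
      then show "x \<in> Q" using I(2) subsetD[OF conjunct1[OF spec[OF I(1)]]] by simp
    qed
    show "Q \<subseteq> {x. \<forall>i. a $ i \<le> x $ i \<and> x $ i \<le> a $ i + s}"
    proof
      fix x assume "x \<in> Q"
      then have "x $ i \<in> {b i .. b i + s}" for i using I(2) subsetD[OF conjunct2[OF spec[OF I(1)]], of "x $ i" i] by simp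
      then show "x \<in> {x. \<forall>i. a $ i \<le> x $ i \<and> x $ i \<le> a $ i + s}" by (simp add: a_def)
    qed
  qed
  note * = cube_lebesgue[OF s sq]
  show "Q \<in> sets lebesgue" "emeasure lebesgue Q = ennreal (s ^ CARD('n))" "0 < s" using * s by auto
  interpret dyadic_grid a s by unfold_locales (rule s)
  have c: "corner 0 a = a" by (simp add: corner_def vec_eq_iff)
  have "AE x in lebesgue. x \<in> cell 0 a \<longleftrightarrow> x \<in> box a (\<chi> i. a $ i + s)"
    using cube_lebesgue(3)[OF _ cell_squeeze[of 0 a]] s c by simp
  then have "AE x in lebesgue. x \<in> Q \<longleftrightarrow> x \<in> cell 0 a"
    using *(3) by eventually_elim simp
  then show "\<exists>b. AE x in lebesgue. x \<in> Q \<longleftrightarrow> x \<in> dyadic_grid.cell b s 0 b" by blast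
qed

text \<open>
  The quotient in the definition may be cleared because a cube has positive and finite weight.
\<close>

lemma A_infinity_const_ge:
  assumes Q: "cube_with_side s Q" and w: "weight w"
  shows "(\<integral>\<^sup>+x\<in>Q. frac_maximal 0 (\<lambda>y. w y * indicator Q y) x \<partial>lebesgue)
    \<le> A_infinity_const w * emeasure (weight_measure w) Q"
proof -
  let ?I = "\<integral>\<^sup>+x\<in>Q. frac_maximal 0 (\<lambda>y. w y * indicator Q y) x \<partial>lebesgue" and ?m = "emeasure (weight_measure w) Q"
  have fin: "?m < top" using Q w by (intro weight_finite cube_measurable[OF Q] cube_bounded[OF Q])
  have pos: "0 < ?m"
    using cube_measurable(2,3)[OF Q] by (intro weight_positive w cube_measurable(1)[OF Q]) simp
  have "?I / ?m \<le> A_infinity_const w"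
    unfolding A_infinity_const_def using Q by (intro SUP_upper) (auto simp: cubes_def)
  then have "?I / ?m * ?m \<le> A_infinity_const w * ?m" by (rule mult_right_mono) simp
  moreover have "?I / ?m * ?m = ?I"
    using fin pos by (simp add: ennreal_divide_times ennreal_mult_divide_eq)
  ultimately show ?thesis by simp
qed

text \<open>
  The factor \<open>indicator Q\<close> serves the localized maximal function in the weight constant; the choice
  \<open>Q = UNIV\<close> gives the maximal function of the weight itself.
\<close>

lemma frac_maximal_ge:
  assumes R: "cube_with_side s R" "x \<in> R" and w: "weight w" and RQ: "R \<subseteq> Q"
  shows "ennreal (s powr \<alpha>) * (emeasure (weight_measure w) R / emeasure lebesgue R) \<le> frac_maximal \<alpha> (\<lambda>y. w y * indicator Q y) x"
proof -
  have wm [measurable]: "w \<in> borel_measurable lebesgue" using w by (auto simp: weight_def intro: L1_loc_measurable)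
  have "emeasure (weight_measure w) R = (\<integral>\<^sup>+y\<in>R. ennreal (w y) \<partial>lebesgue)"
    unfolding weight_measure_def using cube_measurable(1)[OF R(1)] by (intro emeasure_density) auto
  also have "\<dots> \<le> (\<integral>\<^sup>+y\<in>R. ennreal \<bar>w y * indicator Q y\<bar> \<partial>lebesgue)"
    using RQ by (intro nn_integral_mono) (auto simp: indicator_def intro: ennreal_leI)
  finally have "emeasure (weight_measure w) R / emeasure lebesgue R \<le> nn_average R (\<lambda>y. \<bar>w y * indicator Q y\<bar>)"
    unfolding nn_average_def by (rule divide_right_mono_ennreal)
  then have "ennreal (s powr \<alpha>) * (emeasure (weight_measure w) R / emeasure lebesgue R) \<le> ennreal (s powr \<alpha>) * nn_average R (\<lambda>y. \<bar>w y * indicator Q y\<bar>)"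
    by (rule mult_left_mono) simp
  also have "\<dots> \<le> frac_maximal \<alpha> (\<lambda>y. w y * indicator Q y) x"
    unfolding frac_maximal_def using R by (intro SUP_upper2[of "(s, R)"]) auto
  finally show ?thesis .
qed

section \<open>From cubes to the whole space\<close>

text \<open>
  Every cube is a competitor in its own maximal function.
\<close>

lemma A_infinity_const_ge_1:
  fixes w :: "real ^ 'n \<Rightarrow> real"
  assumes w: "weight w"
  shows "1 \<le> A_infinity_const w"
proof -
  interpret dyadic_grid "0 :: real ^ 'n" 1 by unfold_locales simp
  let ?Q = "cell 0 0" and ?M = "weight_measure w"
  have cube: "cube_with_side 1 ?Q" using cell_cube[of 0 0] by simp
  note meas = cube_measurable(1,2)[OF cube]
  have fin: "emeasure ?M ?Q < top" by (intro weight_finite w meas cube_bounded[OF cube])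
  have pos: "0 < emeasure ?M ?Q" by (intro weight_positive w meas) (simp add: meas)
  have "emeasure ?M ?Q = (\<integral>\<^sup>+x. emeasure ?M ?Q * indicator ?Q x \<partial>lebesgue)"
    using meas by (simp add: nn_integral_cmult_indicator)
  also have "\<dots> \<le> (\<integral>\<^sup>+x\<in>?Q. frac_maximal 0 (\<lambda>y. w y * indicator ?Q y) x \<partial>lebesgue)"
  proof (intro nn_integral_mono)
    fix x
    show "emeasure ?M ?Q * indicator ?Q x \<le> frac_maximal 0 (\<lambda>y. w y * indicator ?Q y) x * indicator ?Q x"
      using frac_maximal_ge[OF cube _ w order_refl, of x 0] meas
      by (cases "x \<in> ?Q") (auto simp: divide_ennreal_def)
  qed
  also have "\<dots> \<le> A_infinity_const w * emeasure ?M ?Q" by (rule A_infinity_const_ge[OF cube w])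
  finally have "1 * emeasure ?M ?Q \<le> A_infinity_const w * emeasure ?M ?Q" by simp
  then show ?thesis using pos fin
    by (subst (asm) (1 2) mult.commute) (subst (asm) ennreal_mult_le_mult_iff, auto)
qed

definition energy :: "real \<Rightarrow> real \<Rightarrow> (real ^ 'n \<Rightarrow> real) \<Rightarrow> (real ^ 'n \<Rightarrow> real) \<Rightarrow> ennreal" where
  "energy \<delta> p w u = (\<integral>\<^sup>+x. (\<integral>\<^sup>+y. ennreal (\<bar>u x - u y\<bar> powr p / norm (x - y) powr (real CARD('n) + \<delta> * p)) \<partial>lebesgue)
                  * frac_maximal (\<delta> * p) w x \<partial>lebesgue)"

lemma gagliardo_cong_AE:
  assumes "AE x in lborel. u x = u' x"
  shows "AE x in lborel. (\<integral>\<^sup>+y. ennreal (\<bar>u x - u y\<bar> powr p / norm (x - y) powr q) \<partial>lebesgue) = gagliardo p q u' x"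
  using assms
proof eventually_elim
  case (elim x)
  show ?case unfolding gagliardo_def nn_integral_completion
    by (rule nn_integral_cong_AE) (use assms elim in auto)
qed

lemma frac_maximal_ge_cell:
  assumes R: "cube_with_side s R" "x \<in> R" "R \<in> sets borel" and w: "weight w"
  shows "ennreal (s powr \<alpha>) * (emeasure (weight_measure w) R / emeasure lborel R) \<le> frac_maximal \<alpha> w x"
  using frac_maximal_ge[OF R(1,2) w subset_UNIV, of \<alpha>] R(3) by simp

text \<open>
  Both \<open>u\<close> and \<open>w\<close> are replaced by Borel representatives and the cube by the half-open cell that agrees
  with it up to a null set.
\<close>

lemma cube_poincare:
  fixes w u :: "real ^ 'n \<Rightarrow> real"
  assumes w: "weight w" and W: "A_infinity_const w < top" and u: "u \<in> borel_measurable lebesgue"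
    and Q: "cube_with_side s Q" and p: "1 \<le> p" and \<delta>: "0 < \<delta>" "\<delta> < 1"
  shows "\<exists>m. (\<integral>\<^sup>+x\<in>Q. ennreal (\<bar>u x - m\<bar> powr p) \<partial>weight_measure w)
    \<le> ennreal ((1 - \<delta>) * (poincare_const TYPE('n) * p * enn2real (A_infinity_const w)) powr p) * energy \<delta> p w u"
proof -
  have wm [measurable]: "w \<in> borel_measurable lebesgue" using w by (auto simp: weight_def intro: L1_loc_measurable)
  note [measurable] = u
  obtain w' where w' [measurable]: "w' \<in> borel_measurable borel" and wAE: "AE x in lborel. w x = w' x"
    and em: "\<And>B. B \<in> sets borel \<Longrightarrow> emeasure (density lborel (\<lambda>x. ennreal (w' x))) B = emeasure (weight_measure w) B"
    using weight_borel_representative[OF w] by blast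
  obtain u' where "u' \<in> borel_measurable lborel" and uAE: "AE x in lborel. u x = u' x"
    using completion_ex_borel_measurable_real[OF u] by blast
  then have u' [measurable]: "u' \<in> borel_measurable borel" by simp
  have Qm [measurable]: "Q \<in> sets lebesgue" by (rule cube_measurable(1)[OF Q])
  have s: "0 < s" by (rule cube_measurable(3)[OF Q])
  obtain b where b: "AE x in lebesgue. x \<in> Q \<longleftrightarrow> x \<in> dyadic_grid.cell b s 0 b"
    using cube_measurable(4)[OF Q] by blast
  define V where "V = enn2real (A_infinity_const w)"
  have V: "A_infinity_const w = ennreal V" using W by (simp add: V_def)
  have V1: "1 \<le> V" using A_infinity_const_ge_1[OF w] unfolding V by (cases "V \<ge> 0") (auto simp: ennreal_neg)
  interpret dg: dyadic_grid b s by unfold_locales (rule s)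
  let ?w = "\<lambda>x. ennreal (w' x)"
  interpret fujii_wilson_grid b s ?w V
  proof
    show "?w \<in> borel_measurable borel" by simp
    show "emeasure (density lborel ?w) (dg.cell m x) < top" for m x
      by (simp add: em) (intro weight_finite w cube_measurable(1)[OF dg.cell_cube] cube_bounded[OF dg.cell_cube])
    show "0 < V" using V1 by simp
    fix m x
    let ?R = "dg.cell m x"
    have "(\<integral>\<^sup>+y\<in>?R. (SUP k. if dg.cell k y \<subseteq> ?R then emeasure (density lborel ?w) (dg.cell k y) / emeasure lborel (dg.cell k y) else 0) \<partial>lborel)
      \<le> (\<integral>\<^sup>+y\<in>?R. frac_maximal 0 (\<lambda>y. w y * indicator ?R y) y \<partial>lebesgue)"
      unfolding nn_integral_completion
    proof (intro nn_integral_mono mult_right_mono SUP_least)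
      fix y k
      show "(if dg.cell k y \<subseteq> ?R then emeasure (density lborel ?w) (dg.cell k y) / emeasure lborel (dg.cell k y) else 0)
        \<le> frac_maximal 0 (\<lambda>y. w y * indicator ?R y) y"
        using frac_maximal_ge[OF dg.cell_cube[of k y] dg.cell_self w, of ?R 0] s by (auto simp: em)
    qed simp
    also have "\<dots> \<le> ennreal V * emeasure (density lborel ?w) ?R"
      using A_infinity_const_ge[OF dg.cell_cube[of m x] w] by (simp add: V em)
    finally show "(\<integral>\<^sup>+y\<in>?R. (SUP k. if dg.cell k y \<subseteq> ?R then emeasure (density lborel ?w) (dg.cell k y) / emeasure lborel (dg.cell k y) else 0) \<partial>lborel)
      \<le> ennreal V * emeasure (density lborel ?w) ?R" .
  qed
  obtain m where m: "(\<integral>\<^sup>+x\<in>dg.cell 0 b. ennreal (\<bar>u' x - m\<bar> powr p) \<partial>\<mu>)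
    \<le> ennreal ((1 - \<delta>) * (poincare_const TYPE('n) * p * V) powr p) *
      (\<integral>\<^sup>+x\<in>dg.cell 0 b. gagliardo p (real CARD('n) + \<delta> * p) u' x * frac_max (\<delta> * p) x \<partial>lborel)"
    using local_poincare[OF u' p \<delta> V1] by blast
  have "(\<integral>\<^sup>+x\<in>Q. ennreal (\<bar>u x - m\<bar> powr p) \<partial>weight_measure w)
    = (\<integral>\<^sup>+x. ennreal (w x) * (ennreal (\<bar>u x - m\<bar> powr p) * indicator Q x) \<partial>lebesgue)"
    unfolding weight_measure_def by (subst nn_integral_density) auto
  also have "\<dots> = (\<integral>\<^sup>+x. ?w x * (ennreal (\<bar>u' x - m\<bar> powr p) * indicator (dg.cell 0 b) x) \<partial>lborel)"
    unfolding nn_integral_completion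
    by (rule nn_integral_cong_AE) (use wAE uAE b[unfolded AE_completion_iff] in \<open>eventually_elim, auto simp: indicator_def\<close>)
  also have "\<dots> = (\<integral>\<^sup>+x\<in>dg.cell 0 b. ennreal (\<bar>u' x - m\<bar> powr p) \<partial>\<mu>)"
    by (subst nn_integral_density) auto
  finally have eq: "(\<integral>\<^sup>+x\<in>Q. ennreal (\<bar>u x - m\<bar> powr p) \<partial>weight_measure w) = (\<integral>\<^sup>+x\<in>dg.cell 0 b. ennreal (\<bar>u' x - m\<bar> powr p) \<partial>\<mu>)" .
  have "(\<integral>\<^sup>+x\<in>dg.cell 0 b. gagliardo p (real CARD('n) + \<delta> * p) u' x * frac_max (\<delta> * p) x \<partial>lborel) \<le> energy \<delta> p w u"
    unfolding energy_def nn_integral_completion[of lborel "\<lambda>x. _ x * _ x"]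
  proof (rule nn_integral_mono_AE, use gagliardo_cong_AE[OF uAE, of p "real CARD('n) + \<delta> * p"] in eventually_elim)
    case (elim x)
    have "frac_max (\<delta> * p) x \<le> frac_maximal (\<delta> * p) w x"
      unfolding frac_max_def
      by (rule SUP_least) (use frac_maximal_ge_cell[OF dg.cell_cube dg.cell_self dg.cell_borel w] in \<open>simp add: em\<close>)
    then show ?case unfolding elim by (auto simp: indicator_def intro: mult_left_mono)
  qed
  then have "(\<integral>\<^sup>+x\<in>Q. ennreal (\<bar>u x - m\<bar> powr p) \<partial>weight_measure w)
    \<le> ennreal ((1 - \<delta>) * (poincare_const TYPE('n) * p * V) powr p) * energy \<delta> p w u"
    unfolding eq by (rule order_trans[OF m mult_left_mono]) simp
  then show ?thesis unfolding V_def by blast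
qed

lemma weighted_average_eq:
  fixes w u :: "real ^ 'n \<Rightarrow> real"
  assumes w: "weight w" and u [measurable]: "u \<in> borel_measurable lebesgue" and Q [measurable]: "Q \<in> sets lebesgue"
  shows "(LINT x:Q|lebesgue. u x * w x) = (LINT x:Q|weight_measure w. u x)"
proof -
  have wm [measurable]: "w \<in> borel_measurable lebesgue" using w by (auto simp: weight_def intro: L1_loc_measurable)
  have "(LINT x:Q|weight_measure w. u x) = (LINT x|lebesgue. w x *\<^sub>R (indicator Q x *\<^sub>R u x))"
    unfolding set_lebesgue_integral_def weight_measure_def
    by (rule integral_density) (use w in \<open>auto simp: weight_def elim: eventually_mono\<close>)
  then show ?thesis by (simp add: set_lebesgue_integral_def mult_ac)
qed

text \<open>
  The integrands over the exhausting cubes, with the vanishing averages subtracted, converge pointwise,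
  so Fatou's lemma transfers the uniform bound.
\<close>

lemma global_poincare:
  fixes w u :: "real ^ 'n \<Rightarrow> real"
  assumes w: "weight w" and W: "A_infinity_const w < top" and u: "u \<in> F_class w"
    and p: "1 \<le> p" and \<delta>: "0 < \<delta>" "\<delta> < 1"
  shows "(\<integral>\<^sup>+x. ennreal (\<bar>u x\<bar> powr p * w x) \<partial>lebesgue)
    \<le> ennreal ((1 - \<delta>) * (4 * poincare_const TYPE('n) * p * enn2real (A_infinity_const w)) powr p) * energy \<delta> p w u"
proof -
  let ?M = "weight_measure w"
  let ?A = "poincare_const TYPE('n) * p * enn2real (A_infinity_const w)"
  let ?E = "energy \<delta> p w u"
  have A: "0 \<le> ?A" using p by (simp add: poincare_const_def)
  have wm [measurable]: "w \<in> borel_measurable lebesgue" using w by (auto simp: weight_def intro: L1_loc_measurable)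
  have um [measurable]: "u \<in> borel_measurable lebesgue" using u by (auto simp: F_class_def intro: L1_loc_measurable)
  have M [simp]: "sets ?M = sets lebesgue" "space ?M = UNIV" by (simp_all add: weight_measure_def)
  have umM [measurable]: "u \<in> borel_measurable ?M" using um by (simp add: weight_measure_def)
  obtain Q where Q: "\<And>j. Q j \<in> cubes" "incseq Q" "(\<Union>j. Q j) = UNIV"
    and lim: "(\<lambda>j. 1 / measure ?M (Q j) * (LINT x:Q j|lebesgue. u x * w x)) \<longlonglongrightarrow> 0"
    using u by (auto simp: F_class_def)
  have Qs: "\<exists>s. cube_with_side s (Q j)" for j using Q(1)[of j] by (simp add: cubes_def)
  have Qm [measurable]: "Q j \<in> sets lebesgue" for j using Qs[of j] cube_measurable(1) by blast
  define c where "c j = (LINT x:Q j|?M. u x) / measure ?M (Q j)" for j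
  have clim: "c \<longlonglongrightarrow> 0"
    using lim unfolding c_def weighted_average_eq[OF w um Qm] by simp
  have each: "(\<integral>\<^sup>+x\<in>Q j. ennreal (\<bar>u x - c j\<bar> powr p) \<partial>?M) \<le> ennreal ((1 - \<delta>) * (4 * ?A) powr p) * ?E" for j
  proof -
    obtain s where s: "cube_with_side s (Q j)" using Qs by blast
    obtain m where m: "(\<integral>\<^sup>+x\<in>Q j. ennreal (\<bar>u x - m\<bar> powr p) \<partial>?M) \<le> ennreal ((1 - \<delta>) * ?A powr p) * ?E"
      using cube_poincare[OF w W um s p \<delta>] by blast
    have fin: "emeasure ?M (Q j) < top" by (intro weight_finite w Qm cube_bounded[OF s])
    have pos: "0 < emeasure ?M (Q j)"
      using cube_measurable(2,3)[OF s] by (intro weight_positive w Qm) simp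
    have mpos: "0 < measure ?M (Q j)" using fin pos by (simp add: measure_def enn2real_positive_iff)
    have int: "set_integrable ?M (Q j) u"
    proof -
      obtain e where "\<forall>x\<in>Q j. norm x \<le> e" using cube_bounded[OF s] by (auto simp: bounded_iff)
      then have e: "Q j \<subseteq> cball 0 e" by auto
      have "set_integrable ?M (cball 0 e) u" using u by (auto simp: F_class_def L1_loc_def)
      then show ?thesis by (rule set_integrable_subset) (use e in auto)
    qed
    have "(\<integral>\<^sup>+x\<in>Q j. ennreal (\<bar>u x - c j\<bar> powr p) \<partial>?M) \<le> ennreal (4 powr p) * (\<integral>\<^sup>+x\<in>Q j. ennreal (\<bar>u x - m\<bar> powr p) \<partial>?M)"
      unfolding c_def by (rule mean_deviation_powr) (use fin mpos int p in auto)
    also have "\<dots> \<le> ennreal (4 powr p) * (ennreal ((1 - \<delta>) * ?A powr p) * ?E)" by (rule mult_left_mono[OF m]) simp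
    also have "\<dots> = ennreal ((1 - \<delta>) * (4 * ?A) powr p) * ?E"
    proof -
      have "ennreal (4 powr p) * ennreal ((1 - \<delta>) * ?A powr p) = ennreal ((1 - \<delta>) * (4 * ?A) powr p)"
        using \<delta> A powr_mult[of 4 ?A p] by (subst ennreal_mult[symmetric]) (auto simp: mult_ac)
      then show ?thesis by (simp only: mult.assoc[symmetric])
    qed
    finally show ?thesis .
  qed
  have ptw: "ennreal (\<bar>u x\<bar> powr p) = liminf (\<lambda>j. ennreal (\<bar>u x - c j\<bar> powr p) * indicator (Q j) x)" for x
  proof -
    obtain N where N: "x \<in> Q N" using Q(3) by blast
    have "eventually (\<lambda>j. ennreal (\<bar>u x - c j\<bar> powr p) * indicator (Q j) x = ennreal (\<bar>u x - c j\<bar> powr p)) sequentially"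
      by (rule eventually_sequentiallyI[of N]) (use N Q(2) in \<open>auto simp: incseq_def indicator_def\<close>)
    moreover have "(\<lambda>j. \<bar>u x - c j\<bar>) \<longlonglongrightarrow> \<bar>u x - 0\<bar>"
      by (intro tendsto_intros clim)
    then have "(\<lambda>j. \<bar>u x - c j\<bar> powr p) \<longlonglongrightarrow> \<bar>u x\<bar> powr p"
      using p by (intro tendsto_powr') auto
    then have "(\<lambda>j. ennreal (\<bar>u x - c j\<bar> powr p)) \<longlonglongrightarrow> ennreal (\<bar>u x\<bar> powr p)"
      by (rule tendsto_ennrealI)
    ultimately have "(\<lambda>j. ennreal (\<bar>u x - c j\<bar> powr p) * indicator (Q j) x) \<longlonglongrightarrow> ennreal (\<bar>u x\<bar> powr p)"
      by (simp add: tendsto_cong)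
    then show ?thesis by (rule lim_imp_Liminf[OF sequentially_bot, symmetric])
  qed
  have "(\<integral>\<^sup>+x. ennreal (\<bar>u x\<bar> powr p * w x) \<partial>lebesgue) = (\<integral>\<^sup>+x. ennreal (w x) * ennreal (\<bar>u x\<bar> powr p) \<partial>lebesgue)"
    by (intro nn_integral_cong) (simp add: ennreal_mult'' mult.commute)
  also have "\<dots> = (\<integral>\<^sup>+x. ennreal (\<bar>u x\<bar> powr p) \<partial>?M)"
    unfolding weight_measure_def by (subst nn_integral_density) auto
  also have "\<dots> = (\<integral>\<^sup>+x. liminf (\<lambda>j. ennreal (\<bar>u x - c j\<bar> powr p) * indicator (Q j) x) \<partial>?M)"
    using ptw by simp
  also have "\<dots> \<le> liminf (\<lambda>j. \<integral>\<^sup>+x\<in>Q j. ennreal (\<bar>u x - c j\<bar> powr p) \<partial>?M)"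
  proof (rule nn_integral_liminf)
    fix j
    have "(\<lambda>x. ennreal (\<bar>u x - c j\<bar> powr p) * indicator (Q j) x) \<in> borel_measurable lebesgue" by measurable
    then show "(\<lambda>x. ennreal (\<bar>u x - c j\<bar> powr p) * indicator (Q j) x) \<in> borel_measurable ?M"
      by (simp add: weight_measure_def)
  qed
  also have "\<dots> \<le> limsup (\<lambda>j. \<integral>\<^sup>+x\<in>Q j. ennreal (\<bar>u x - c j\<bar> powr p) \<partial>?M)"
    by (rule Liminf_le_Limsup) simp
  also have "\<dots> \<le> ennreal ((1 - \<delta>) * (4 * ?A) powr p) * ?E"
    by (rule Limsup_bounded) (simp add: each)
  finally show ?thesis by (simp add: mult.assoc)
qed

text \<open>
  The fractional maximal function of a weight is positive everywhere, so vanishing energy makes \<open>u\<close> constant almost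
  everywhere; the averages then equal this constant and also tend to zero. The main
  estimate rests on this when its right-hand side could read \<open>\<infinity> * 0\<close>.
\<close>

lemma energy_zero:
  fixes w u :: "real ^ 'n \<Rightarrow> real"
  assumes w: "weight w" and u: "u \<in> F_class w" and E: "energy \<delta> p w u = 0"
  shows "AE x in lebesgue. u x = 0"
proof -
  have wm [measurable]: "w \<in> borel_measurable lebesgue" using w by (auto simp: weight_def intro: L1_loc_measurable)
  have um [measurable]: "u \<in> borel_measurable lebesgue" using u by (auto simp: F_class_def intro: L1_loc_measurable)
  obtain u' where "u' \<in> borel_measurable lborel" and uAE: "AE x in lborel. u x = u' x"
    using completion_ex_borel_measurable_real[OF um] by blast
  then have u' [measurable]: "u' \<in> borel_measurable borel" by simp
  let ?q = "real CARD('n) + \<delta> * p"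
  interpret dyadic_grid "0 :: real ^ 'n" 1 by unfold_locales simp
  define h where "h x = emeasure (weight_measure w) (cell 0 x) / emeasure lborel (cell 0 x)" for x
  have hm [measurable]: "h \<in> borel_measurable borel"
    unfolding h_def by (rule cell_fun_borel[of "\<lambda>R. emeasure (weight_measure w) R / emeasure lborel R" 0])
  have hpos: "0 < h x" for x
    unfolding h_def using weight_positive[OF w, of "cell 0 x"] cube_measurable(1,2)[OF cell_cube[of 0 x]]
    by (simp add: cell_emeasure divide_ennreal_def)
  have "(\<integral>\<^sup>+x. gagliardo p ?q u' x * h x \<partial>lborel) \<le> energy \<delta> p w u"
    unfolding energy_def nn_integral_completion[of lborel "\<lambda>x. _ x * _ x"]
  proof (rule nn_integral_mono_AE, use gagliardo_cong_AE[OF uAE, of p ?q] in eventually_elim)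
    case (elim x)
    have "h x \<le> frac_maximal (\<delta> * p) w x"
      using frac_maximal_ge_cell[OF cell_cube[of 0 x] cell_self cell_borel w, of "\<delta> * p"] by (simp add: h_def)
    then show ?case unfolding elim by (intro mult_left_mono) auto
  qed
  then have "AE x in lborel. gagliardo p ?q u' x * h x = 0"
    using E by (simp add: nn_integral_0_iff_AE)
  then have "AE x in lborel. gagliardo p ?q u' x = 0"
    by eventually_elim (use hpos in \<open>auto simp: less_le\<close>)
  then obtain x where x: "gagliardo p ?q u' x = 0"
    using eventually_happens[of _ "ae_filter lborel"] by (force simp: ae_filter_eq_bot_iff)
  then have "AE y in lborel. ennreal (\<bar>u' x - u' y\<bar> powr p / norm (x - y) powr ?q) = 0"
    unfolding gagliardo_def by (subst (asm) nn_integral_0_iff_AE) auto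
  moreover have "AE y in lborel. y \<noteq> x" by (rule AE_lborel_singleton)
  ultimately have "AE y in lborel. u y = u' x"
    using uAE by eventually_elim (auto simp: ennreal_eq_0_iff divide_le_0_iff not_le)
  then have const: "AE y in lebesgue. u y = u' x" by (rule AE_completion)
  obtain Q where Q: "\<And>j. Q j \<in> cubes"
    and lim: "(\<lambda>j. 1 / measure (weight_measure w) (Q j) * (LINT x:Q j|lebesgue. u x * w x)) \<longlonglongrightarrow> 0"
    using u by (auto simp: F_class_def)
  have "1 / measure (weight_measure w) (Q j) * (LINT x:Q j|lebesgue. u x * w x) = u' x" for j
  proof -
    obtain s where s: "cube_with_side s (Q j)" using Q[of j] by (auto simp: cubes_def)
    have Qm [measurable]: "Q j \<in> sets lebesgue" by (rule cube_measurable(1)[OF s])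
    have fin: "emeasure (weight_measure w) (Q j) < top" by (intro weight_finite w Qm cube_bounded[OF s])
    have pos: "0 < emeasure (weight_measure w) (Q j)"
      using cube_measurable(2,3)[OF s] by (intro weight_positive w Qm) simp
    have "(LINT y:Q j|lebesgue. u y * w y) = (LINT y:Q j|lebesgue. u' x * w y)"
      unfolding set_lebesgue_integral_def by (rule integral_cong_AE) (use const in auto)
    also have "\<dots> = (LINT y:Q j|weight_measure w. u' x)" by (rule weighted_average_eq[OF w]) auto
    also have "\<dots> = u' x * measure (weight_measure w) (Q j)"
      using fin Qm by (simp add: set_lebesgue_integral_def weight_measure_def less_top)
    finally show ?thesis using fin pos by (simp add: measure_def enn2real_positive_iff less_imp_neq[THEN not_sym])
  qed
  then have "u' x = 0" using lim by (simp add: LIMSEQ_const_iff)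
  then show ?thesis using const by simp
qed

lemma ennreal_powr_mono: "x \<le> y \<Longrightarrow> 0 \<le> r \<Longrightarrow> ennreal_powr x r \<le> ennreal_powr y r"
  unfolding ennreal_powr_def
  by (auto simp: top_unique less_top intro!: ennreal_leI powr_mono2 enn2real_mono)

lemma ennreal_powr_ennreal: "0 \<le> x \<Longrightarrow> ennreal_powr (ennreal x) r = ennreal (x powr r)"
  by (simp add: ennreal_powr_def)

theorem corollary2p6:
  shows "\<exists>c::real. 0 < c \<and>
    (\<forall>(\<delta>::real) (p::real) (w :: real ^ 'n \<Rightarrow> real) (u :: real ^ 'n \<Rightarrow> real).
       0 < \<delta> \<longrightarrow> \<delta> < 1 \<longrightarrow> 1 \<le> p \<longrightarrow> w \<in> A_infinity \<longrightarrow> u \<in> F_class w \<longrightarrow>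
       ennreal_powr (\<integral>\<^sup>+x. ennreal (\<bar>u x\<bar> powr p * w x) \<partial>lebesgue) (1 / p)
       \<le> ennreal (c * p * (1 - \<delta>) powr (1 / p)) * A_infinity_const w *
         ennreal_powr
           (\<integral>\<^sup>+x. (\<integral>\<^sup>+y. ennreal (\<bar>u x - u y\<bar> powr p / norm (x - y) powr (real CARD('n) + \<delta> * p)) \<partial>lebesgue)
                  * frac_maximal (\<delta> * p) w x \<partial>lebesgue)
           (1 / p))"
proof (intro exI[of _ "4 * poincare_const TYPE('n)"] conjI allI impI)
  let ?c = "4 * poincare_const TYPE('n)"
  show c: "0 < ?c" by (simp add: poincare_const_def)
  fix \<delta> p :: real and w u :: "real ^ 'n \<Rightarrow> real"
  assume \<delta>: "0 < \<delta>" "\<delta> < 1" and p: "1 \<le> p" and wA: "w \<in> A_infinity" and u: "u \<in> F_class w"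
  have w: "weight w" using wA by (auto simp: A_infinity_def A_class_def)
  let ?L = "\<integral>\<^sup>+x. ennreal (\<bar>u x\<bar> powr p * w x) \<partial>lebesgue" and ?W = "A_infinity_const w" and ?E = "energy \<delta> p w u"
  let ?k = "?c * p * (1 - \<delta>) powr (1 / p)"
  have k: "0 < ?k" using c p \<delta> by simp
  have W1: "1 \<le> ?W" by (rule A_infinity_const_ge_1[OF w])
  have "ennreal_powr ?L (1 / p) \<le> ennreal ?k * ?W * ennreal_powr ?E (1 / p)"
  proof (cases "?E = 0")
    case True
    have "AE x in lebesgue. u x = 0" by (rule energy_zero[OF w u True])
    then have "AE x in lebesgue. ennreal (\<bar>u x\<bar> powr p * w x) = 0" by eventually_elim simp
    then have "?L = (\<integral>\<^sup>+(x :: real ^ 'n). 0 \<partial>lebesgue)" by (rule nn_integral_cong_AE)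
    then show ?thesis using p by (simp add: ennreal_powr_def)
  next
    case E0: False
    show ?thesis
    proof (cases "?E = top \<or> ?W = top")
      case True
      \<comment> \<open>All factors on the right are nonzero and one of them is infinite.\<close>
      have "ennreal_powr ?E (1 / p) \<noteq> 0"
        using E0 by (cases ?E) (auto simp: ennreal_powr_def ennreal_eq_0_iff not_le)
      moreover have "?W \<noteq> 0" using W1 by auto
      moreover have "ennreal_powr ?E (1 / p) = top \<or> ?W = top" using True by (auto simp: ennreal_powr_def)
      ultimately have "ennreal ?k * ?W * ennreal_powr ?E (1 / p) = top"
        using k by (auto simp: ennreal_mult_eq_top_iff)
      then show ?thesis by (simp only: top_greatest)
    next
      case False
      define V where "V = enn2real ?W"
      have V: "?W = ennreal V" "0 \<le> V" using False by (auto simp: V_def less_top)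
      obtain e where e: "?E = ennreal e" "0 \<le> e" using False by (cases ?E) auto
      have "?L \<le> ennreal ((1 - \<delta>) * (?c * p * V) powr p) * ?E"
        unfolding V_def by (rule global_poincare) (use w False u p \<delta> in \<open>auto simp: less_top\<close>)
      also have "\<dots> = ennreal ((1 - \<delta>) * (?c * p * V) powr p * e)"
        using e \<delta> by (simp add: ennreal_mult)
      finally have "ennreal_powr ?L (1 / p) \<le> ennreal_powr (ennreal ((1 - \<delta>) * (?c * p * V) powr p * e)) (1 / p)"
        by (rule ennreal_powr_mono) (use p in simp)
      also have "\<dots> = ennreal (((1 - \<delta>) * (?c * p * V) powr p * e) powr (1 / p))"
        by (rule ennreal_powr_ennreal) (use \<delta> e in simp)
      also have "((1 - \<delta>) * (?c * p * V) powr p * e) powr (1 / p) = ?k * V * e powr (1 / p)"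
        using \<delta> c p V(2) e(2) by (simp add: powr_mult powr_powr mult_ac)
      also have "ennreal (?k * V * e powr (1 / p)) = ennreal ?k * ?W * ennreal_powr ?E (1 / p)"
        unfolding V(1) e(1) ennreal_powr_ennreal[OF e(2)] using k V(2) by (simp only: ennreal_mult' ennreal_mult powr_ge_zero mult_nonneg_nonneg less_imp_le)
      finally show ?thesis .
    qed
  qed
  then show "ennreal_powr ?L (1 / p) \<le> ennreal ?k * ?W * ennreal_powr
           (\<integral>\<^sup>+x. (\<integral>\<^sup>+y. ennreal (\<bar>u x - u y\<bar> powr p / norm (x - y) powr (real CARD('n) + \<delta> * p)) \<partial>lebesgue)
                  * frac_maximal (\<delta> * p) w x \<partial>lebesgue) (1 / p)"
    unfolding energy_def .
qed

end
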